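(* Let $(M,h)$ be a Hermitian manifold of complex dimension $n$ with background Riemannian metric $g=\mathrm{Re}\,h$ and complex structure $J$. Let $D$ be the metric connection on $TM$ induced by the Chern connection of $(M,h)$ under the bundle isomorphism $u\mapsto u_o=\frac12(u-\sqrt{-1}Ju)$ from $TM$ to $T^{1,0}M$, and let $D^2$ be its curvature. Then for arbitrary tangent vectors $u,v\in TM$ (at the same point), writing $\xi=u_o=\xi^\alpha\frac{\partial}{\partial z^\alpha}$ and $\eta=v_o=\eta^\alpha\frac{\partial}{\partial z^\alpha}$ in local holomorphic coordinates, we have $$g\big((D^2u)(v,u),v\big)=\frac12\,\mathfrak R_{\alpha\bar\beta\gamma\bar\delta}\,\big(\xi^\alpha\bar\eta^\beta-\eta^\alpha\bar\xi^\beta\big)\big(\eta^\gamma\bar\xi^\delta-\xi^\gamma\bar\eta^\delta\big),$$ where $\mathfrak R_{\alpha\bar\beta\gamma\bar\delta}$ are the components of the curvature tensor of the Chern connection. In particular, $$g\big((D^2u)(Ju,u),Ju\big)=2\,\mathfrak R_{\alpha\bar\beta\gamma\bar\delta}\,\xi^\alpha\bar\xi^\beta\xi^\gamma\bar\xi^\delta .$$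
   Context: Greek indices run from $1$ to $n$, and repeated indices are summed. Local holomorphic coordinates are $z^\alpha=x^\alpha+\sqrt{-1}x^{n+\alpha}$. The Hermitian metric is $h=h_{\alpha\bar\beta}\,dz^\alpha d\bar z^\beta$, and $g=\mathrm{Re}\,h$, so that $g(u,v)=\mathrm{Re}(h_{\alpha\bar\beta}\xi^\alpha\bar\eta^\beta)$ for $\xi=u_o,\ \eta=v_o$. $(h^{\bar\beta\alpha})$ denotes the inverse matrix of $(h_{\alpha\bar\beta})$. The Chern connection is the unique connection on the holomorphic tangent bundle $T^{1,0}M$ compatible with $h$ and with the complex (holomorphic) structure; its connection 1-forms are $\theta^\alpha_\beta=h^{\bar\lambda\alpha}\frac{\partial h_{\beta\bar\lambda}}{\partial z^\gamma}dz^\gamma$, i.e. $D\frac{\partial}{\partial z^\beta}=\theta_\beta^\alpha\otimes\frac{\partial}{\partial z^\alpha}$. Its curvature components are $$\mathfrak R_{\alpha\bar\beta\gamma\bar\delta}=-\frac{\partial^2h_{\alpha\bar\beta}}{\partial z^\gamma\partial\bar z^\delta}+\frac{\partial h_{\alpha\bar\lambda}}{\partial z^\gamma}h^{\bar\lambda\kappa}\frac{\partial h_{\kappa\bar\beta}}{\partial\bar z^\delta}.$$ The induced metric connection, still denoted $D$, is the connection on the real tangent bundle $TM$ obtained by transporting the Chern connection through the bundle isomorphism $u\mapsto u_o$, i.e. $(D_vu)_o=D_v(u_o)$ for real vector fields $u,v$. It is compatible with $g$ but in general has torsion. Its curvature is $(D^2u)(v,w)=D_vD_wu-D_wD_vu-D_{[v,w]}u$,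 which is tensorial in $u,v,w$. *)

theory Defs
  imports "HOL-Analysis.Analysis" "HOL-Library.Function_Algebras"
begin

section \<open>Smooth and holomorphic functions on open sets of complex n-space\<close>

primrec Ck_on :: "nat \<Rightarrow> 'e::real_normed_vector set \<Rightarrow> ('e \<Rightarrow> 'f::real_normed_vector) \<Rightarrow> bool" where
  "Ck_on 0 W F \<longleftrightarrow> continuous_on W F"
| "Ck_on (Suc k) W F \<longleftrightarrow>
     (\<forall>x\<in>W. F differentiable (at x)) \<and> (\<forall>v. Ck_on k W (\<lambda>x. frechet_derivative F (at x) v))"

text \<open>Real smoothness; used for open sets in finite-dimensional spaces only.\<close>

definition smooth_on :: "'e::real_normed_vector set \<Rightarrow> ('e \<Rightarrow> 'f::real_normed_vector) \<Rightarrow> bool" where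
  "smooth_on W F \<longleftrightarrow> (\<forall>k. Ck_on k W F)"

text \<open>A holomorphic function of several variables is a smooth function satisfying the
  Cauchy-Riemann equations, i.e. whose real derivative is complex linear.\<close>

definition holomorphic_vec_on :: "(complex ^ 'n) set \<Rightarrow> (complex ^ 'n \<Rightarrow> complex) \<Rightarrow> bool" where
  "holomorphic_vec_on W F \<longleftrightarrow> smooth_on W F \<and>
     (\<forall>z\<in>W. \<forall>v. frechet_derivative F (at z) (\<i> *s v) = \<i> * frechet_derivative F (at z) v)"


section \<open>Complex manifolds\<close>

text \<open>A chart is a coordinate domain together with the coordinate map
  \<open>z = (z\<^sup>\<alpha>)\<close>; only the values of the map on the domain matter.  The underlying real
  coordinates are the real and imaginary parts of the \<open>z\<^sup>\<alpha>\<close>.\<close>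

type_synonym ('a, 'n) chart = "'a set \<times> ('a \<Rightarrow> complex ^ 'n)"

abbreviation dom_of :: "('a, 'n) chart \<Rightarrow> 'a set" where
  "dom_of c \<equiv> fst c"

abbreviation coord :: "('a, 'n) chart \<Rightarrow> 'a \<Rightarrow> complex ^ 'n" where
  "coord c \<equiv> snd c"

abbreviation inv_coord :: "('a, 'n) chart \<Rightarrow> complex ^ 'n \<Rightarrow> 'a" where
  "inv_coord c \<equiv> inv_into (dom_of c) (coord c)"

definition is_chart :: "('a::topological_space, 'n::finite) chart \<Rightarrow> bool" where
  "is_chart c \<longleftrightarrow> open (dom_of c) \<and> open (coord c ` dom_of c) \<and>
     homeomorphism (dom_of c) (coord c ` dom_of c) (coord c) (inv_coord c)"

definition holomorphic_transition :: "('a, 'n::finite) chart \<Rightarrow> ('a, 'n) chart \<Rightarrow> bool" where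
  "holomorphic_transition c c' \<longleftrightarrow>
     (\<forall>\<alpha>. holomorphic_vec_on (coord c ` (dom_of c \<inter> dom_of c'))
            (\<lambda>z. coord c' (inv_coord c z) $ \<alpha>))"

definition compatible_charts :: "('a, 'n::finite) chart \<Rightarrow> ('a, 'n) chart \<Rightarrow> bool" where
  "compatible_charts c c' \<longleftrightarrow> holomorphic_transition c c' \<and> holomorphic_transition c' c"

text \<open>The manifold is the type \<open>'a\<close> with a maximal holomorphic atlas; its complex
  dimension is \<open>CARD('n)\<close>.\<close>

definition complex_manifold ::
  "('a::{t2_space, second_countable_topology}, 'n::finite) chart set \<Rightarrow> bool" where
  "complex_manifold A \<longleftrightarrow>
     (\<forall>c\<in>A. is_chart c) \<and>
     (\<Union>c\<in>A. dom_of c) = UNIV \<and>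
     (\<forall>c\<in>A. \<forall>c'\<in>A. compatible_charts c c') \<and>
     (\<forall>c. is_chart c \<and> (\<forall>c'\<in>A. compatible_charts c c') \<longrightarrow> c \<in> A)"

definition smooth_fun :: "('a, 'n::finite) chart set \<Rightarrow> 'a set \<Rightarrow> ('a \<Rightarrow> complex) \<Rightarrow> bool" where
  "smooth_fun A S f \<longleftrightarrow>
     (\<forall>c\<in>A. smooth_on (coord c ` (dom_of c \<inter> S)) (\<lambda>z. f (inv_coord c z)))"

definition holomorphic_fun :: "('a, 'n::finite) chart set \<Rightarrow> 'a set \<Rightarrow> ('a \<Rightarrow> complex) \<Rightarrow> bool" where
  "holomorphic_fun A S f \<longleftrightarrow>
     (\<forall>c\<in>A. holomorphic_vec_on (coord c ` (dom_of c \<inter> S)) (\<lambda>z. f (inv_coord c z)))"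

definition smooth_near ::
  "('a::topological_space, 'n::finite) chart set \<Rightarrow> 'a \<Rightarrow> ('a \<Rightarrow> complex) \<Rightarrow> bool" where
  "smooth_near A p f \<longleftrightarrow> (\<exists>S. open S \<and> p \<in> S \<and> smooth_fun A S f)"


section \<open>Tangent vectors\<close>

text \<open>A complexified tangent vector at \<open>p\<close> is represented by its action on complex-valued
  functions that are smooth near \<open>p\<close>, and is put to \<open>0\<close> on all other functions, so that
  equality of vectors is equality of operators.  Sums and differences of vectors
  are the pointwise ones of functions.\<close>

type_synonym 'a tvec = "('a \<Rightarrow> complex) \<Rightarrow> complex"
type_synonym 'a field = "'a \<Rightarrow> 'a tvec"

definition scale_vec :: "complex \<Rightarrow> 'a tvec \<Rightarrow> 'a tvec" (infixr "\<odot>" 75) where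
  "a \<odot> X = (\<lambda>f. a * X f)"

text \<open>The real tangent vector with components \<open>w\<close> in the chart \<open>c\<close>: the real coordinate
  vector fields are \<open>\<partial>/\<partial>x\<^sup>\<alpha> = dir_deriv A c p (axis \<alpha> 1)\<close> and
  \<open>\<partial>/\<partial>x\<^sup>n\<^sup>+\<^sup>\<alpha> = dir_deriv A c p (axis \<alpha> \<i>)\<close>.\<close>

definition dir_deriv ::
  "('a::topological_space, 'n::finite) chart set \<Rightarrow> ('a, 'n) chart \<Rightarrow> 'a \<Rightarrow> complex ^ 'n \<Rightarrow> 'a tvec" where
  "dir_deriv A c p w =
     (\<lambda>f. if smooth_near A p f
          then frechet_derivative (\<lambda>z. f (inv_coord c z)) (at (coord c p)) w else 0)"

text \<open>The real tangent space \<open>T\<^sub>pM\<close>.\<close>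

definition tangent :: "('a::topological_space, 'n::finite) chart set \<Rightarrow> 'a \<Rightarrow> 'a tvec set" where
  "tangent A p = {dir_deriv A c p w | c w. c \<in> A \<and> p \<in> dom_of c}"

text \<open>The complex structure: \<open>J(\<partial>/\<partial>x\<^sup>\<alpha>) = \<partial>/\<partial>x\<^sup>n\<^sup>+\<^sup>\<alpha>\<close> and
  \<open>J(\<partial>/\<partial>x\<^sup>n\<^sup>+\<^sup>\<alpha>) = -\<partial>/\<partial>x\<^sup>\<alpha>\<close> in any holomorphic chart.\<close>

definition J_map :: "('a::topological_space, 'n::finite) chart set \<Rightarrow> 'a \<Rightarrow> 'a tvec \<Rightarrow> 'a tvec" where
  "J_map A p X =
     (THE Y. \<exists>c\<in>A. p \<in> dom_of c \<and> (\<exists>w. X = dir_deriv A c p w \<and> Y = dir_deriv A c p (\<i> *s w)))"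

text \<open>The coordinate vectors \<open>\<partial>/\<partial>z\<^sup>\<alpha>\<close> and their conjugates.\<close>

definition d_z ::
  "('a::topological_space, 'n::finite) chart set \<Rightarrow> ('a, 'n) chart \<Rightarrow> 'n \<Rightarrow> 'a field" where
  "d_z A c \<alpha> p =
     (1/2) \<odot> (dir_deriv A c p (axis \<alpha> 1) - \<i> \<odot> dir_deriv A c p (axis \<alpha> \<i>))"

definition d_zbar ::
  "('a::topological_space, 'n::finite) chart set \<Rightarrow> ('a, 'n) chart \<Rightarrow> 'n \<Rightarrow> 'a field" where
  "d_zbar A c \<alpha> p =
     (1/2) \<odot> (dir_deriv A c p (axis \<alpha> 1) + \<i> \<odot> dir_deriv A c p (axis \<alpha> \<i>))"

text \<open>The fibre at \<open>p\<close> of the holomorphic tangent bundle \<open>T\<^sup>1\<^sup>,\<^sup>0M\<close>.\<close>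

definition tangent10 :: "('a::topological_space, 'n::finite) chart set \<Rightarrow> 'a \<Rightarrow> 'a tvec set" where
  "tangent10 A p = {\<Sum>\<alpha>\<in>UNIV. \<zeta> \<alpha> \<odot> d_z A c \<alpha> p | c \<zeta>. c \<in> A \<and> p \<in> dom_of c}"

text \<open>The isomorphism \<open>u \<mapsto> u\<^sub>o\<close> from \<open>TM\<close> to \<open>T\<^sup>1\<^sup>,\<^sup>0M\<close>.\<close>

definition to10 :: "('a::topological_space, 'n::finite) chart set \<Rightarrow> 'a \<Rightarrow> 'a tvec \<Rightarrow> 'a tvec" where
  "to10 A p X = (1/2) \<odot> (X - \<i> \<odot> J_map A p X)"

text \<open>Smooth sections, over an open set \<open>S\<close>, of a bundle with fibres \<open>E p\<close> (which will be
  \<open>tangent A p\<close> or \<open>tangent10 A p\<close>).\<close>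

definition smooth_section ::
  "('a::topological_space, 'n::finite) chart set \<Rightarrow> ('a \<Rightarrow> 'a tvec set) \<Rightarrow> 'a set \<Rightarrow> 'a field \<Rightarrow> bool" where
  "smooth_section A E S s \<longleftrightarrow> (\<forall>p\<in>S. s p \<in> E p) \<and>
     (\<forall>S' f. open S' \<and> S' \<subseteq> S \<and> smooth_fun A S' f \<longrightarrow> smooth_fun A S' (\<lambda>p. s p f))"

definition holomorphic_section ::
  "('a::topological_space, 'n::finite) chart set \<Rightarrow> 'a set \<Rightarrow> 'a field \<Rightarrow> bool" where
  "holomorphic_section A S s \<longleftrightarrow> smooth_section A (tangent10 A) S s \<and>
     (\<forall>S' f. open S' \<and> S' \<subseteq> S \<and> holomorphic_fun A S' f \<longrightarrow> holomorphic_fun A S' (\<lambda>p. s p f))"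

definition lie_bracket ::
  "('a::topological_space, 'n::finite) chart set \<Rightarrow> 'a field \<Rightarrow> 'a field \<Rightarrow> 'a field" where
  "lie_bracket A v w p =
     (\<lambda>f. if smooth_near A p f then v p (\<lambda>q. w q f) - w p (\<lambda>q. v q f) else 0)"


section \<open>Hermitian metrics\<close>

definition hermitian_metric ::
  "('a::topological_space, 'n::finite) chart set \<Rightarrow> ('a \<Rightarrow> 'a tvec \<Rightarrow> 'a tvec \<Rightarrow> complex) \<Rightarrow> bool" where
  "hermitian_metric A h \<longleftrightarrow>
     (\<forall>p. \<forall>X\<in>tangent10 A p. \<forall>Y\<in>tangent10 A p. \<forall>Z\<in>tangent10 A p. \<forall>a b.
        h p (a \<odot> X + b \<odot> Y) Z = a * h p X Z + b * h p Y Z) \<and>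
     (\<forall>p. \<forall>X\<in>tangent10 A p. \<forall>Y\<in>tangent10 A p. h p Y X = cnj (h p X Y)) \<and>
     (\<forall>p. \<forall>X\<in>tangent10 A p. X \<noteq> 0 \<longrightarrow> Re (h p X X) > 0) \<and>
     (\<forall>S s t. open S \<and> smooth_section A (tangent10 A) S s \<and> smooth_section A (tangent10 A) S t
        \<longrightarrow> smooth_fun A S (\<lambda>p. h p (s p) (t p)))"

definition hermitian_manifold ::
  "('a::{t2_space, second_countable_topology}, 'n::finite) chart set
     \<Rightarrow> ('a \<Rightarrow> 'a tvec \<Rightarrow> 'a tvec \<Rightarrow> complex) \<Rightarrow> bool" where
  "hermitian_manifold A h \<longleftrightarrow> complex_manifold A \<and> hermitian_metric A h"

text \<open>The background metric \<open>g = Re h\<close>.\<close>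

definition g_metric ::
  "('a::topological_space, 'n::finite) chart set \<Rightarrow> ('a \<Rightarrow> 'a tvec \<Rightarrow> 'a tvec \<Rightarrow> complex)
     \<Rightarrow> 'a \<Rightarrow> 'a tvec \<Rightarrow> 'a tvec \<Rightarrow> real" where
  "g_metric A h p X Y = Re (h p (to10 A p X) (to10 A p Y))"

text \<open>The matrix \<open>h\<^sub>\<alpha>\<^sub>\<beta>\<close> (second index conjugate) in a chart.\<close>

definition h_matrix ::
  "('a::topological_space, 'n::finite) chart set \<Rightarrow> ('a \<Rightarrow> 'a tvec \<Rightarrow> 'a tvec \<Rightarrow> complex)
     \<Rightarrow> ('a, 'n) chart \<Rightarrow> 'a \<Rightarrow> complex ^ 'n ^ 'n" where
  "h_matrix A h c p = (\<chi> \<alpha> \<beta>. h p (d_z A c \<alpha> p) (d_z A c \<beta> p))"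

text \<open>The curvature components of the Chern connection; the second and the
  fourth index are the conjugate ones.\<close>

definition chern_curvature ::
  "('a::topological_space, 'n::finite) chart set \<Rightarrow> ('a \<Rightarrow> 'a tvec \<Rightarrow> 'a tvec \<Rightarrow> complex)
     \<Rightarrow> ('a, 'n) chart \<Rightarrow> 'a \<Rightarrow> 'n \<Rightarrow> 'n \<Rightarrow> 'n \<Rightarrow> 'n \<Rightarrow> complex" where
  "chern_curvature A h c p \<alpha> \<beta> \<gamma> \<delta> =
     - d_z A c \<gamma> p (\<lambda>q. d_zbar A c \<delta> q (\<lambda>r. h_matrix A h c r $ \<alpha> $ \<beta>))
     + (\<Sum>\<mu>\<in>UNIV. \<Sum>\<kappa>\<in>UNIV.
          d_z A c \<gamma> p (\<lambda>q. h_matrix A h c q $ \<alpha> $ \<mu>)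
          * matrix_inv (h_matrix A h c p) $ \<mu> $ \<kappa>
          * d_zbar A c \<delta> p (\<lambda>q. h_matrix A h c q $ \<kappa> $ \<beta>))"


section \<open>Connections\<close>

text \<open>\<open>D s p X\<close> is the value at \<open>p\<close> of the covariant derivative of the section \<open>s\<close> in the
  direction of the real tangent vector \<open>X\<close> at \<open>p\<close>.  A connection acts on local sections:
  the value at \<open>p\<close> is only meaningful if \<open>s\<close> is a smooth section near \<open>p\<close>, and the last
  clause is the compatibility with restriction to open subsets.\<close>

type_synonym 'a conn = "'a field \<Rightarrow> 'a \<Rightarrow> 'a tvec \<Rightarrow> 'a tvec"

definition connection10 :: "('a::topological_space, 'n::finite) chart set \<Rightarrow> 'a conn \<Rightarrow> bool" where
  "connection10 A D \<longleftrightarrow>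
     (\<forall>S s. open S \<and> smooth_section A (tangent10 A) S s \<longrightarrow>
        (\<forall>p\<in>S. \<forall>X\<in>tangent A p. D s p X \<in> tangent10 A p) \<and>
        (\<forall>v. smooth_section A (tangent A) S v \<longrightarrow>
           smooth_section A (tangent10 A) S (\<lambda>p. D s p (v p))) \<and>
        (\<forall>p\<in>S. \<forall>X\<in>tangent A p. \<forall>Y\<in>tangent A p. \<forall>a b :: real.
           D s p (of_real a \<odot> X + of_real b \<odot> Y) = of_real a \<odot> D s p X + of_real b \<odot> D s p Y) \<and>
        (\<forall>t. smooth_section A (tangent10 A) S t \<longrightarrow>
           (\<forall>p\<in>S. \<forall>X\<in>tangent A p. D (\<lambda>q. s q + t q) p X = D s p X + D t p X)) \<and>
        (\<forall>f. smooth_fun A S f \<longrightarrow>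
           (\<forall>p\<in>S. \<forall>X\<in>tangent A p. D (\<lambda>q. f q \<odot> s q) p X = X f \<odot> s p + f p \<odot> D s p X)) \<and>
        (\<forall>t. (\<forall>q\<in>S. t q = s q) \<longrightarrow> (\<forall>p\<in>S. \<forall>X\<in>tangent A p. D t p X = D s p X)))"

definition metric_compatible ::
  "('a::topological_space, 'n::finite) chart set \<Rightarrow> ('a \<Rightarrow> 'a tvec \<Rightarrow> 'a tvec \<Rightarrow> complex)
     \<Rightarrow> 'a conn \<Rightarrow> bool" where
  "metric_compatible A h D \<longleftrightarrow>
     (\<forall>S s t. open S \<and> smooth_section A (tangent10 A) S s \<and> smooth_section A (tangent10 A) S t \<longrightarrow>
        (\<forall>p\<in>S. \<forall>X\<in>tangent A p.
           X (\<lambda>q. h q (s q) (t q)) = h p (D s p X) (t p) + h p (s p) (D t p X)))"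

text \<open>Compatibility with the holomorphic structure: the \<open>(0,1)\<close>-part of \<open>D\<close> annihilates
  holomorphic sections, i.e. the complex linear extension of \<open>D s\<close> vanishes on the vectors
  \<open>X + \<i> JX\<close> of type \<open>(0,1)\<close>.\<close>

definition holomorphically_compatible ::
  "('a::topological_space, 'n::finite) chart set \<Rightarrow> 'a conn \<Rightarrow> bool" where
  "holomorphically_compatible A D \<longleftrightarrow>
     (\<forall>S s. open S \<and> holomorphic_section A S s \<longrightarrow>
        (\<forall>p\<in>S. \<forall>X\<in>tangent A p. D s p X + \<i> \<odot> D s p (J_map A p X) = 0))"

definition chern_connection ::
  "('a::topological_space, 'n::finite) chart set \<Rightarrow> ('a \<Rightarrow> 'a tvec \<Rightarrow> 'a tvec \<Rightarrow> complex)
     \<Rightarrow> 'a conn \<Rightarrow> bool" where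
  "chern_connection A h D \<longleftrightarrow>
     connection10 A D \<and> metric_compatible A h D \<and> holomorphically_compatible A D"

text \<open>The connection on \<open>TM\<close> induced by \<open>D\<close> through \<open>u \<mapsto> u\<^sub>o\<close>.\<close>

definition induced_connection ::
  "('a::topological_space, 'n::finite) chart set \<Rightarrow> 'a conn \<Rightarrow> 'a conn" where
  "induced_connection A D u p X =
     (THE Y. Y \<in> tangent A p \<and> to10 A p Y = D (\<lambda>q. to10 A q (u q)) p X)"

definition curvature_fields ::
  "('a::topological_space, 'n::finite) chart set \<Rightarrow> 'a conn
     \<Rightarrow> 'a field \<Rightarrow> 'a field \<Rightarrow> 'a field \<Rightarrow> 'a field" where
  "curvature_fields A D u v w p =
     D (\<lambda>q. D u q (w q)) p (v p) - D (\<lambda>q. D u q (v q)) p (w p) - D u p (lie_bracket A v w p)"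

text \<open>The curvature tensor \<open>(D\<^sup>2u)(v,w)\<close> of a connection on \<open>TM\<close> at tangent vectors
  \<open>u, v, w\<close> at \<open>p\<close>: the common value, for all local extensions of \<open>u, v, w\<close> to smooth vector
  fields, of the curvature expression at \<open>p\<close>.\<close>

definition curvature ::
  "('a::topological_space, 'n::finite) chart set \<Rightarrow> 'a conn
     \<Rightarrow> 'a \<Rightarrow> 'a tvec \<Rightarrow> 'a tvec \<Rightarrow> 'a tvec \<Rightarrow> 'a tvec" where
  "curvature A D p u v w =
     (THE r. \<forall>S u' v' w'. open S \<and> p \<in> S \<and> smooth_section A (tangent A) S u' \<and>
        smooth_section A (tangent A) S v' \<and> smooth_section A (tangent A) S w' \<and>
        u' p = u \<and> v' p = v \<and> w' p = w \<longrightarrow> curvature_fields A D u' v' w' p = r)"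

end

theory Submission
  imports Defs
begin

text \<open>
  In a holomorphic chart, holomorphic compatibility makes the Chern covariant derivative of a
  coordinate field complex linear in the direction, so the connection is given by matrices
  \<open>\<Gamma>\<^sub>\<gamma>\<close>, and metric compatibility reads \<open>P\<^sub>\<gamma> h = \<Gamma>\<^sub>\<gamma> h\<close> and \<open>Q\<^sub>\<delta> h = h \<Gamma>\<^sub>\<delta>\<^sup>*\<close>, where \<open>P\<^sub>\<gamma>\<close> and
  \<open>Q\<^sub>\<delta>\<close> are the derivatives along the \<open>\<gamma>\<close>-th holomorphic and the \<open>\<delta>\<close>-th antiholomorphic
  coordinate.  The curvature of the induced connection is
  \<open>\<partial>\<^sub>v \<Gamma>\<^sub>w - \<partial>\<^sub>w \<Gamma>\<^sub>v + [\<Gamma>\<^sub>w, \<Gamma>\<^sub>v]\<close>.  Its (2,0)-part vanishes because \<open>P\<^sub>\<delta> P\<^sub>\<gamma> h\<close> is symmetric, and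
  the remaining (1,1)-part, multiplied by \<open>h\<close>, has components \<open>-(Q\<^sub>\<delta> \<Gamma>\<^sub>\<gamma>) h\<close>; since \<open>P\<^sub>\<gamma>\<close> and \<open>Q\<^sub>\<delta>\<close>
  commute, these are the Chern curvature components.  The formula for \<open>g = Re h\<close> is half the sum
  of the resulting expression and its conjugate.
\<close>

section \<open>Calculus of smooth functions\<close>

text \<open>Vectors are operators with default value 0 on functions that are not smooth near the
  point, so sum and Leibniz rules hold only under smoothness conditions;
  \<open>derivation_at\<close> and \<open>smooth_near\<close> carry these. \<open>J_map\<close>,
  \<open>induced_connection\<close> and \<open>curvature\<close> are definite descriptions, and each
  needs a unique value before anything can be computed. Coordinate functions settle this: a vector
  is determined by its values on them. Moreover \<open>to10\<close> leaves the components unchanged,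
  so the induced connection on real fields has the same component formula as the Chern connection in
  the frame of the \<open>d_z\<close>. The connection may have torsion; the bracket serves only to
  cancel the derivatives of the components of v and w. A real direction has conjugate components of
  types (1,0) and (0,1), which is why the (1,1)-part comes with a difference of products of one
  component and one conjugate. Hermitian symmetry of the curvature makes the conjugate of the
  pairing a sum of the same shape, and this produces the other difference factor in the
  formula.\<close>

lemma frechet_derivative_eq:
  "(F has_derivative F') (at x) \<Longrightarrow> frechet_derivative F (at x) v = F' v"
  by (drule frechet_derivative_at) simp

lemma Ck_on_subset: "Ck_on k W F \<Longrightarrow> V \<subseteq> W \<Longrightarrow> Ck_on k V F"
proof (induction k arbitrary: F)
  case 0
  then show ?case by (simp add: continuous_on_subset)
qed (simp add: subset_iff)

lemma Ck_on_SucD: "Ck_on (Suc k) W F \<Longrightarrow> Ck_on k W F"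
proof (induction k arbitrary: F)
  case 0
  then show ?case
    by (simp add: differentiable_imp_continuous_within continuous_at_imp_continuous_on)
qed simp

text \<open>Derivatives are taken in the full space, not within \<open>W\<close>. Openness makes
  agreement on \<open>W\<close> agreement near each of its points, so the derivatives agree on
  \<open>W\<close> as well and the induction goes on.\<close>

lemma Ck_on_cong:
  assumes "open W" "\<And>x. x \<in> W \<Longrightarrow> F x = G x" "Ck_on k W F"
  shows "Ck_on k W G"
  using assms(2,3)
proof (induction k arbitrary: F G)
  case 0
  then show ?case using continuous_on_cong[of W W F G] by simp
next
  case (Suc k)
  have hd: "(G has_derivative frechet_derivative F (at x)) (at x)" if "x \<in> W" for x
  proof (rule has_derivative_transform_within_open[OF _ \<open>open W\<close> that])
    show "(F has_derivative frechet_derivative F (at x)) (at x)"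
      using Suc.prems(2) that by (simp flip: frechet_derivative_works)
  qed (rule Suc.prems(1))
  have "Ck_on k W (\<lambda>x. frechet_derivative G (at x) v)" for v
  proof (rule Suc.IH)
    show "frechet_derivative F (at x) v = frechet_derivative G (at x) v" if "x \<in> W" for x
      using frechet_derivative_eq[OF hd[OF that]] by simp
    show "Ck_on k W (\<lambda>x. frechet_derivative F (at x) v)"
      using Suc.prems(2) by simp
  qed
  moreover have "G differentiable (at x)" if "x \<in> W" for x
    using hd[OF that] by (rule differentiableI)
  ultimately show ?case by simp
qed

text \<open>Admits a derivative given by an explicit formula in place of
  \<open>frechet_derivative\<close>; the closure rules below take the formula from the sum, product
  and chain rules.\<close>

lemma Ck_on_SucI:
  assumes "open W" "\<And>x. x \<in> W \<Longrightarrow> (F has_derivative F' x) (at x)" "\<And>v. Ck_on k W (\<lambda>x. F' x v)"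
  shows "Ck_on (Suc k) W F"
proof -
  have "Ck_on k W (\<lambda>x. frechet_derivative F (at x) v)" for v
    by (rule Ck_on_cong[OF assms(1) _ assms(3)]) (simp add: frechet_derivative_eq[OF assms(2)])
  moreover have "F differentiable (at x)" if "x \<in> W" for x
    using assms(2)[OF that] by (rule differentiableI)
  ultimately show ?thesis by simp
qed

lemma Ck_on_const: "open W \<Longrightarrow> Ck_on k W (\<lambda>x. c)"
proof (induction k arbitrary: c)
  case (Suc k)
  then show ?case by (intro Ck_on_SucI[where F' = "\<lambda>x v. 0"]) auto
qed auto

lemma Ck_on_derivative:
  assumes "Ck_on (Suc k) W F" "x \<in> W"
  shows "(F has_derivative frechet_derivative F (at x)) (at x)"
  using assms by (simp flip: frechet_derivative_works)

lemma Ck_on_bounded_linear: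
  assumes "bounded_linear L" "open W" "Ck_on k W F"
  shows "Ck_on k W (\<lambda>x. L (F x))"
  using assms(3)
proof (induction k arbitrary: F)
  case 0
  then show ?case using assms(1) by (auto intro: bounded_linear.continuous_on)
next
  case (Suc k)
  show ?case
  proof (rule Ck_on_SucI[OF assms(2)])
    show "((\<lambda>x. L (F x)) has_derivative (\<lambda>v. L (frechet_derivative F (at x) v))) (at x)" if "x \<in> W" for x
      by (rule bounded_linear.has_derivative[OF assms(1) Ck_on_derivative[OF Suc.prems that]])
    show "Ck_on k W (\<lambda>x. L (frechet_derivative F (at x) v))" for v
      using Suc.prems by (intro Suc.IH) simp
  qed
qed

lemma Ck_on_add:
  assumes "open W" "Ck_on k W F" "Ck_on k W G"
  shows "Ck_on k W (\<lambda>x. F x + G x)"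
  using assms(2,3)
proof (induction k arbitrary: F G)
  case 0
  then show ?case by (auto intro: continuous_on_add)
next
  case (Suc k)
  show ?case
  proof (rule Ck_on_SucI[OF assms(1)])
    show "((\<lambda>x. F x + G x) has_derivative
        (\<lambda>v. frechet_derivative F (at x) v + frechet_derivative G (at x) v)) (at x)" if "x \<in> W" for x
      by (rule has_derivative_add[OF Ck_on_derivative[OF Suc.prems(1) that] Ck_on_derivative[OF Suc.prems(2) that]])
    show "Ck_on k W (\<lambda>x. frechet_derivative F (at x) v + frechet_derivative G (at x) v)" for v
      using Suc.prems by (intro Suc.IH) simp_all
  qed
qed

lemma Ck_on_bilinear:
  assumes "bounded_bilinear B" "open W" "Ck_on k W F" "Ck_on k W G"
  shows "Ck_on k W (\<lambda>x. B (F x) (G x))"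
  using assms(3,4)
proof (induction k arbitrary: F G)
  case 0
  then show ?case using assms(1) by (auto intro: bounded_bilinear.continuous_on)
next
  case (Suc k)
  show ?case
  proof (rule Ck_on_SucI[OF assms(2)])
    show "((\<lambda>x. B (F x) (G x)) has_derivative (\<lambda>v. B (F x) (frechet_derivative G (at x) v)
        + B (frechet_derivative F (at x) v) (G x))) (at x)" if "x \<in> W" for x
      by (rule bounded_bilinear.FDERIV[OF assms(1) Ck_on_derivative[OF Suc.prems(1) that]
            Ck_on_derivative[OF Suc.prems(2) that]])
    \<comment> \<open>Each product has one undifferentiated factor, which must first be lowered from
      class \<open>Suc k\<close> to class \<open>k\<close>.\<close>
    show "Ck_on k W (\<lambda>x. B (F x) (frechet_derivative G (at x) v)
        + B (frechet_derivative F (at x) v) (G x))" for v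
      using Suc.prems Suc.prems[THEN Ck_on_SucD] by (intro Ck_on_add[OF assms(2)] Suc.IH) simp_all
  qed
qed

lemma Ck_on_sum:
  assumes "open W" "\<And>i. i \<in> I \<Longrightarrow> Ck_on k W (F i)"
  shows "Ck_on k W (\<lambda>x. \<Sum>i\<in>I. F i x)"
  using assms(2)
  by (induction I rule: infinite_finite_induct) (simp_all add: Ck_on_add Ck_on_const assms(1))

text \<open>\<open>Ck_on\<close> controls derivatives along fixed directions only, while the chain
  rule produces a direction that moves with the point. Expanding it in the basis leaves fixed
  directions with varying scalar coefficients, which keeps the induction in
  \<open>Ck_on_compose\<close> going.\<close>

lemma frechet_derivative_Basis:
  fixes F :: "'e::euclidean_space \<Rightarrow> 'f::real_normed_vector"
  assumes "F differentiable (at y)"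
  shows "frechet_derivative F (at y) w = (\<Sum>b\<in>Basis. (w \<bullet> b) *\<^sub>R frechet_derivative F (at y) b)"
proof -
  interpret linear "frechet_derivative F (at y)" using linear_frechet_derivative[OF assms] .
  show ?thesis
    by (subst euclidean_representation[of w, symmetric]) (simp only: sum scaleR)
qed

lemma Ck_on_compose:
  fixes F :: "'e::euclidean_space \<Rightarrow> 'f::real_normed_vector"
  assumes "open W" "open V" "Ck_on k V F" "Ck_on k W G" "\<And>x. x \<in> W \<Longrightarrow> G x \<in> V"
  shows "Ck_on k W (\<lambda>x. F (G x))"
  using assms(3,4)
proof (induction k arbitrary: F)
  case 0
  then show ?case using assms(5) by (auto intro: continuous_on_compose2)
next
  case (Suc k)
  have G: "Ck_on k W G" by (rule Ck_on_SucD[OF Suc.prems(2)])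
  show ?case
  proof (rule Ck_on_SucI[OF assms(1), where F' = "\<lambda>x v. \<Sum>b\<in>Basis.
      (frechet_derivative G (at x) v \<bullet> b) *\<^sub>R frechet_derivative F (at (G x)) b"])
    fix x assume x: "x \<in> W"
    then have *: "F differentiable (at (G x))" using Suc.prems assms(5) by auto
    have "((\<lambda>x. F (G x)) has_derivative
        (\<lambda>v. frechet_derivative F (at (G x)) (frechet_derivative G (at x) v))) (at x)"
      using Ck_on_derivative[OF Suc.prems(2) x] *[unfolded frechet_derivative_works]
      by (rule has_derivative_compose)
    then show "((\<lambda>x. F (G x)) has_derivative (\<lambda>v. \<Sum>b\<in>Basis.
      (frechet_derivative G (at x) v \<bullet> b) *\<^sub>R frechet_derivative F (at (G x)) b)) (at x)"
      unfolding frechet_derivative_Basis[OF *, of "frechet_derivative G (at x) _"] .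
  next
    fix v
    show "Ck_on k W (\<lambda>x. \<Sum>b\<in>Basis.
      (frechet_derivative G (at x) v \<bullet> b) *\<^sub>R frechet_derivative F (at (G x)) b)"
    proof (intro Ck_on_sum Ck_on_bilinear[OF bounded_bilinear_scaleR] assms(1))
      fix b
      show "Ck_on k W (\<lambda>x. frechet_derivative G (at x) v \<bullet> b)"
        using Suc.prems(2) by (simp add: Ck_on_bounded_linear[OF bounded_linear_inner_left assms(1)])
      show "Ck_on k W (\<lambda>x. frechet_derivative F (at (G x)) b)"
        by (rule Suc.IH[of "\<lambda>y. frechet_derivative F (at y) b", OF _ G]) (use Suc.prems(1) in simp)
    qed
  qed
qed

lemma smooth_on_subset: "smooth_on W F \<Longrightarrow> V \<subseteq> W \<Longrightarrow> smooth_on V F"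
  by (simp add: smooth_on_def Ck_on_subset[of _ W F V])

lemma smooth_on_cong:
  "open W \<Longrightarrow> (\<And>x. x \<in> W \<Longrightarrow> F x = G x) \<Longrightarrow> smooth_on W F \<Longrightarrow> smooth_on W G"
  by (simp add: smooth_on_def Ck_on_cong[of W F G])

lemma smooth_on_differentiable: "smooth_on W F \<Longrightarrow> x \<in> W \<Longrightarrow> F differentiable (at x)"
  unfolding smooth_on_def by (drule spec[of _ "Suc 0"]) simp

lemma smooth_on_derivative:
  "smooth_on W F \<Longrightarrow> x \<in> W \<Longrightarrow> (F has_derivative frechet_derivative F (at x)) (at x)"
  by (simp add: smooth_on_differentiable flip: frechet_derivative_works)

lemma smooth_on_frechet:
  assumes "smooth_on W F" shows "smooth_on W (\<lambda>x. frechet_derivative F (at x) v)"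
  unfolding smooth_on_def
proof
  fix k show "Ck_on k W (\<lambda>x. frechet_derivative F (at x) v)"
    using assms[unfolded smooth_on_def, rule_format, of "Suc k"] by simp
qed

lemma smooth_on_continuous: "smooth_on W F \<Longrightarrow> continuous_on W F"
  unfolding smooth_on_def by (drule spec[of _ 0]) simp

lemma smooth_on_const: "open W \<Longrightarrow> smooth_on W (\<lambda>x. c)"
  by (simp add: smooth_on_def Ck_on_const)

lemma smooth_on_bounded_linear:
  "bounded_linear L \<Longrightarrow> open W \<Longrightarrow> smooth_on W F \<Longrightarrow> smooth_on W (\<lambda>x. L (F x))"
  by (simp add: smooth_on_def Ck_on_bounded_linear)

lemma smooth_on_id: assumes "open W" shows "smooth_on W (\<lambda>x. x)"
  unfolding smooth_on_def
proof
  fix k show "Ck_on k W (\<lambda>x. x)"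
    by (cases k) (simp_all add: Ck_on_const assms)
qed

lemma smooth_on_add:
  "open W \<Longrightarrow> smooth_on W F \<Longrightarrow> smooth_on W G \<Longrightarrow> smooth_on W (\<lambda>x. F x + G x)"
  by (simp add: smooth_on_def Ck_on_add)

lemma smooth_on_mult:
  fixes F G :: "'e::real_normed_vector \<Rightarrow> 'f::real_normed_algebra"
  shows "open W \<Longrightarrow> smooth_on W F \<Longrightarrow> smooth_on W G \<Longrightarrow> smooth_on W (\<lambda>x. F x * G x)"
  by (simp add: smooth_on_def Ck_on_bilinear[OF bounded_bilinear_mult])

lemma smooth_on_sum:
  "open W \<Longrightarrow> (\<And>i. i \<in> I \<Longrightarrow> smooth_on W (F i)) \<Longrightarrow> smooth_on W (\<lambda>x. \<Sum>i\<in>I. F i x)"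
  by (simp add: smooth_on_def Ck_on_sum)

lemma smooth_on_compose:
  fixes F :: "'e::euclidean_space \<Rightarrow> 'f::real_normed_vector"
  assumes "open W" "open V" "smooth_on V F" "smooth_on W G" "\<And>x. x \<in> W \<Longrightarrow> G x \<in> V"
  shows "smooth_on W (\<lambda>x. F (G x))"
  using assms by (simp add: smooth_on_def Ck_on_compose)

lemma bounded_linear_axis: "bounded_linear (axis i :: complex \<Rightarrow> complex ^ 'n)"
  unfolding linear_conv_bounded_linear[symmetric]
  by (intro linearI) (auto simp: axis_def vec_eq_iff)

lemma smooth_on_vec:
  fixes F :: "'e::real_normed_vector \<Rightarrow> complex ^ 'n"
  assumes "open W" "\<And>i. smooth_on W (\<lambda>x. F x $ i)"
  shows "smooth_on W F"
proof -
  have eq: "F x = (\<Sum>i\<in>UNIV. axis i (F x $ i))" for x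
    by (auto simp: vec_eq_iff axis_def)
  show ?thesis
    by (subst eq[abs_def]) (intro smooth_on_sum assms smooth_on_bounded_linear[OF bounded_linear_axis])
qed

section \<open>Symmetry of second derivatives\<close>

lemma has_real_derivative_along_line:
  fixes F :: "'e::real_normed_vector \<Rightarrow> real"
  assumes "smooth_on W F" "y + r *\<^sub>R v \<in> W"
  shows "((\<lambda>r. F (y + r *\<^sub>R v)) has_real_derivative frechet_derivative F (at (y + r *\<^sub>R v)) v) (at r)"
proof -
  interpret linear "frechet_derivative F (at (y + r *\<^sub>R v))"
    using linear_frechet_derivative[OF smooth_on_differentiable[OF assms]] .
  have "((\<lambda>r. y + r *\<^sub>R v) has_derivative (\<lambda>s. s *\<^sub>R v)) (at r)"
    by (auto intro!: derivative_eq_intros)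
  from has_derivative_compose[OF this smooth_on_derivative[OF assms]]
  show ?thesis unfolding has_field_derivative_def by (simp add: scaleR mult.commute[of _ "frechet_derivative _ _ _"])
qed

text \<open>The mean value theorem is used twice, first in direction \<open>v\<close> for the
  difference of \<open>F\<close> along two parallel segments, then in direction \<open>w\<close> for
  \<open>dF\<close>. The second difference is symmetric in \<open>v\<close> and \<open>w\<close>, so
  it can be compared with either mixed derivative.\<close>

lemma second_difference_mean_value:
  fixes F :: "'e::real_normed_vector \<Rightarrow> real"
  assumes F: "smooth_on W F" and t: "t > 0"
    and box: "\<And>r s. 0 \<le> r \<Longrightarrow> r \<le> t \<Longrightarrow> 0 \<le> s \<Longrightarrow> s \<le> t \<Longrightarrow> x + r *\<^sub>R v + s *\<^sub>R w \<in> W"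
  obtains r s where "0 \<le> r" "r \<le> t" "0 \<le> s" "s \<le> t"
    "F (x + t *\<^sub>R v + t *\<^sub>R w) - F (x + t *\<^sub>R v) - F (x + t *\<^sub>R w) + F x
      = t * t * frechet_derivative (\<lambda>y. frechet_derivative F (at y) v) (at (x + r *\<^sub>R v + s *\<^sub>R w)) w"
proof -
  define dF where "dF y = frechet_derivative F (at y) v" for y
  have dF: "smooth_on W dF" unfolding dF_def by (rule smooth_on_frechet[OF F])
  define g where "g r = F (x + t *\<^sub>R w + r *\<^sub>R v) - F (x + r *\<^sub>R v)" for r
  have g: "(g has_real_derivative (dF (x + t *\<^sub>R w + r *\<^sub>R v) - dF (x + r *\<^sub>R v))) (at r)"
    if "0 \<le> r" "r \<le> t" for r
    unfolding g_def dF_def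
    using box[of r t] box[of r 0] that t
    by (intro DERIV_diff has_real_derivative_along_line[OF F]) (auto simp: algebra_simps)
  obtain r where r: "0 < r" "r < t"
    "g t - g 0 = (t - 0) * (dF (x + t *\<^sub>R w + r *\<^sub>R v) - dF (x + r *\<^sub>R v))"
    using MVT2[OF t g] by auto
  have k: "((\<lambda>s. dF (x + r *\<^sub>R v + s *\<^sub>R w)) has_real_derivative
      frechet_derivative dF (at (x + r *\<^sub>R v + s *\<^sub>R w)) w) (at s)"
    if "0 \<le> s" "s \<le> t" for s
    using box[of r s] that r by (intro has_real_derivative_along_line[OF dF]) auto
  obtain s where s: "0 < s" "s < t"
    "dF (x + r *\<^sub>R v + t *\<^sub>R w) - dF (x + r *\<^sub>R v + 0 *\<^sub>R w)
      = (t - 0) * frechet_derivative dF (at (x + r *\<^sub>R v + s *\<^sub>R w)) w"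
    using MVT2[OF t k] by blast
  have "dF (x + t *\<^sub>R w + r *\<^sub>R v) - dF (x + r *\<^sub>R v)
      = t * frechet_derivative dF (at (x + r *\<^sub>R v + s *\<^sub>R w)) w"
    using s(3) by (simp add: add_ac)
  then have "g t - g 0 = t * t * frechet_derivative dF (at (x + r *\<^sub>R v + s *\<^sub>R w)) w"
    using r(3) by simp
  then have "F (x + t *\<^sub>R v + t *\<^sub>R w) - F (x + t *\<^sub>R v) - F (x + t *\<^sub>R w) + F x
      = t * t * frechet_derivative dF (at (x + r *\<^sub>R v + s *\<^sub>R w)) w"
    by (simp add: g_def add_ac)
  then show thesis
    using that[of r s] r s(1,2) by (simp add: dF_def[abs_def])
qed

text \<open>One second difference, read with \<open>v\<close> and \<open>w\<close> in either order,
  is \<open>t * t\<close> times a value of each mixed derivative at some point near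
  \<open>x\<close>. Continuity of both derivatives then forces them to agree at \<open>x\<close>
  itself.\<close>

lemma mixed_derivative_commute_real:
  fixes F :: "'e::real_normed_vector \<Rightarrow> real"
  assumes W: "open W" "x \<in> W" and F: "smooth_on W F"
  shows "frechet_derivative (\<lambda>y. frechet_derivative F (at y) v) (at x) w
       = frechet_derivative (\<lambda>y. frechet_derivative F (at y) w) (at x) v"
proof -
  define a where "a y = frechet_derivative (\<lambda>y. frechet_derivative F (at y) v) (at y) w" for y
  define b where "b y = frechet_derivative (\<lambda>y. frechet_derivative F (at y) w) (at y) v" for y
  have ab: "continuous_on W a" "continuous_on W b"
    unfolding a_def b_def by (intro smooth_on_continuous smooth_on_frechet F)+
  have "dist (a x) (b x) < 2 * e" if e: "e > 0" for e
  proof -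
    have "(a \<longlongrightarrow> a x) (nhds x)" "(b \<longlongrightarrow> b x) (nhds x)"
      using ab W by (simp_all add: continuous_on_eq_continuous_at isCont_def tendsto_at_iff_tendsto_nhds)
    from tendstoD[OF this(1) e] tendstoD[OF this(2) e] eventually_nhds_in_open[OF W]
    have "\<forall>\<^sub>F y in nhds x. dist (a y) (a x) < e \<and> dist (b y) (b x) < e \<and> y \<in> W"
      by (simp add: eventually_conj_iff)
    then obtain d where d: "d > 0"
      "\<And>y. dist y x < d \<Longrightarrow> dist (a y) (a x) < e \<and> dist (b y) (b x) < e \<and> y \<in> W"
      unfolding eventually_nhds_metric by metis
    \<comment> \<open>The summand 1 keeps \<open>N\<close> positive even if \<open>v\<close> and
      \<open>w\<close> vanish; the factor 2 in \<open>t\<close> puts the whole parallelogram within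
      \<open>d / 2\<close> of \<open>x\<close>.\<close>
    define N where "N = norm v + norm w + 1"
    have pos: "N > 0" unfolding N_def by (smt (verit) norm_ge_zero)
    define t where "t = d / (2 * N)"
    have t: "t > 0" unfolding t_def using d(1) pos by (intro divide_pos_pos) auto
    have near: "dist (x + r *\<^sub>R v' + s *\<^sub>R w') x < d"
      if "0 \<le> r" "r \<le> t" "0 \<le> s" "s \<le> t" "(v' = v \<and> w' = w) \<or> (v' = w \<and> w' = v)" for r s v' w'
    proof -
      have "norm (r *\<^sub>R v' + s *\<^sub>R w') \<le> r * norm v' + s * norm w'"
        using that norm_triangle_ineq[of "r *\<^sub>R v'" "s *\<^sub>R w'"] by auto
      also have "\<dots> \<le> t * norm v' + t * norm w'"
        using that by (intro add_mono mult_right_mono) auto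
      also have "\<dots> \<le> t * N"
        using t that(5) by (auto simp: N_def algebra_simps)
      also have "\<dots> = d / 2" unfolding t_def using pos by simp
      also have "\<dots> < d" using d(1) by simp
      finally show ?thesis by (simp add: dist_norm add.assoc)
    qed
    obtain r s where 1: "0 \<le> r" "r \<le> t" "0 \<le> s" "s \<le> t"
      "F (x + t *\<^sub>R v + t *\<^sub>R w) - F (x + t *\<^sub>R v) - F (x + t *\<^sub>R w) + F x
        = t * t * a (x + r *\<^sub>R v + s *\<^sub>R w)"
      unfolding a_def by (rule second_difference_mean_value[OF F t, of x v w]) (use near d(2) in auto)
    obtain r' s' where 2: "0 \<le> r'" "r' \<le> t" "0 \<le> s'" "s' \<le> t"
      "F (x + t *\<^sub>R w + t *\<^sub>R v) - F (x + t *\<^sub>R w) - F (x + t *\<^sub>R v) + F x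
        = t * t * b (x + r' *\<^sub>R w + s' *\<^sub>R v)"
      unfolding b_def by (rule second_difference_mean_value[OF F t, of x w v]) (use near d(2) in auto)
    have "t * t * a (x + r *\<^sub>R v + s *\<^sub>R w) = t * t * b (x + r' *\<^sub>R w + s' *\<^sub>R v)"
      using 1(5) 2(5) by (simp add: algebra_simps)
    then have "a (x + r *\<^sub>R v + s *\<^sub>R w) = b (x + r' *\<^sub>R w + s' *\<^sub>R v)" using t by auto
    moreover have "dist (a (x + r *\<^sub>R v + s *\<^sub>R w)) (a x) < e" using d(2) near 1 by auto
    moreover have "dist (b (x + r' *\<^sub>R w + s' *\<^sub>R v)) (b x) < e" using d(2) near 2 by auto
    ultimately show ?thesis by (auto simp: dist_real_def)
  qed
  \<comment> \<open>If the two values differed, half their distance as \<open>e\<close> would make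
    the distance smaller than itself.\<close>
  from this[of "dist (a x) (b x) / 2"] have "a x = b x" by (cases "a x = b x") auto
  then show ?thesis by (simp add: a_def b_def)
qed

lemma frechet_derivative_bounded_linear:
  assumes "bounded_linear L" "F differentiable (at x)"
  shows "frechet_derivative (\<lambda>y. L (F y)) (at x) v = L (frechet_derivative F (at x) v)"
  by (rule frechet_derivative_eq[OF bounded_linear.has_derivative[OF assms(1)
        assms(2)[unfolded frechet_derivative_works]]])

text \<open>Inner products with basis vectors reduce the claim to real-valued functions, where the
  mean value theorem is at hand.\<close>

lemma mixed_derivative_commute:
  fixes F :: "'e::real_normed_vector \<Rightarrow> 'f::euclidean_space"
  assumes W: "open W" "x \<in> W" and F: "smooth_on W F"
  shows "frechet_derivative (\<lambda>y. frechet_derivative F (at y) v) (at x) w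
       = frechet_derivative (\<lambda>y. frechet_derivative F (at y) w) (at x) v"
proof -
  have *: "frechet_derivative (\<lambda>y. frechet_derivative (\<lambda>y. F y \<bullet> b) (at y) v) (at x) w
     = frechet_derivative (\<lambda>y. frechet_derivative F (at y) v) (at x) w \<bullet> b" for b v w
  proof -
    have "frechet_derivative (\<lambda>y. frechet_derivative (\<lambda>y. F y \<bullet> b) (at y) v) (at x)
      = frechet_derivative (\<lambda>y. frechet_derivative F (at y) v \<bullet> b) (at x)"
      using W smooth_on_differentiable[OF F]
      by (intro frechet_derivative_transform_within_open[OF _ W])
         (auto simp: frechet_derivative_bounded_linear[OF bounded_linear_inner_left]
           intro!: smooth_on_differentiable[OF _ W(2)] smooth_on_frechet
             smooth_on_bounded_linear[OF bounded_linear_inner_left] F)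
    then show ?thesis
      using smooth_on_differentiable[OF smooth_on_frechet[OF F] W(2)]
      by (simp add: frechet_derivative_bounded_linear[OF bounded_linear_inner_left])
  qed
  show ?thesis
  proof (rule euclidean_eqI)
    fix b :: 'f
    have "smooth_on W (\<lambda>y. F y \<bullet> b)"
      by (intro smooth_on_bounded_linear[OF bounded_linear_inner_left] W F)
    from mixed_derivative_commute_real[OF W this, of v w]
    show "frechet_derivative (\<lambda>y. frechet_derivative F (at y) v) (at x) w \<bullet> b
       = frechet_derivative (\<lambda>y. frechet_derivative F (at y) w) (at x) v \<bullet> b"
      by (simp add: *)
  qed
qed

section \<open>Smooth functions and vectors in a holomorphic chart\<close>

lemma sum_tvec_apply: "(\<Sum>i\<in>I. X i :: 'a tvec) f = (\<Sum>i\<in>I. X i f)"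
  by (induction I rule: infinite_finite_induct) auto

lemma scale_vec_apply [simp]: "(a \<odot> X) f = a * X f"
  by (simp add: scale_vec_def)

lemma chart_inv_coord: "q \<in> dom_of c \<Longrightarrow> is_chart c \<Longrightarrow> inv_coord c (coord c q) = q"
  by (auto simp: is_chart_def homeomorphism_def)

lemma chart_coord_inv: "z \<in> coord c ` dom_of c \<Longrightarrow> coord c (inv_coord c z) = z"
  by (rule f_inv_into_f)

lemma chart_open_image:
  assumes "is_chart c" "open S" shows "open (coord c ` (dom_of c \<inter> S))"
proof -
  have "openin (top_of_set (coord c ` dom_of c)) (coord c ` (dom_of c \<inter> S))"
    using assms by (intro homeomorphism_imp_open_map) (auto simp: is_chart_def openin_open)
  then show ?thesis using assms by (auto simp: is_chart_def intro: openin_open_trans)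
qed

section \<open>Algebra of smooth functions on the manifold\<close>

lemma smooth_fun_subset:
  "smooth_fun A S f \<Longrightarrow> T \<subseteq> S \<Longrightarrow> smooth_fun A T f"
  unfolding smooth_fun_def by (fast intro: smooth_on_subset)

lemma smooth_near_cong:
  assumes "complex_manifold A" "smooth_near A p f" "open S" "p \<in> S" "\<And>q. q \<in> S \<Longrightarrow> f q = g q"
  shows "smooth_near A p g"
proof -
  obtain T where T: "open T" "p \<in> T" "smooth_fun A T f" using assms(2) unfolding smooth_near_def by auto
  have "smooth_fun A (T \<inter> S) g"
    unfolding smooth_fun_def
  proof
    fix c assume c: "c \<in> A"
    have ic: "is_chart c" using assms(1) c by (auto simp: complex_manifold_def)
    show "smooth_on (coord c ` (dom_of c \<inter> (T \<inter> S))) (\<lambda>z. g (inv_coord c z))"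
    proof (rule smooth_on_cong)
      show "smooth_on (coord c ` (dom_of c \<inter> (T \<inter> S))) (\<lambda>z. f (inv_coord c z))"
        using smooth_fun_subset[OF T(3), of "T \<inter> S"] c by (auto simp: smooth_fun_def)
    qed (use ic T assms in \<open>auto intro!: chart_open_image simp: chart_inv_coord\<close>)
  qed
  then show ?thesis using T assms unfolding smooth_near_def by blast
qed

context
  fixes A :: "('a::{t2_space, second_countable_topology}, 'n::finite) chart set"
  assumes A: "complex_manifold A"
begin

lemma smooth_fun_cong:
  assumes "open S" "smooth_fun A S f" "\<And>q. q \<in> S \<Longrightarrow> f q = g q"
  shows "smooth_fun A S g"
  unfolding smooth_fun_def
proof
  fix c assume c: "c \<in> A"
  have ic: "is_chart c" using A c by (auto simp: complex_manifold_def)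
  show "smooth_on (coord c ` (dom_of c \<inter> S)) (\<lambda>z. g (inv_coord c z))"
    by (rule smooth_on_cong[of _ "\<lambda>z. f (inv_coord c z)"])
      (use ic c assms in \<open>auto intro!: chart_open_image simp: chart_inv_coord smooth_fun_def\<close>)
qed

lemma smooth_fun_const: "open S \<Longrightarrow> smooth_fun A S (\<lambda>q. a)"
  using A by (auto simp: smooth_fun_def complex_manifold_def intro!: smooth_on_const chart_open_image)

lemma smooth_fun_add:
  "open S \<Longrightarrow> smooth_fun A S f \<Longrightarrow> smooth_fun A S g \<Longrightarrow> smooth_fun A S (\<lambda>q. f q + g q)"
  using A by (auto simp: smooth_fun_def complex_manifold_def intro!: smooth_on_add chart_open_image)

lemma smooth_fun_mult:
  "open S \<Longrightarrow> smooth_fun A S f \<Longrightarrow> smooth_fun A S g \<Longrightarrow> smooth_fun A S (\<lambda>q. f q * g q)"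
  using A by (auto simp: smooth_fun_def complex_manifold_def intro!: smooth_on_mult chart_open_image)

lemma smooth_fun_cnj: "open S \<Longrightarrow> smooth_fun A S f \<Longrightarrow> smooth_fun A S (\<lambda>q. cnj (f q))"
  using A by (auto simp: smooth_fun_def complex_manifold_def
      intro!: smooth_on_bounded_linear[OF bounded_linear_cnj] chart_open_image)

lemma smooth_fun_sum:
  "open S \<Longrightarrow> (\<And>i. i \<in> I \<Longrightarrow> smooth_fun A S (f i)) \<Longrightarrow> smooth_fun A S (\<lambda>q. \<Sum>i\<in>I. f i q)"
  using A by (auto simp: smooth_fun_def complex_manifold_def intro!: smooth_on_sum chart_open_image)

lemmas smooth_fun_intros = smooth_fun_const smooth_fun_add smooth_fun_mult smooth_fun_cnj smooth_fun_sum

lemma smooth_nearI: "open S \<Longrightarrow> smooth_fun A S f \<Longrightarrow> p \<in> S \<Longrightarrow> smooth_near A p f"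
  unfolding smooth_near_def by blast

lemma smooth_near_const: "smooth_near A p (\<lambda>q. a)"
  using smooth_fun_const[of UNIV] unfolding smooth_near_def by blast

lemma smooth_near_cnj: "smooth_near A p f \<Longrightarrow> smooth_near A p (\<lambda>q. cnj (f q))"
  unfolding smooth_near_def using smooth_fun_cnj by blast

lemma smooth_near_binary:
  assumes "smooth_near A p f" "smooth_near A p g"
  obtains S where "open S" "p \<in> S" "smooth_fun A S f" "smooth_fun A S g"
proof -
  obtain S T where "open S" "p \<in> S" "smooth_fun A S f" "open T" "p \<in> T" "smooth_fun A T g"
    using assms unfolding smooth_near_def by blast
  then show ?thesis
    using that[of "S \<inter> T"] smooth_fun_subset[of A S f "S \<inter> T"] smooth_fun_subset[of A T g "S \<inter> T"] by auto
qed

lemma smooth_near_add: "smooth_near A p f \<Longrightarrow> smooth_near A p g \<Longrightarrow> smooth_near A p (\<lambda>q. f q + g q)"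
  by (erule (1) smooth_near_binary) (blast intro: smooth_nearI smooth_fun_add)

lemma smooth_near_mult: "smooth_near A p f \<Longrightarrow> smooth_near A p g \<Longrightarrow> smooth_near A p (\<lambda>q. f q * g q)"
  by (erule (1) smooth_near_binary) (blast intro: smooth_nearI smooth_fun_mult)

lemma smooth_near_sum:
  "(\<And>i. i \<in> I \<Longrightarrow> smooth_near A p (f i)) \<Longrightarrow> smooth_near A p (\<lambda>q. \<Sum>i\<in>I. f i q)"
  by (induction I rule: infinite_finite_induct) (auto intro: smooth_near_const smooth_near_add)

lemmas smooth_near_intros = smooth_near_const smooth_near_add smooth_near_mult smooth_near_cnj smooth_near_sum

end

section \<open>Derivations at a point\<close>

text \<open>Real tangent vectors and the complex vectors \<open>d_z\<close> and
  \<open>d_zbar\<close> are handled alike through this notion. The last clause says that only the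
  germ at \<open>p\<close> matters; it allows a function to be replaced by a coordinate expression
  that is valid near \<open>p\<close> only.\<close>

definition derivation_at :: "('a::topological_space, 'n::finite) chart set \<Rightarrow> 'a \<Rightarrow> 'a tvec \<Rightarrow> bool" where
  "derivation_at A p X \<longleftrightarrow>
     (\<forall>f g. smooth_near A p f \<and> smooth_near A p g \<longrightarrow>
        X (\<lambda>q. f q + g q) = X f + X g \<and> X (\<lambda>q. f q * g q) = X f * g p + f p * X g) \<and>
     (\<forall>a. X (\<lambda>q. a) = 0) \<and>
     (\<forall>f g S. smooth_near A p f \<and> open S \<and> p \<in> S \<and> (\<forall>q\<in>S. f q = g q) \<longrightarrow> X g = X f)"

lemma derivation_add:
  "derivation_at A p X \<Longrightarrow> smooth_near A p f \<Longrightarrow> smooth_near A p g \<Longrightarrow> X (\<lambda>q. f q + g q) = X f + X g"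
  by (simp add: derivation_at_def)

lemma derivation_mult:
  "derivation_at A p X \<Longrightarrow> smooth_near A p f \<Longrightarrow> smooth_near A p g \<Longrightarrow>
    X (\<lambda>q. f q * g q) = X f * g p + f p * X g"
  by (simp add: derivation_at_def)

lemma derivation_const: "derivation_at A p X \<Longrightarrow> X (\<lambda>q. a) = 0"
  by (simp add: derivation_at_def)

lemma derivation_cong:
  "derivation_at A p X \<Longrightarrow> smooth_near A p f \<Longrightarrow> open S \<Longrightarrow> p \<in> S \<Longrightarrow> (\<And>q. q \<in> S \<Longrightarrow> f q = g q)
    \<Longrightarrow> X g = X f"
  unfolding derivation_at_def by blast

lemma derivation_cmult:
  assumes "complex_manifold A" "derivation_at A p X" "smooth_near A p f"
  shows "X (\<lambda>q. a * f q) = a * X f"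
  using derivation_mult[OF assms(2) smooth_near_const[OF assms(1)] assms(3)] assms(2)
  by (simp add: derivation_const)

lemma derivation_sum:
  assumes A: "complex_manifold A" and X: "derivation_at A p X" and f: "\<And>i. i \<in> I \<Longrightarrow> smooth_near A p (f i)"
  shows "X (\<lambda>q. \<Sum>i\<in>I. f i q) = (\<Sum>i\<in>I. X (f i))"
  using f
proof (induction I rule: infinite_finite_induct)
  case (insert i I)
  then show ?case
    using derivation_add[OF X, of "f i" "\<lambda>q. \<Sum>i\<in>I. f i q"] smooth_near_sum[OF A, of I p f] by simp
qed (auto simp: derivation_const[OF X])

lemma derivation_at_combination:
  assumes "derivation_at A p X" "derivation_at A p Y"
  shows "derivation_at A p (\<lambda>f. a * X f + b * Y f)"
  unfolding derivation_at_def
proof (intro conjI allI impI; (elim conjE)?)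
  fix f g assume "smooth_near A p f" "smooth_near A p g"
  note * = derivation_mult[OF assms(1) this] derivation_mult[OF assms(2) this]
    derivation_add[OF assms(1) this] derivation_add[OF assms(2) this]
  show "a * X (\<lambda>q. f q + g q) + b * Y (\<lambda>q. f q + g q) = a * X f + b * Y f + (a * X g + b * Y g)"
    "a * X (\<lambda>q. f q * g q) + b * Y (\<lambda>q. f q * g q) =
       (a * X f + b * Y f) * g p + f p * (a * X g + b * Y g)"
    unfolding * by (simp_all add: algebra_simps)
next
  fix f g S assume "smooth_near A p f" "open S" "p \<in> S" "\<forall>q\<in>S. f q = g q"
  then show "a * X g + b * Y g = a * X f + b * Y f"
    using derivation_cong[OF assms(1)] derivation_cong[OF assms(2)] by metis
qed (simp add: derivation_const[OF assms(1)] derivation_const[OF assms(2)])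

lemma axis_decomposition:
  fixes w :: "complex ^ 'n::finite"
  shows "w = (\<Sum>\<alpha>\<in>UNIV. Re (w $ \<alpha>) *\<^sub>R axis \<alpha> 1 + Im (w $ \<alpha>) *\<^sub>R axis \<alpha> \<i>)"
proof -
  have "(\<Sum>\<alpha>\<in>UNIV. Re (w $ \<alpha>) *\<^sub>R (axis \<alpha> 1 :: complex ^ 'n) + Im (w $ \<alpha>) *\<^sub>R axis \<alpha> \<i>) $ \<beta>
     = (\<Sum>\<alpha>\<in>UNIV. if \<alpha> = \<beta> then w $ \<alpha> else 0)" for \<beta>
    unfolding sum_component
    by (intro sum.cong) (auto simp: axis_def complex_eq_iff)
  then show ?thesis by (simp add: vec_eq_iff)
qed

text \<open>A real linear map splits into a complex linear and a conjugate linear part. For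
  directional derivatives the coefficients are \<open>d_z\<close> and \<open>d_zbar\<close>; for a
  connection the second part is the one that holomorphic compatibility kills.\<close>

lemma linear_dz_dzbar:
  fixes L :: "complex ^ 'n::finite \<Rightarrow> complex"
  assumes "linear L"
  shows "L w = (\<Sum>\<alpha>\<in>UNIV. w $ \<alpha> * ((L (axis \<alpha> 1) - \<i> * L (axis \<alpha> \<i>)) / 2)
                + cnj (w $ \<alpha>) * ((L (axis \<alpha> 1) + \<i> * L (axis \<alpha> \<i>)) / 2))"
proof -
  interpret linear L by fact
  have "L w = (\<Sum>\<alpha>\<in>UNIV. Re (w $ \<alpha>) *\<^sub>R L (axis \<alpha> 1) + Im (w $ \<alpha>) *\<^sub>R L (axis \<alpha> \<i>))"
    by (subst axis_decomposition[of w]) (simp add: sum add scaleR)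
  also have "\<dots> = (\<Sum>\<alpha>\<in>UNIV. w $ \<alpha> * ((L (axis \<alpha> 1) - \<i> * L (axis \<alpha> \<i>)) / 2)
                + cnj (w $ \<alpha>) * ((L (axis \<alpha> 1) + \<i> * L (axis \<alpha> \<i>)) / 2))"
    by (intro sum.cong) (auto simp: complex_eq_iff field_simps)
  finally show ?thesis .
qed

section \<open>Holomorphic charts and change of coordinates\<close>

locale holomorphic_chart =
  fixes A :: "('a::{t2_space, second_countable_topology}, 'n::finite) chart set" and c :: "('a, 'n) chart"
  assumes manifold: "complex_manifold A" and chart_in: "c \<in> A"
begin

lemma chart: "is_chart c"
  using manifold chart_in by (auto simp: complex_manifold_def)

lemma open_dom: "open (dom_of c)"
  using chart by (simp add: is_chart_def)

lemma open_image: "open S \<Longrightarrow> S \<subseteq> dom_of c \<Longrightarrow> open (coord c ` S)"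
  using chart_open_image[OF chart, of S] by (simp add: Int_absorb1)

lemma inv_coord [simp]: "q \<in> dom_of c \<Longrightarrow> inv_coord c (coord c q) = q"
  using chart_inv_coord chart by blast

abbreviation transition :: "('a, 'n) chart \<Rightarrow> complex ^ 'n \<Rightarrow> complex ^ 'n" where
  "transition c' \<equiv> (\<lambda>z. coord c (inv_coord c' z))"

lemma
  assumes c': "c' \<in> A"
  shows smooth_on_transition: "smooth_on (coord c' ` (dom_of c' \<inter> dom_of c)) (transition c')"
    and transition_complex_linear: "z \<in> coord c' ` (dom_of c' \<inter> dom_of c) \<Longrightarrow>
      frechet_derivative (transition c') (at z) (\<i> *s v) = \<i> *s frechet_derivative (transition c') (at z) v"
proof -
  have *: "holomorphic_vec_on (coord c' ` (dom_of c' \<inter> dom_of c)) (\<lambda>z. transition c' z $ \<alpha>)" for \<alpha>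
    using manifold chart_in c'
    by (auto simp: complex_manifold_def compatible_charts_def holomorphic_transition_def)
  have op: "open (coord c' ` (dom_of c' \<inter> dom_of c))"
    using manifold chart_in c' open_dom by (intro chart_open_image) (auto simp: complex_manifold_def)
  show sm: "smooth_on (coord c' ` (dom_of c' \<inter> dom_of c)) (transition c')"
    using * op by (intro smooth_on_vec) (auto simp: holomorphic_vec_on_def)
  assume z: "z \<in> coord c' ` (dom_of c' \<inter> dom_of c)"
  have "frechet_derivative (\<lambda>z. transition c' z $ \<alpha>) (at z) v = frechet_derivative (transition c') (at z) v $ \<alpha>"
    for \<alpha> v
    by (intro frechet_derivative_bounded_linear bounded_linear_vec_nth smooth_on_differentiable[OF sm z])
  then have "frechet_derivative (transition c') (at z) (\<i> *s v) $ \<alpha>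
      = \<i> * frechet_derivative (transition c') (at z) v $ \<alpha>" for \<alpha>
    using *[of \<alpha>, unfolded holomorphic_vec_on_def, THEN conjunct2, rule_format, OF z, of v] by simp
  then show "frechet_derivative (transition c') (at z) (\<i> *s v)
      = \<i> *s frechet_derivative (transition c') (at z) v"
    by (simp add: vec_eq_iff)
qed

text \<open>Near a point of both domains, the expression of \<open>f\<close> in \<open>c'\<close> is
  its expression in \<open>c\<close> after the transition map, so closure under composition and the
  chain rule apply.\<close>

lemma
  assumes S: "open S" "S \<subseteq> dom_of c" and c': "c' \<in> A"
    and F: "smooth_on (coord c ` S) (\<lambda>z. f (inv_coord c z))"
  shows smooth_on_change_chart: "smooth_on (coord c' ` (dom_of c' \<inter> S)) (\<lambda>z. f (inv_coord c' z))"
    and has_derivative_change_chart: "q \<in> dom_of c' \<Longrightarrow> q \<in> S \<Longrightarrow>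
      ((\<lambda>z. f (inv_coord c' z)) has_derivative (\<lambda>v. frechet_derivative (\<lambda>z. f (inv_coord c z)) (at (coord c q))
         (frechet_derivative (transition c') (at (coord c' q)) v))) (at (coord c' q))"
proof -
  have ic': "is_chart c'" using manifold c' by (auto simp: complex_manifold_def)
  let ?W = "coord c' ` (dom_of c' \<inter> S)"
  have op: "open ?W" using ic' S by (intro chart_open_image)
  have tr: "smooth_on ?W (transition c')"
    using smooth_on_transition[OF c'] S by (auto elim!: smooth_on_subset)
  have eq: "f (inv_coord c (transition c' z)) = f (inv_coord c' z)" if "z \<in> ?W" for z
    using that S(2) by (auto simp: chart_inv_coord[OF _ ic'] subset_iff)
  show "smooth_on ?W (\<lambda>z. f (inv_coord c' z))"
  proof (rule smooth_on_cong[OF op])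
    show "smooth_on ?W (\<lambda>z. f (inv_coord c (transition c' z)))"
      by (rule smooth_on_compose[OF op open_image[OF S] F tr]) (auto simp: chart_inv_coord[OF _ ic'])
  qed (rule eq)
  assume q: "q \<in> dom_of c'" "q \<in> S"
  then have W: "coord c' q \<in> ?W" by blast
  have t: "transition c' (coord c' q) = coord c q" using q by (simp add: chart_inv_coord[OF _ ic'])
  show "((\<lambda>z. f (inv_coord c' z)) has_derivative (\<lambda>v. frechet_derivative (\<lambda>z. f (inv_coord c z)) (at (coord c q))
         (frechet_derivative (transition c') (at (coord c' q)) v))) (at (coord c' q))"
  proof (rule has_derivative_transform_within_open[OF _ op W eq])
    show "((\<lambda>z. f (inv_coord c (transition c' z))) has_derivative
        (\<lambda>v. frechet_derivative (\<lambda>z. f (inv_coord c z)) (at (coord c q))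
         (frechet_derivative (transition c') (at (coord c' q)) v))) (at (coord c' q))"
      using smooth_on_derivative[OF tr W] smooth_on_derivative[OF F, of "coord c q"] q t
      by (intro has_derivative_compose[of "transition c'" _ _ _ "\<lambda>z. f (inv_coord c z)"]) auto
  qed
qed

text \<open>\<open>smooth_fun\<close> quantifies over the whole atlas; inside the domain of one
  chart the change of coordinates reduces it to that chart.\<close>

lemma smooth_fun_iff:
  assumes S: "open S" "S \<subseteq> dom_of c"
  shows "smooth_fun A S f \<longleftrightarrow> smooth_on (coord c ` S) (\<lambda>z. f (inv_coord c z))"
  using smooth_on_change_chart[OF S] chart_in S(2)
  by (auto simp: smooth_fun_def Int_absorb1 dest: bspec[of _ _ c])

text \<open>A complex linear derivative stays complex linear when composed with the derivative of a
  holomorphic transition map, so the Cauchy-Riemann equations also need to be checked in one chart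
  only.\<close>

lemma holomorphic_fun_iff:
  assumes S: "open S" "S \<subseteq> dom_of c"
  shows "holomorphic_fun A S f \<longleftrightarrow> holomorphic_vec_on (coord c ` S) (\<lambda>z. f (inv_coord c z))"
proof
  assume "holomorphic_fun A S f"
  then show "holomorphic_vec_on (coord c ` S) (\<lambda>z. f (inv_coord c z))"
    using chart_in S(2) by (auto simp: holomorphic_fun_def Int_absorb1 dest: bspec[of _ _ c])
next
  assume F: "holomorphic_vec_on (coord c ` S) (\<lambda>z. f (inv_coord c z))"
  then have sm: "smooth_on (coord c ` S) (\<lambda>z. f (inv_coord c z))" by (simp add: holomorphic_vec_on_def)
  show "holomorphic_fun A S f"
    unfolding holomorphic_fun_def holomorphic_vec_on_def
  proof (intro ballI conjI allI)
    fix c' assume c': "c' \<in> A"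
    show "smooth_on (coord c' ` (dom_of c' \<inter> S)) (\<lambda>z. f (inv_coord c' z))"
      by (rule smooth_on_change_chart[OF S c' sm])
    fix z v assume "z \<in> coord c' ` (dom_of c' \<inter> S)"
    then obtain q where q: "q \<in> dom_of c'" "q \<in> S" "z = coord c' q" by auto
    show "frechet_derivative (\<lambda>z. f (inv_coord c' z)) (at z) (\<i> *s v) =
          \<i> * frechet_derivative (\<lambda>z. f (inv_coord c' z)) (at z) v"
      unfolding q(3) frechet_derivative_eq[OF has_derivative_change_chart[OF S c' sm q(1,2)]]
      using F q S by (subst transition_complex_linear[OF c']) (auto simp: holomorphic_vec_on_def)
  qed
qed

section \<open>Tangent vectors in a chart\<close>

lemma smooth_nearE:
  assumes "smooth_near A p f" "p \<in> dom_of c"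
  obtains S where "open S" "p \<in> S" "S \<subseteq> dom_of c" "smooth_fun A S f"
    "smooth_on (coord c ` S) (\<lambda>z. f (inv_coord c z))"
proof -
  obtain S where S: "open S" "p \<in> S" "smooth_fun A S f" using assms unfolding smooth_near_def by auto
  let ?S = "S \<inter> dom_of c"
  have "smooth_fun A ?S f" by (rule smooth_fun_subset[OF S(3)]) auto
  then show thesis using that[of ?S] S open_dom assms(2) smooth_fun_iff[of ?S f] by auto
qed

lemma smooth_near_derivative:
  assumes "smooth_near A p f" "p \<in> dom_of c"
  shows "((\<lambda>z. f (inv_coord c z)) has_derivative (\<lambda>w. dir_deriv A c p w f)) (at (coord c p))"
proof -
  obtain S where S: "open S" "p \<in> S" "S \<subseteq> dom_of c" "smooth_on (coord c ` S) (\<lambda>z. f (inv_coord c z))"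
    using smooth_nearE[OF assms] by metis
  show ?thesis
    using smooth_on_derivative[OF S(4), of "coord c p"] S assms by (simp add: dir_deriv_def)
qed

lemma dir_deriv_linear: "p \<in> dom_of c \<Longrightarrow> linear (\<lambda>w. dir_deriv A c p w f)"
  by (cases "smooth_near A p f")
     (simp_all add: smooth_near_derivative[THEN has_derivative_linear], simp add: dir_deriv_def linear_iff)

lemma dir_deriv_eqI:
  assumes "((\<lambda>z. f (inv_coord c z)) has_derivative f') (at (coord c p))" "smooth_near A p f"
  shows "dir_deriv A c p w f = f' w"
  using frechet_derivative_eq[OF assms(1)] assms(2) by (simp add: dir_deriv_def)

lemma derivation_dir_deriv:
  assumes p: "p \<in> dom_of c" shows "derivation_at A p (dir_deriv A c p w)"
  unfolding derivation_at_def
proof (intro conjI allI impI; (elim conjE)?)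
  fix f g assume fg: "smooth_near A p f" "smooth_near A p g"
  note d = smooth_near_derivative[OF fg(1) p] smooth_near_derivative[OF fg(2) p]
  show "dir_deriv A c p w (\<lambda>q. f q + g q) = dir_deriv A c p w f + dir_deriv A c p w g"
    by (rule dir_deriv_eqI[OF has_derivative_add[OF d] smooth_near_add[OF manifold fg]])
  show "dir_deriv A c p w (\<lambda>q. f q * g q) = dir_deriv A c p w f * g p + f p * dir_deriv A c p w g"
    using dir_deriv_eqI[OF has_derivative_mult[OF d] smooth_near_mult[OF manifold fg]] p
    by (simp add: algebra_simps)
next
  fix a show "dir_deriv A c p w (\<lambda>q. a) = 0"
    by (rule dir_deriv_eqI[OF has_derivative_const smooth_near_const[OF manifold]])
next
  fix f g S assume f: "smooth_near A p f" and S: "open S" "p \<in> S" "\<forall>q\<in>S. f q = g q"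
  have "((\<lambda>z. g (inv_coord c z)) has_derivative (\<lambda>w. dir_deriv A c p w f)) (at (coord c p))"
    using S p
    by (intro has_derivative_transform_within_open[OF smooth_near_derivative[OF f p],
          of "coord c ` (S \<inter> dom_of c)"] open_image) (auto intro: open_dom)
  then show "dir_deriv A c p w g = dir_deriv A c p w f"
  proof (rule dir_deriv_eqI)
    show "smooth_near A p g" by (rule smooth_near_cong[OF manifold f S(1,2)]) (simp add: S(3))
  qed
qed

text \<open>This is the chain rule on functions smooth near \<open>p\<close>; on all others both
  operators have the default value 0, so the vectors are equal as operators.\<close>

lemma dir_deriv_change_chart:
  assumes "c' \<in> A" "p \<in> dom_of c" "p \<in> dom_of c'"
  shows "dir_deriv A c' p w = dir_deriv A c p (frechet_derivative (transition c') (at (coord c' p)) w)"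
proof
  fix f
  show "dir_deriv A c' p w f = dir_deriv A c p (frechet_derivative (transition c') (at (coord c' p)) w) f"
  proof (cases "smooth_near A p f")
    case True
    then obtain S where S: "open S" "p \<in> S" "S \<subseteq> dom_of c"
      "smooth_on (coord c ` S) (\<lambda>z. f (inv_coord c z))"
      using smooth_nearE assms(2) by metis
    show ?thesis
      using frechet_derivative_eq[OF has_derivative_change_chart[OF S(1,3) assms(1) S(4) assms(3) S(2)]] True
      by (simp add: dir_deriv_def)
  qed (simp add: dir_deriv_def)
qed

lemma tangentE:
  assumes "X \<in> tangent A p" "p \<in> dom_of c"
  obtains w where "X = dir_deriv A c p w"
  using assms dir_deriv_change_chart unfolding tangent_def by blast

lemma dir_deriv_in_tangent: "p \<in> dom_of c \<Longrightarrow> dir_deriv A c p w \<in> tangent A p"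
  unfolding tangent_def using chart_in by blast

abbreviation coord_fun :: "'n \<Rightarrow> 'a \<Rightarrow> complex" where
  "coord_fun \<alpha> \<equiv> (\<lambda>q. coord c q $ \<alpha>)"

lemma smooth_fun_coord: "smooth_fun A (dom_of c) (coord_fun \<alpha>)"
proof -
  have op: "open (coord c ` dom_of c)" using open_image[OF open_dom] by simp
  have "smooth_on (coord c ` dom_of c) (\<lambda>z. z $ \<alpha>)"
    by (intro smooth_on_bounded_linear[OF bounded_linear_vec_nth] smooth_on_id op)
  then have "smooth_on (coord c ` dom_of c) (\<lambda>z. coord_fun \<alpha> (inv_coord c z))"
    by (rule smooth_on_cong[OF op, rotated]) (simp add: chart_coord_inv)
  then show ?thesis by (simp add: smooth_fun_iff[OF open_dom order_refl])
qed

lemma smooth_near_coord: "p \<in> dom_of c \<Longrightarrow> smooth_near A p (coord_fun \<alpha>)"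
  by (rule smooth_nearI[OF manifold open_dom smooth_fun_coord])

text \<open>Coordinate functions read off components, hence a vector determines its components in
  the chart. The uniqueness claims about vectors below rest on this.\<close>

lemma dir_deriv_coord [simp]:
  assumes "p \<in> dom_of c" shows "dir_deriv A c p w (coord_fun \<alpha>) = w $ \<alpha>"
proof -
  have "((\<lambda>z. z $ \<alpha>) has_derivative (\<lambda>w. w $ \<alpha>)) (at (coord c p))"
    by (rule bounded_linear_imp_has_derivative[OF bounded_linear_vec_nth])
  moreover have "open (coord c ` dom_of c)" "coord c p \<in> coord c ` dom_of c"
    using open_image[OF open_dom order_refl] assms by blast+
  ultimately have "((\<lambda>z. coord_fun \<alpha> (inv_coord c z)) has_derivative (\<lambda>w. w $ \<alpha>)) (at (coord c p))"
    by (rule has_derivative_transform_within_open) (simp add: chart_coord_inv)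
  then show ?thesis by (rule dir_deriv_eqI) (rule smooth_near_coord[OF assms])
qed

lemma dir_deriv_eq_iff: "p \<in> dom_of c \<Longrightarrow> dir_deriv A c p w = dir_deriv A c p w' \<longleftrightarrow> w = w'"
  by (metis dir_deriv_coord vec_eq_iff)

text \<open>The description does not depend on the chart, because the derivative of a transition map
  is complex linear and so commutes with multiplying components by \<i>.\<close>

lemma J_map_dir_deriv:
  assumes p: "p \<in> dom_of c"
  shows "J_map A p (dir_deriv A c p w) = dir_deriv A c p (\<i> *s w)"
  unfolding J_map_def
proof (rule the_equality)
  show "\<exists>c'\<in>A. p \<in> dom_of c' \<and> (\<exists>w'. dir_deriv A c p w = dir_deriv A c' p w'
      \<and> dir_deriv A c p (\<i> *s w) = dir_deriv A c' p (\<i> *s w'))"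
    using chart_in p by blast
next
  fix Y
  assume "\<exists>c'\<in>A. p \<in> dom_of c' \<and> (\<exists>w'. dir_deriv A c p w = dir_deriv A c' p w' \<and> Y = dir_deriv A c' p (\<i> *s w'))"
  then obtain c' w' where c': "c' \<in> A" "p \<in> dom_of c'" "dir_deriv A c p w = dir_deriv A c' p w'"
    "Y = dir_deriv A c' p (\<i> *s w')" by blast
  have "w = frechet_derivative (transition c') (at (coord c' p)) w'"
    using c'(3) by (simp add: dir_deriv_change_chart[OF c'(1) p c'(2)] dir_deriv_eq_iff[OF p])
  then show "Y = dir_deriv A c p (\<i> *s w)"
    using c'(2) p by (simp add: c'(4) dir_deriv_change_chart[OF c'(1) p c'(2)] transition_complex_linear[OF c'(1)])
qed

section \<open>The coordinate fields of types (1,0) and (0,1)\<close>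

lemma d_z_apply: "d_z A c \<alpha> p f = (dir_deriv A c p (axis \<alpha> 1) f - \<i> * dir_deriv A c p (axis \<alpha> \<i>) f) / 2"
  by (simp add: d_z_def)

lemma d_zbar_apply: "d_zbar A c \<alpha> p f = (dir_deriv A c p (axis \<alpha> 1) f + \<i> * dir_deriv A c p (axis \<alpha> \<i>) f) / 2"
  by (simp add: d_zbar_def)

lemma dir_deriv_expand:
  "p \<in> dom_of c \<Longrightarrow> dir_deriv A c p w f =
    (\<Sum>\<alpha>\<in>UNIV. w $ \<alpha> * d_z A c \<alpha> p f + cnj (w $ \<alpha>) * d_zbar A c \<alpha> p f)"
  unfolding d_z_apply d_zbar_apply by (rule linear_dz_dzbar[OF dir_deriv_linear])

definition hvec :: "'a \<Rightarrow> complex ^ 'n \<Rightarrow> 'a tvec" where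
  "hvec p w = (\<Sum>\<alpha>\<in>UNIV. w $ \<alpha> \<odot> d_z A c \<alpha> p)"

lemma hvec_apply: "hvec p w f = (\<Sum>\<alpha>\<in>UNIV. w $ \<alpha> * d_z A c \<alpha> p f)"
  by (simp add: hvec_def sum_tvec_apply)

text \<open>In \<open>X - \<i> \<odot> J_map A p X\<close> the \<open>d_z\<close> terms add up and
  the \<open>d_zbar\<close> terms cancel. Thus \<open>to10\<close> does not change the component
  vector, and real and (1,0) components may be identified.\<close>

lemma to10_dir_deriv: "p \<in> dom_of c \<Longrightarrow> to10 A p (dir_deriv A c p w) = hvec p w"
proof
  fix f assume p: "p \<in> dom_of c"
  have "dir_deriv A c p w f - \<i> * dir_deriv A c p (\<i> *s w) f
      = (\<Sum>\<alpha>\<in>UNIV. (w $ \<alpha> * d_z A c \<alpha> p f + cnj (w $ \<alpha>) * d_zbar A c \<alpha> p f)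
        - \<i> * (\<i> * w $ \<alpha> * d_z A c \<alpha> p f + cnj (\<i> * w $ \<alpha>) * d_zbar A c \<alpha> p f))"
    unfolding dir_deriv_expand[OF p] sum_distrib_left sum_subtractf[symmetric] by simp
  also have "\<dots> = (\<Sum>\<alpha>\<in>UNIV. 2 * (w $ \<alpha> * d_z A c \<alpha> p f))"
    by (intro sum.cong) (simp_all add: algebra_simps)
  finally show "to10 A p (dir_deriv A c p w) f = hvec p w f"
    by (simp add: to10_def J_map_dir_deriv[OF p] hvec_apply flip: sum_distrib_left)
qed

lemma derivation_d_z:
  assumes "p \<in> dom_of c" shows "derivation_at A p (d_z A c \<alpha> p)"
proof -
  have "d_z A c \<alpha> p = (\<lambda>f. 1/2 * dir_deriv A c p (axis \<alpha> 1) f + (-\<i>/2) * dir_deriv A c p (axis \<alpha> \<i>) f)"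
    by (rule ext) (simp add: d_z_apply field_simps)
  then show ?thesis by (simp only: derivation_at_combination derivation_dir_deriv assms)
qed

lemma derivation_d_zbar:
  assumes "p \<in> dom_of c" shows "derivation_at A p (d_zbar A c \<alpha> p)"
proof -
  have "d_zbar A c \<alpha> p = (\<lambda>f. 1/2 * dir_deriv A c p (axis \<alpha> 1) f + (\<i>/2) * dir_deriv A c p (axis \<alpha> \<i>) f)"
    by (rule ext) (simp add: d_zbar_apply field_simps)
  then show ?thesis by (simp only: derivation_at_combination derivation_dir_deriv assms)
qed

lemma d_z_coord: "p \<in> dom_of c \<Longrightarrow> d_z A c \<alpha> p (coord_fun \<beta>) = (if \<alpha> = \<beta> then 1 else 0)"
  by (simp add: d_z_apply axis_def)

lemma hvec_coord [simp]: "p \<in> dom_of c \<Longrightarrow> hvec p w (coord_fun \<alpha>) = w $ \<alpha>"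
  by (simp add: hvec_apply d_z_coord if_distrib cong: if_cong)

lemma hvec_eq_iff: "p \<in> dom_of c \<Longrightarrow> hvec p w = hvec p w' \<longleftrightarrow> w = w'"
  by (metis hvec_coord vec_eq_iff)

lemma hvec_axis: "hvec p (axis \<alpha> 1) = d_z A c \<alpha> p"
  by (rule ext) (simp add: hvec_apply axis_def if_distrib if_distribR cong: if_cong)

lemma hvec_add: "hvec p (w + w') = hvec p w + hvec p w'"
  by (rule ext) (simp add: hvec_apply algebra_simps sum.distrib)

lemma hvec_scale: "hvec p (a *s w) = a \<odot> hvec p w"
  by (rule ext) (simp add: hvec_apply algebra_simps sum_distrib_left)

lemma hvec_in_tangent10: "p \<in> dom_of c \<Longrightarrow> hvec p w \<in> tangent10 A p"
  unfolding tangent10_def hvec_def using chart_in by blast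

text \<open>The vector is the image under \<open>to10\<close> of the real vector with the same
  components in the other chart, and for real vectors the change of chart is known.\<close>

lemma tangent10E:
  assumes "X \<in> tangent10 A p" "p \<in> dom_of c"
  obtains w where "X = hvec p w"
proof -
  obtain c' \<zeta> where c': "c' \<in> A" "p \<in> dom_of c'" "X = (\<Sum>\<alpha>\<in>UNIV. \<zeta> \<alpha> \<odot> d_z A c' \<alpha> p)"
    using assms(1) unfolding tangent10_def by auto
  interpret c': holomorphic_chart A c' using manifold c' by unfold_locales
  have "X = c'.hvec p (\<chi> \<alpha>. \<zeta> \<alpha>)" by (simp add: c'.hvec_def c')
  also have "\<dots> = to10 A p (dir_deriv A c' p (\<chi> \<alpha>. \<zeta> \<alpha>))" by (simp add: c'.to10_dir_deriv c')
  also have "\<dots> = hvec p (frechet_derivative (transition c') (at (coord c' p)) (\<chi> \<alpha>. \<zeta> \<alpha>))"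
    by (simp add: dir_deriv_change_chart[OF c'(1) assms(2) c'(2)] to10_dir_deriv assms(2))
  finally show thesis by (rule that)
qed

lemma tangent_components:
  "X \<in> tangent A p \<Longrightarrow> p \<in> dom_of c \<Longrightarrow> X = dir_deriv A c p (\<chi> \<alpha>. X (coord_fun \<alpha>))"
  by (erule (1) tangentE) (simp add: dir_deriv_eq_iff vec_eq_iff)

lemma tangent10_components:
  "X \<in> tangent10 A p \<Longrightarrow> p \<in> dom_of c \<Longrightarrow> X = hvec p (\<chi> \<alpha>. X (coord_fun \<alpha>))"
  by (erule (1) tangent10E) (simp add: hvec_eq_iff vec_eq_iff)

lemma derivation_tangent: "X \<in> tangent A p \<Longrightarrow> p \<in> dom_of c \<Longrightarrow> derivation_at A p X"
  by (metis tangentE derivation_dir_deriv)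

section \<open>Second derivatives along coordinate fields\<close>

text \<open>A repeated derivative on the manifold becomes a repeated Frechet derivative in
  coordinates. The inner derivatives agree on the open image of \<open>S\<close>, which suffices for
  differentiating once more.\<close>

lemma
  assumes S: "open S" "S \<subseteq> dom_of c" and f: "smooth_fun A S f"
  shows smooth_fun_dir_deriv: "smooth_fun A S (\<lambda>q. dir_deriv A c q w f)"
    and dir_deriv_commute_aux: "p \<in> S \<Longrightarrow> dir_deriv A c p v (\<lambda>q. dir_deriv A c q w f)
      = frechet_derivative (\<lambda>z. frechet_derivative (\<lambda>z. f (inv_coord c z)) (at z) w) (at (coord c p)) v"
proof -
  let ?F = "\<lambda>z. f (inv_coord c z)"
  have F: "smooth_on (coord c ` S) ?F" using f smooth_fun_iff[OF S] by simp
  have op: "open (coord c ` S)" by (rule open_image[OF S])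
  have eq: "frechet_derivative ?F (at z) w = dir_deriv A c (inv_coord c z) w f" if zS: "z \<in> coord c ` S" for z
  proof -
    obtain q where q: "q \<in> S" "z = coord c q" using zS by blast
    then have "inv_coord c z = q" using S by auto
    then show ?thesis using q smooth_nearI[OF manifold S(1) f] by (simp add: dir_deriv_def)
  qed
  show sm: "smooth_fun A S (\<lambda>q. dir_deriv A c q w f)"
    unfolding smooth_fun_iff[OF S] by (rule smooth_on_cong[OF op eq smooth_on_frechet[OF F]])
  assume p: "p \<in> S"
  have "((\<lambda>z. dir_deriv A c (inv_coord c z) w f) has_derivative
      frechet_derivative (\<lambda>z. frechet_derivative ?F (at z) w) (at (coord c p))) (at (coord c p))"
    using p by (intro has_derivative_transform_within_open[OF smooth_on_derivative[OF smooth_on_frechet[OF F]] op _ eq])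
      auto
  then show "dir_deriv A c p v (\<lambda>q. dir_deriv A c q w f)
      = frechet_derivative (\<lambda>z. frechet_derivative ?F (at z) w) (at (coord c p)) v"
    by (rule dir_deriv_eqI) (rule smooth_nearI[OF manifold S(1) sm p])
qed

lemma dir_deriv_commute:
  assumes f: "smooth_near A p f" and p: "p \<in> dom_of c"
  shows "dir_deriv A c p v (\<lambda>q. dir_deriv A c q w f) = dir_deriv A c p w (\<lambda>q. dir_deriv A c q v f)"
proof -
  obtain S where S: "open S" "S \<subseteq> dom_of c" "p \<in> S" "smooth_fun A S f"
    "smooth_on (coord c ` S) (\<lambda>z. f (inv_coord c z))"
    using smooth_nearE[OF assms] by metis
  show ?thesis
    unfolding dir_deriv_commute_aux[OF S(1,2,4,3)] using S
    by (intro mixed_derivative_commute[OF open_image[OF S(1,2)]]) auto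
qed

lemma smooth_near_dir_deriv:
  "smooth_near A p f \<Longrightarrow> p \<in> dom_of c \<Longrightarrow> smooth_near A p (\<lambda>q. dir_deriv A c q w f)"
  by (erule (1) smooth_nearE) (blast intro: smooth_nearI[OF manifold] smooth_fun_dir_deriv)

lemma smooth_fun_d_z:
  assumes "open S" "S \<subseteq> dom_of c" "smooth_fun A S f"
  shows "smooth_fun A S (\<lambda>q. d_z A c \<alpha> q f)"
proof -
  have "smooth_fun A S (\<lambda>q. 1/2 * dir_deriv A c q (axis \<alpha> 1) f + (-\<i>/2) * dir_deriv A c q (axis \<alpha> \<i>) f)"
    by (intro smooth_fun_add smooth_fun_mult smooth_fun_const smooth_fun_dir_deriv manifold assms)
  then show ?thesis by (simp add: d_z_apply field_simps)
qed

lemma smooth_fun_d_zbar: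
  assumes "open S" "S \<subseteq> dom_of c" "smooth_fun A S f"
  shows "smooth_fun A S (\<lambda>q. d_zbar A c \<alpha> q f)"
proof -
  have "smooth_fun A S (\<lambda>q. 1/2 * dir_deriv A c q (axis \<alpha> 1) f + (\<i>/2) * dir_deriv A c q (axis \<alpha> \<i>) f)"
    by (intro smooth_fun_add smooth_fun_mult smooth_fun_const smooth_fun_dir_deriv manifold assms)
  then show ?thesis by (simp add: d_zbar_apply field_simps)
qed

lemma smooth_near_d_z: "smooth_near A p f \<Longrightarrow> p \<in> dom_of c \<Longrightarrow> smooth_near A p (\<lambda>q. d_z A c \<alpha> q f)"
  by (erule (1) smooth_nearE) (blast intro: smooth_nearI[OF manifold] smooth_fun_d_z)

lemma smooth_near_d_zbar: "smooth_near A p f \<Longrightarrow> p \<in> dom_of c \<Longrightarrow> smooth_near A p (\<lambda>q. d_zbar A c \<alpha> q f)"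
  by (erule (1) smooth_nearE) (blast intro: smooth_nearI[OF manifold] smooth_fun_d_zbar)

text \<open>For the directions \<open>axis \<beta> 1\<close> and \<open>axis \<beta> \<i>\<close>
  the inner function is \<open>d_z\<close> or \<open>d_zbar\<close> applied to \<open>f\<close>,
  according to whether \<open>b\<close> is \<open>-\<i>\<close> or \<open>\<i>\<close>; one
  statement serves both.\<close>

lemma derivation_lincomb_dir_deriv:
  assumes X: "derivation_at A p X" and f: "smooth_near A p f" and p: "p \<in> dom_of c"
  shows "X (\<lambda>q. (dir_deriv A c q u f + b * dir_deriv A c q v f) / 2)
    = (X (\<lambda>q. dir_deriv A c q u f) + b * X (\<lambda>q. dir_deriv A c q v f)) / 2"
proof -
  note sm = smooth_near_dir_deriv[OF f p] smooth_near_const[OF manifold]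
  have "X (\<lambda>q. 1/2 * dir_deriv A c q u f + (b/2) * dir_deriv A c q v f)
    = 1/2 * X (\<lambda>q. dir_deriv A c q u f) + (b/2) * X (\<lambda>q. dir_deriv A c q v f)"
    by (simp only: derivation_add[OF X] derivation_cmult[OF manifold X] sm smooth_near_mult[OF manifold])
  then show ?thesis by (simp add: add_divide_distrib)
qed

text \<open>Both operators expand into real coordinate directions, where second derivatives are
  symmetric.\<close>

lemma
  assumes f: "smooth_near A p f" and p: "p \<in> dom_of c"
  shows d_z_commute: "d_z A c \<alpha> p (\<lambda>q. d_z A c \<beta> q f) = d_z A c \<beta> p (\<lambda>q. d_z A c \<alpha> q f)"
    and d_zbar_commute: "d_zbar A c \<alpha> p (\<lambda>q. d_zbar A c \<beta> q f) = d_zbar A c \<beta> p (\<lambda>q. d_zbar A c \<alpha> q f)"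
    and d_z_d_zbar_commute: "d_z A c \<alpha> p (\<lambda>q. d_zbar A c \<beta> q f) = d_zbar A c \<beta> p (\<lambda>q. d_z A c \<alpha> q f)"
proof -
  note lincomb = derivation_lincomb_dir_deriv[OF derivation_dir_deriv[OF p] f p]
  have P: "dir_deriv A c p v (\<lambda>q. d_z A c \<beta> q f) = (dir_deriv A c p v (\<lambda>q. dir_deriv A c q (axis \<beta> 1) f)
      - \<i> * dir_deriv A c p v (\<lambda>q. dir_deriv A c q (axis \<beta> \<i>) f)) / 2" for v \<beta>
    using lincomb[where b = "-\<i>" and u = "axis \<beta> 1" and v = "axis \<beta> \<i>"] by (simp add: d_z_apply)
  have Q: "dir_deriv A c p v (\<lambda>q. d_zbar A c \<beta> q f) = (dir_deriv A c p v (\<lambda>q. dir_deriv A c q (axis \<beta> 1) f)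
      + \<i> * dir_deriv A c p v (\<lambda>q. dir_deriv A c q (axis \<beta> \<i>) f)) / 2" for v \<beta>
    using lincomb[where b = "\<i>" and u = "axis \<beta> 1" and v = "axis \<beta> \<i>"] by (simp add: d_zbar_apply)
  note comm = dir_deriv_commute[OF f p, of "axis \<alpha> 1" "axis \<beta> 1"]
    dir_deriv_commute[OF f p, of "axis \<alpha> \<i>" "axis \<beta> \<i>"]
    dir_deriv_commute[OF f p, of "axis \<alpha> 1" "axis \<beta> \<i>"]
    dir_deriv_commute[OF f p, of "axis \<alpha> \<i>" "axis \<beta> 1"]
  show "d_z A c \<alpha> p (\<lambda>q. d_z A c \<beta> q f) = d_z A c \<beta> p (\<lambda>q. d_z A c \<alpha> q f)"
    unfolding d_z_apply[of \<alpha> p "\<lambda>q. d_z A c \<beta> q f"] d_z_apply[of \<beta> p "\<lambda>q. d_z A c \<alpha> q f"] P comm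
    by (simp add: field_simps)
  show "d_zbar A c \<alpha> p (\<lambda>q. d_zbar A c \<beta> q f) = d_zbar A c \<beta> p (\<lambda>q. d_zbar A c \<alpha> q f)"
    unfolding d_zbar_apply[of \<alpha> p "\<lambda>q. d_zbar A c \<beta> q f"] d_zbar_apply[of \<beta> p "\<lambda>q. d_zbar A c \<alpha> q f"] Q comm
    by (simp add: field_simps)
  show "d_z A c \<alpha> p (\<lambda>q. d_zbar A c \<beta> q f) = d_zbar A c \<beta> p (\<lambda>q. d_z A c \<alpha> q f)"
    unfolding d_z_apply[of \<alpha> p "\<lambda>q. d_zbar A c \<beta> q f"] d_zbar_apply[of \<beta> p "\<lambda>q. d_z A c \<alpha> q f"] P Q comm
    by (simp add: field_simps)
qed

lemma dir_deriv_cnj: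
  assumes "smooth_near A p f" "p \<in> dom_of c"
  shows "dir_deriv A c p w (\<lambda>q. cnj (f q)) = cnj (dir_deriv A c p w f)"
  by (rule dir_deriv_eqI[OF bounded_linear.has_derivative[OF bounded_linear_cnj smooth_near_derivative[OF assms]]])
     (rule smooth_near_cnj[OF manifold assms(1)])

lemma d_zbar_cnj:
  "smooth_near A p f \<Longrightarrow> p \<in> dom_of c \<Longrightarrow> d_zbar A c \<alpha> p (\<lambda>q. cnj (f q)) = cnj (d_z A c \<alpha> p f)"
  by (simp add: d_zbar_apply d_z_apply dir_deriv_cnj)

lemma d_z_cnj:
  "smooth_near A p f \<Longrightarrow> p \<in> dom_of c \<Longrightarrow> d_z A c \<alpha> p (\<lambda>q. cnj (f q)) = cnj (d_zbar A c \<alpha> p f)"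
  by (simp add: d_zbar_apply d_z_apply dir_deriv_cnj)

section \<open>Smooth sections and the Lie bracket in components\<close>

text \<open>A smooth section must act smoothly on all functions smooth on smaller open sets. Smooth
  components suffice, since \<open>s q f\<close> is a sum of products of them, or their conjugates,
  with coordinate derivatives of \<open>f\<close>; \<open>smooth_section_coord\<close> is the
  converse.\<close>

lemma smooth_section_tangentI:
  assumes S: "open S" "S \<subseteq> dom_of c" and s: "\<And>q. q \<in> S \<Longrightarrow> s q = dir_deriv A c q (a q)"
    and a: "\<And>\<alpha>. smooth_fun A S (\<lambda>q. a q $ \<alpha>)"
  shows "smooth_section A (tangent A) S s"
  unfolding smooth_section_def
proof (intro conjI ballI allI impI; (elim conjE)?)
  fix p assume "p \<in> S"
  then show "s p \<in> tangent A p" using s S dir_deriv_in_tangent by auto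
next
  fix T f assume T: "open T" "T \<subseteq> S" and f: "smooth_fun A T f"
  have T': "T \<subseteq> dom_of c" using T S by auto
  have "smooth_fun A T (\<lambda>q. \<Sum>\<alpha>\<in>UNIV. a q $ \<alpha> * d_z A c \<alpha> q f + cnj (a q $ \<alpha>) * d_zbar A c \<alpha> q f)"
    using smooth_fun_subset[OF a T(2)]
    by (intro smooth_fun_intros[OF manifold] smooth_fun_d_z smooth_fun_d_zbar T T' f) auto
  then show "smooth_fun A T (\<lambda>q. s q f)"
    by (rule smooth_fun_cong[OF manifold T(1)]) (use s T T' in \<open>auto simp: dir_deriv_expand subset_iff\<close>)
qed

lemma smooth_section_tangent10I:
  assumes S: "open S" "S \<subseteq> dom_of c" and s: "\<And>q. q \<in> S \<Longrightarrow> s q = hvec q (a q)"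
    and a: "\<And>\<alpha>. smooth_fun A S (\<lambda>q. a q $ \<alpha>)"
  shows "smooth_section A (tangent10 A) S s"
  unfolding smooth_section_def
proof (intro conjI ballI allI impI; (elim conjE)?)
  fix p assume "p \<in> S"
  then show "s p \<in> tangent10 A p" using s S hvec_in_tangent10 by auto
next
  fix T f assume T: "open T" "T \<subseteq> S" and f: "smooth_fun A T f"
  have T': "T \<subseteq> dom_of c" using T S by auto
  have "smooth_fun A T (\<lambda>q. \<Sum>\<alpha>\<in>UNIV. a q $ \<alpha> * d_z A c \<alpha> q f)"
    using smooth_fun_subset[OF a T(2)]
    by (intro smooth_fun_intros[OF manifold] smooth_fun_d_z T T' f) auto
  then show "smooth_fun A T (\<lambda>q. s q f)"
    by (rule smooth_fun_cong[OF manifold T(1)]) (use s T T' in \<open>auto simp: hvec_apply subset_iff\<close>)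
qed

lemma smooth_section_coord:
  assumes "open S" "S \<subseteq> dom_of c" "smooth_section A E S s"
  shows "smooth_fun A S (\<lambda>q. s q (coord_fun \<alpha>))"
  using assms smooth_fun_subset[OF smooth_fun_coord assms(2)] unfolding smooth_section_def by blast

text \<open>Makes holomorphic compatibility applicable to the frame. On a holomorphic
  \<open>f\<close> the field acts as the derivative in the direction \<open>axis \<alpha> 1\<close>,
  which by symmetry of second derivatives again satisfies the Cauchy-Riemann equations.\<close>

lemma holomorphic_section_d_z: "holomorphic_section A (dom_of c) (d_z A c \<alpha>)"
  unfolding holomorphic_section_def
proof (intro conjI allI impI; (elim conjE)?)
  show "smooth_section A (tangent10 A) (dom_of c) (d_z A c \<alpha>)"
    by (rule smooth_section_tangent10I[OF open_dom order_refl hvec_axis[symmetric]])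
       (intro smooth_fun_const[OF manifold] open_dom)
next
  fix S f assume S: "open S" "S \<subseteq> dom_of c" and f: "holomorphic_fun A S f"
  let ?F = "\<lambda>z. f (inv_coord c z)" and ?e = "axis \<alpha> 1"
  have F: "smooth_on (coord c ` S) ?F"
    and Fi: "\<And>z v. z \<in> coord c ` S \<Longrightarrow> frechet_derivative ?F (at z) (\<i> *s v) = \<i> * frechet_derivative ?F (at z) v"
    using f unfolding holomorphic_fun_iff[OF S] holomorphic_vec_on_def by auto
  have sm: "smooth_fun A S f" using F smooth_fun_iff[OF S] by simp
  have op: "open (coord c ` S)" by (rule open_image[OF S])
  have eq: "d_z A c \<alpha> (inv_coord c z) f = frechet_derivative ?F (at z) ?e" if zS: "z \<in> coord c ` S" for z
  proof -
    obtain q where q: "q \<in> S" "z = coord c q" using zS by blast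
    then have zq: "inv_coord c z = q" using S by auto
    have ax: "axis \<alpha> \<i> = \<i> *s (axis \<alpha> 1 :: complex ^ 'n)" by (simp add: vec_eq_iff axis_def)
    have "dir_deriv A c q w f = frechet_derivative ?F (at z) w" for w
      using q smooth_nearI[OF manifold S(1) sm] by (simp add: dir_deriv_def)
    then show ?thesis using Fi[OF zS] by (simp add: d_z_apply zq ax)
  qed
  have dF: "smooth_on (coord c ` S) (\<lambda>z. frechet_derivative ?F (at z) v)" for v
    by (rule smooth_on_frechet[OF F])
  have "holomorphic_vec_on (coord c ` S) (\<lambda>z. d_z A c \<alpha> (inv_coord c z) f)"
    unfolding holomorphic_vec_on_def
  proof (intro conjI ballI allI)
    show "smooth_on (coord c ` S) (\<lambda>z. d_z A c \<alpha> (inv_coord c z) f)"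
      by (rule smooth_on_cong[OF op _ dF]) (simp add: eq)
    fix z v assume z: "z \<in> coord c ` S"
    have 1: "frechet_derivative (\<lambda>z. d_z A c \<alpha> (inv_coord c z) f) (at z)
        = frechet_derivative (\<lambda>z. frechet_derivative ?F (at z) ?e) (at z)"
      by (rule frechet_derivative_transform_within_open[symmetric, OF smooth_on_differentiable[OF dF z] op z])
         (simp add: eq)
    have 2: "frechet_derivative (\<lambda>z. frechet_derivative ?F (at z) (\<i> *s v)) (at z)
        = frechet_derivative (\<lambda>z. \<i> * frechet_derivative ?F (at z) v) (at z)"
      by (rule frechet_derivative_transform_within_open[OF smooth_on_differentiable[OF dF z] op z]) (rule Fi)
    \<comment> \<open>Once the two derivatives are exchanged, the Cauchy-Riemann equation of
      \<open>?F\<close>, valid on the whole open image, is differentiated along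
      \<open>?e\<close>.\<close>
    show "frechet_derivative (\<lambda>z. d_z A c \<alpha> (inv_coord c z) f) (at z) (\<i> *s v)
        = \<i> * frechet_derivative (\<lambda>z. d_z A c \<alpha> (inv_coord c z) f) (at z) v"
      unfolding 1 mixed_derivative_commute[OF op z F, of ?e] 2
      by (rule frechet_derivative_bounded_linear[OF bounded_linear_mult_right smooth_on_differentiable[OF dF z]])
  qed
  then show "holomorphic_fun A S (\<lambda>p. d_z A c \<alpha> p f)" unfolding holomorphic_fun_iff[OF S] .
qed

text \<open>The second derivatives of \<open>f\<close> in \<open>v (w f)\<close> and
  \<open>w (v f)\<close> have the same coefficients and cancel, leaving a first order operator. If
  \<open>f\<close> is not smooth near \<open>p\<close>, both sides are 0 by default.\<close>

lemma lie_bracket_eq: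
  assumes S: "open S" "S \<subseteq> dom_of c" "p \<in> S"
    and v: "smooth_section A (tangent A) S v" and w: "smooth_section A (tangent A) S w"
  shows "lie_bracket A v w p =
    dir_deriv A c p (\<chi> \<alpha>. v p (\<lambda>q. w q (coord_fun \<alpha>)) - w p (\<lambda>q. v q (coord_fun \<alpha>)))"
    (is "_ = dir_deriv A c p ?l")
proof
  fix f
  show "lie_bracket A v w p f = dir_deriv A c p ?l f"
  proof (cases "smooth_near A p f")
    case f: True
    have p: "p \<in> dom_of c" using S by auto
    let ?P = "\<lambda>\<alpha> q. d_z A c \<alpha> q f" and ?Q = "\<lambda>\<alpha> q. d_zbar A c \<alpha> q f"
    let ?c = "\<lambda>v \<alpha> q. v q (coord_fun \<alpha>)"
    \<comment> \<open>The Leibniz rule separates derivatives of the components of \<open>y\<close>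
      from second derivatives of \<open>f\<close>; the latter fall into four combinations of
      types.\<close>
    have second: "x p (\<lambda>q. y q f) = (\<Sum>\<alpha>\<in>UNIV. x p (?c y \<alpha>) * ?P \<alpha> p + cnj (x p (?c y \<alpha>)) * ?Q \<alpha> p)
       + (\<Sum>\<alpha>\<in>UNIV. \<Sum>\<beta>\<in>UNIV.
           ?c y \<alpha> p * ?c x \<beta> p * d_z A c \<beta> p (?P \<alpha>) + ?c y \<alpha> p * cnj (?c x \<beta> p) * d_zbar A c \<beta> p (?P \<alpha>)
         + (cnj (?c y \<alpha> p) * ?c x \<beta> p * d_z A c \<beta> p (?Q \<alpha>)
            + cnj (?c y \<alpha> p) * cnj (?c x \<beta> p) * d_zbar A c \<beta> p (?Q \<alpha>)))"
      if x: "smooth_section A (tangent A) S x" and y: "smooth_section A (tangent A) S y" for x y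
    proof -
      have X: "x p \<in> tangent A p" using x S by (auto simp: smooth_section_def)
      note D = derivation_tangent[OF X p]
      have sy: "smooth_near A p (?c y \<alpha>)" for \<alpha>
        by (rule smooth_nearI[OF manifold S(1) smooth_section_coord[OF S(1,2) y] S(3)])
      note sm = smooth_near_intros[OF manifold] sy smooth_near_d_z[OF f p] smooth_near_d_zbar[OF f p]
      have xp: "x p g = (\<Sum>\<beta>\<in>UNIV. ?c x \<beta> p * d_z A c \<beta> p g + cnj (?c x \<beta> p) * d_zbar A c \<beta> p g)" for g
        by (subst tangent_components[OF X p]) (simp add: dir_deriv_expand[OF p])
      \<comment> \<open>A real vector commutes with conjugation, so the conjugate components bring
        in no new derivatives.\<close>
      have cnjx: "x p (\<lambda>q. cnj (?c y \<alpha> q)) = cnj (x p (?c y \<alpha>))" for \<alpha>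
        using tangentE[OF X p] dir_deriv_cnj[OF sy p] by metis
      have "x p (\<lambda>q. y q f) = x p (\<lambda>q. \<Sum>\<alpha>\<in>UNIV. ?c y \<alpha> q * ?P \<alpha> q + cnj (?c y \<alpha> q) * ?Q \<alpha> q)"
      proof (rule derivation_cong[OF D _ S(1,3)])
        fix q assume q: "q \<in> S"
        have yq: "y q f = dir_deriv A c q (\<chi> \<alpha>. y q (coord_fun \<alpha>)) f"
          using y S q by (intro fun_cong[OF tangent_components]) (auto simp: smooth_section_def)
        have "q \<in> dom_of c" using q S by auto
        from dir_deriv_expand[OF this]
        show "(\<Sum>\<alpha>\<in>UNIV. ?c y \<alpha> q * ?P \<alpha> q + cnj (?c y \<alpha> q) * ?Q \<alpha> q) = y q f"
          unfolding yq by simp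
      qed (intro sm)
      also have "\<dots> = (\<Sum>\<alpha>\<in>UNIV. x p (?c y \<alpha>) * ?P \<alpha> p + ?c y \<alpha> p * x p (?P \<alpha>)
          + (cnj (x p (?c y \<alpha>)) * ?Q \<alpha> p + cnj (?c y \<alpha> p) * x p (?Q \<alpha>)))"
        by (simp only: derivation_sum[OF manifold D] derivation_add[OF D] derivation_mult[OF D] sm cnjx)
      also have "\<dots> = (\<Sum>\<alpha>\<in>UNIV. x p (?c y \<alpha>) * ?P \<alpha> p + cnj (x p (?c y \<alpha>)) * ?Q \<alpha> p)
         + (\<Sum>\<alpha>\<in>UNIV. ?c y \<alpha> p * x p (?P \<alpha>) + cnj (?c y \<alpha> p) * x p (?Q \<alpha>))"
        by (simp add: sum.distrib algebra_simps)
      finally show ?thesis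
        unfolding xp[of "?P _"] xp[of "?Q _"]
        by (simp add: sum_distrib_left sum.distrib algebra_simps)
    qed
    \<comment> \<open>Fields and summation indices are exchanged together; the commutation of
      \<open>d_z\<close> and \<open>d_zbar\<close> restores the same second derivatives.\<close>
    have sym: "(\<Sum>\<alpha>\<in>UNIV. \<Sum>\<beta>\<in>UNIV.
           ?c y \<alpha> p * ?c x \<beta> p * d_z A c \<beta> p (?P \<alpha>) + ?c y \<alpha> p * cnj (?c x \<beta> p) * d_zbar A c \<beta> p (?P \<alpha>)
         + (cnj (?c y \<alpha> p) * ?c x \<beta> p * d_z A c \<beta> p (?Q \<alpha>)
            + cnj (?c y \<alpha> p) * cnj (?c x \<beta> p) * d_zbar A c \<beta> p (?Q \<alpha>)))
       = (\<Sum>\<alpha>\<in>UNIV. \<Sum>\<beta>\<in>UNIV.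
           ?c x \<alpha> p * ?c y \<beta> p * d_z A c \<beta> p (?P \<alpha>) + ?c x \<alpha> p * cnj (?c y \<beta> p) * d_zbar A c \<beta> p (?P \<alpha>)
         + (cnj (?c x \<alpha> p) * ?c y \<beta> p * d_z A c \<beta> p (?Q \<alpha>)
            + cnj (?c x \<alpha> p) * cnj (?c y \<beta> p) * d_zbar A c \<beta> p (?Q \<alpha>)))" for x y
      by (subst sum.swap, intro sum.cong refl)
         (simp add: d_z_d_zbar_commute[OF f p] d_z_commute[OF f p] d_zbar_commute[OF f p] algebra_simps)
    have "lie_bracket A v w p f = v p (\<lambda>q. w q f) - w p (\<lambda>q. v q f)"
      using f by (simp add: lie_bracket_def)
    also have "\<dots> = (\<Sum>\<alpha>\<in>UNIV. v p (?c w \<alpha>) * ?P \<alpha> p + cnj (v p (?c w \<alpha>)) * ?Q \<alpha> p)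
        - (\<Sum>\<alpha>\<in>UNIV. w p (?c v \<alpha>) * ?P \<alpha> p + cnj (w p (?c v \<alpha>)) * ?Q \<alpha> p)"
      unfolding second[OF v w] second[OF w v] sym[of w v] by simp
    also have "\<dots> = dir_deriv A c p ?l f"
      by (simp add: dir_deriv_expand[OF p] sum_subtractf[symmetric] algebra_simps)
    finally show ?thesis .
  qed (simp add: lie_bracket_def dir_deriv_def)
qed

end

section \<open>The Chern connection in a chart\<close>

lemma smooth_section_subset:
  assumes "smooth_section A E S s" "T \<subseteq> S" shows "smooth_section A E T s"
  unfolding smooth_section_def
proof (intro conjI ballI allI impI; (elim conjE)?)
  show "s p \<in> E p" if "p \<in> T" for p using assms that by (auto simp: smooth_section_def)
  fix S' f assume "open S'" "S' \<subseteq> T" "smooth_fun A S' f"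
  then show "smooth_fun A S' (\<lambda>p. s p f)"
    using assms(1)[unfolded smooth_section_def, THEN conjunct2, THEN spec[of _ S'], THEN spec[of _ f]] assms(2)
    by simp
qed

lemma smooth_section_fibre: "smooth_section A E S s \<Longrightarrow> p \<in> S \<Longrightarrow> s p \<in> E p"
  by (simp add: smooth_section_def)

lemma smooth_section_apply:
  assumes "smooth_section A E S s" "open S" "smooth_fun A S f"
  shows "smooth_fun A S (\<lambda>p. s p f)"
  using assms(1)[unfolded smooth_section_def, THEN conjunct2, THEN spec[of _ S], THEN spec[of _ f]] assms(2,3)
  by simp

lemma matrix_mult_matrix_inv:
  assumes "invertible (M :: 'a::semiring_1 ^ 'n ^ 'n)" shows "M ** matrix_inv M = mat 1"
  using assms unfolding invertible_def matrix_inv_def by (rule someI2_ex) simp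

text \<open>Removes the (2,0)-part of the curvature, where an antisymmetric coefficient built from
  two directions multiplies an expression symmetric in its indices.\<close>

lemma antisymmetric_sum_zero:
  fixes a :: "'i \<Rightarrow> 'i \<Rightarrow> complex"
  assumes "\<And>\<gamma> \<delta>. a \<gamma> \<delta> = - a \<delta> \<gamma>" "\<And>\<gamma> \<delta>. b \<gamma> \<delta> = b \<delta> \<gamma>"
  shows "(\<Sum>\<gamma>\<in>I. \<Sum>\<delta>\<in>I. a \<gamma> \<delta> * b \<gamma> \<delta>) = 0"
proof -
  have "(\<Sum>\<gamma>\<in>I. \<Sum>\<delta>\<in>I. a \<gamma> \<delta> * b \<gamma> \<delta>) = (\<Sum>\<gamma>\<in>I. \<Sum>\<delta>\<in>I. a \<delta> \<gamma> * b \<delta> \<gamma>)"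
    by (rule sum.swap)
  also have "\<dots> = (\<Sum>\<gamma>\<in>I. \<Sum>\<delta>\<in>I. - (a \<gamma> \<delta> * b \<gamma> \<delta>))"
    by (intro sum.cong refl) (metis assms mult_minus_left)
  finally show ?thesis by (simp add: sum_negf)
qed

lemma sum_swap_pairs:
  "(\<Sum>\<kappa>\<in>I. \<Sum>\<delta>\<in>J. \<Sum>\<alpha>\<in>K. \<Sum>\<gamma>\<in>L. F \<kappa> \<delta> \<alpha> \<gamma>) = (\<Sum>\<alpha>\<in>K. \<Sum>\<gamma>\<in>L. \<Sum>\<kappa>\<in>I. \<Sum>\<delta>\<in>J. F \<kappa> \<delta> \<alpha> \<gamma>)"
proof -
  have "(\<Sum>\<kappa>\<in>I. \<Sum>\<delta>\<in>J. \<Sum>\<alpha>\<in>K. \<Sum>\<gamma>\<in>L. F \<kappa> \<delta> \<alpha> \<gamma>) = (\<Sum>\<kappa>\<in>I. \<Sum>\<alpha>\<in>K. \<Sum>\<gamma>\<in>L. \<Sum>\<delta>\<in>J. F \<kappa> \<delta> \<alpha> \<gamma>)"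
    by (rule sum.cong[OF refl], subst sum.swap, rule sum.cong[OF refl], rule sum.swap)
  also have "\<dots> = (\<Sum>\<alpha>\<in>K. \<Sum>\<gamma>\<in>L. \<Sum>\<kappa>\<in>I. \<Sum>\<delta>\<in>J. F \<kappa> \<delta> \<alpha> \<gamma>)"
    by (subst sum.swap, rule sum.cong[OF refl], rule sum.swap)
  finally show ?thesis .
qed

text \<open>The algebra of the curvature at a point, with values abstracted to letters:
  \<open>a\<close>, \<open>x\<close>, \<open>y\<close> are the components of u, v, w; a prefixed
  \<open>x\<close> or \<open>y\<close> marks differentiation along v or w; \<open>G\<close> and
  \<open>K\<close> are connection coefficients, \<open>G\<close> with the last index fixed;
  \<open>V\<close> and \<open>W\<close> are second derivatives of a component of u. Terms with first
  derivatives of \<open>a\<close> cancel in pairs, those with derivatives of \<open>x\<close> and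
  \<open>y\<close> cancel against the bracket. What is left is tensorial.\<close>

lemma curvature_sum_identity:
  fixes a x y :: "'n::finite \<Rightarrow> complex"
  shows "(V + (\<Sum>\<alpha>\<in>UNIV. \<Sum>\<gamma>\<in>UNIV. xa \<alpha> * y \<gamma> * G \<gamma> \<alpha> + a \<alpha> * xy \<gamma> * G \<gamma> \<alpha>
        + a \<alpha> * y \<gamma> * xG \<gamma> \<alpha> + ya \<alpha> * x \<gamma> * G \<gamma> \<alpha>)
      + (\<Sum>\<alpha>\<in>UNIV. \<Sum>\<gamma>\<in>UNIV. \<Sum>\<kappa>\<in>UNIV. \<Sum>\<delta>\<in>UNIV. a \<alpha> * y \<gamma> * x \<delta> * K \<gamma> \<alpha> \<kappa> * G \<delta> \<kappa>))
    - (W + (\<Sum>\<alpha>\<in>UNIV. \<Sum>\<gamma>\<in>UNIV. ya \<alpha> * x \<gamma> * G \<gamma> \<alpha> + a \<alpha> * yx \<gamma> * G \<gamma> \<alpha>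
        + a \<alpha> * x \<gamma> * yG \<gamma> \<alpha> + xa \<alpha> * y \<gamma> * G \<gamma> \<alpha>)
      + (\<Sum>\<alpha>\<in>UNIV. \<Sum>\<gamma>\<in>UNIV. \<Sum>\<kappa>\<in>UNIV. \<Sum>\<delta>\<in>UNIV. a \<alpha> * x \<gamma> * y \<delta> * K \<gamma> \<alpha> \<kappa> * G \<delta> \<kappa>))
    - (V - W + (\<Sum>\<alpha>\<in>UNIV. \<Sum>\<gamma>\<in>UNIV. a \<alpha> * (xy \<gamma> - yx \<gamma>) * G \<gamma> \<alpha>))
    = (\<Sum>\<alpha>\<in>UNIV. a \<alpha> * (\<Sum>\<gamma>\<in>UNIV. (y \<gamma> * xG \<gamma> \<alpha> - x \<gamma> * yG \<gamma> \<alpha>)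
        + (\<Sum>\<kappa>\<in>UNIV. \<Sum>\<delta>\<in>UNIV. (y \<gamma> * x \<delta> - x \<gamma> * y \<delta>) * K \<gamma> \<alpha> \<kappa> * G \<delta> \<kappa>)))"
  by (simp add: algebra_simps sum.distrib sum_subtractf sum_distrib_left)

section \<open>Connection coefficients\<close>

locale chern_chart = holomorphic_chart A c
  for A :: "('a::{t2_space, second_countable_topology}, 'n::finite) chart set" and c :: "('a, 'n) chart" +
  fixes h :: "'a \<Rightarrow> 'a tvec \<Rightarrow> 'a tvec \<Rightarrow> complex" and D :: "'a conn"
  assumes metric: "hermitian_metric A h" and chern: "chern_connection A h D"
begin

abbreviation frame :: "'n \<Rightarrow> 'a field" where
  "frame \<alpha> \<equiv> d_z A c \<alpha>"

lemma section_frame: "smooth_section A (tangent10 A) (dom_of c) (frame \<alpha>)"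
  using holomorphic_section_d_z by (simp add: holomorphic_section_def)

lemma
  assumes S: "open S" and s: "smooth_section A (tangent10 A) S s"
  shows D_in_tangent10: "p \<in> S \<Longrightarrow> X \<in> tangent A p \<Longrightarrow> D s p X \<in> tangent10 A p"
    and section_D: "smooth_section A (tangent A) S v \<Longrightarrow> smooth_section A (tangent10 A) S (\<lambda>p. D s p (v p))"
    and D_direction: "p \<in> S \<Longrightarrow> X \<in> tangent A p \<Longrightarrow> Y \<in> tangent A p \<Longrightarrow>
      D s p (of_real a \<odot> X + of_real b \<odot> Y) = of_real a \<odot> D s p X + of_real b \<odot> D s p Y"
    and D_add: "smooth_section A (tangent10 A) S t \<Longrightarrow> p \<in> S \<Longrightarrow> X \<in> tangent A p \<Longrightarrow>
      D (\<lambda>q. s q + t q) p X = D s p X + D t p X"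
    and D_Leibniz: "smooth_fun A S f \<Longrightarrow> p \<in> S \<Longrightarrow> X \<in> tangent A p \<Longrightarrow>
      D (\<lambda>q. f q \<odot> s q) p X = X f \<odot> s p + f p \<odot> D s p X"
    and D_local: "(\<And>q. q \<in> S \<Longrightarrow> t q = s q) \<Longrightarrow> p \<in> S \<Longrightarrow> X \<in> tangent A p \<Longrightarrow> D t p X = D s p X"
proof -
  have "connection10 A D" using chern by (simp add: chern_connection_def)
  note K = this[unfolded connection10_def, THEN spec[of _ S], THEN spec[of _ s], THEN mp, OF conjI[OF S s]]
  note K1 = K[THEN conjunct2] note K2 = K1[THEN conjunct2] note K3 = K2[THEN conjunct2]
  note K4 = K3[THEN conjunct2]
  show "p \<in> S \<Longrightarrow> X \<in> tangent A p \<Longrightarrow> D s p X \<in> tangent10 A p"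
    by (rule K[THEN conjunct1, rule_format])
  show "smooth_section A (tangent A) S v \<Longrightarrow> smooth_section A (tangent10 A) S (\<lambda>p. D s p (v p))"
    by (rule K1[THEN conjunct1, THEN spec[of _ v], THEN mp])
  show "p \<in> S \<Longrightarrow> X \<in> tangent A p \<Longrightarrow> Y \<in> tangent A p \<Longrightarrow>
      D s p (of_real a \<odot> X + of_real b \<odot> Y) = of_real a \<odot> D s p X + of_real b \<odot> D s p Y"
    by (rule K2[THEN conjunct1, rule_format])
  show "smooth_section A (tangent10 A) S t \<Longrightarrow> p \<in> S \<Longrightarrow> X \<in> tangent A p \<Longrightarrow>
      D (\<lambda>q. s q + t q) p X = D s p X + D t p X"
    by (rule K3[THEN conjunct1, THEN spec[of _ t], THEN mp, THEN bspec, THEN bspec])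
  show "smooth_fun A S f \<Longrightarrow> p \<in> S \<Longrightarrow> X \<in> tangent A p \<Longrightarrow>
      D (\<lambda>q. f q \<odot> s q) p X = X f \<odot> s p + f p \<odot> D s p X"
    by (rule K4[THEN conjunct1, THEN spec[of _ f], THEN mp, THEN bspec, THEN bspec])
  show "(\<And>q. q \<in> S \<Longrightarrow> t q = s q) \<Longrightarrow> p \<in> S \<Longrightarrow> X \<in> tangent A p \<Longrightarrow> D t p X = D s p X"
    by (rule K4[THEN conjunct2, THEN spec[of _ t], THEN mp, THEN bspec, THEN bspec]) simp_all
qed

text \<open>The coefficient of the \<gamma>-th coordinate differential in the connection form. The
  real direction \<open>axis \<gamma> 1\<close> suffices, since by \<open>D_frame\<close> the
  dependence on the direction is complex linear.\<close>

definition christoffel :: "'n \<Rightarrow> 'n \<Rightarrow> 'n \<Rightarrow> 'a \<Rightarrow> complex" where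
  "christoffel \<gamma> \<alpha> \<beta> q = D (frame \<alpha>) q (dir_deriv A c q (axis \<gamma> 1)) (coord_fun \<beta>)"

lemma smooth_fun_christoffel: "smooth_fun A (dom_of c) (christoffel \<gamma> \<alpha> \<beta>)"
proof -
  have "smooth_section A (tangent A) (dom_of c) (\<lambda>q. dir_deriv A c q (axis \<gamma> 1))"
    by (rule smooth_section_tangentI[OF open_dom order_refl refl]) (rule smooth_fun_const[OF manifold open_dom])
  from smooth_section_coord[OF open_dom order_refl section_D[OF open_dom section_frame this]]
  show ?thesis by (simp add: christoffel_def[abs_def])
qed

lemma D_frame:
  assumes q: "q \<in> dom_of c"
  shows "D (frame \<alpha>) q (dir_deriv A c q w) = hvec q (\<chi> \<beta>. \<Sum>\<gamma>\<in>UNIV. w $ \<gamma> * christoffel \<gamma> \<alpha> \<beta> q)"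
proof -
  note tan = dir_deriv_in_tangent[OF q]
  define L where "L \<beta> w = D (frame \<alpha>) q (dir_deriv A c q w) (coord_fun \<beta>)" for \<beta> w
  have lin: "linear (L \<beta>)" for \<beta>
  proof -
    have dir: "dir_deriv A c q (a *\<^sub>R x + b *\<^sub>R y) = of_real a \<odot> dir_deriv A c q x + of_real b \<odot> dir_deriv A c q y"
      for a b x y
      by (rule ext) (simp add: linear_add[OF dir_deriv_linear[OF q]] linear_scale[OF dir_deriv_linear[OF q]]
          scaleR_conv_of_real[where 'a = complex])
    have "L \<beta> (a *\<^sub>R x + b *\<^sub>R y) = a *\<^sub>R L \<beta> x + b *\<^sub>R L \<beta> y" for a b x y
      unfolding L_def dir D_direction[OF open_dom section_frame q tan tan]
      by (simp add: scaleR_conv_of_real[where 'a = complex])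
    from this[of 1 _ 1] this[of _ _ 0] show ?thesis by (intro linearI) simp_all
  qed
  have i: "L \<beta> (axis \<gamma> \<i>) = \<i> * L \<beta> (axis \<gamma> 1)" for \<beta> \<gamma>
  proof -
    have "holomorphically_compatible A D" using chern by (simp add: chern_connection_def)
    from this[unfolded holomorphically_compatible_def, THEN spec, THEN spec, THEN mp,
        OF conjI[OF open_dom holomorphic_section_d_z], THEN bspec, OF q, THEN bspec, OF tan]
    have "D (frame \<alpha>) q (dir_deriv A c q (axis \<gamma> 1)) + \<i> \<odot> D (frame \<alpha>) q (dir_deriv A c q (\<i> *s axis \<gamma> 1)) = 0"
      by (simp only: J_map_dir_deriv[OF q])
    moreover have "\<i> *s axis \<gamma> 1 = (axis \<gamma> \<i> :: complex ^ 'n)" by (simp add: vec_eq_iff axis_def)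
    ultimately have "L \<beta> (axis \<gamma> 1) + \<i> * L \<beta> (axis \<gamma> \<i>) = 0"
      by (simp add: L_def fun_eq_iff)
    then have "\<i> * (L \<beta> (axis \<gamma> 1) + \<i> * L \<beta> (axis \<gamma> \<i>)) = 0" by simp
    then show ?thesis by (simp add: algebra_simps)
  qed
  \<comment> \<open>The conjugate linear coefficients are half of \<open>L \<beta> (axis \<gamma> 1)
    + \<i> * L \<beta> (axis \<gamma> \<i>)\<close> and vanish by \<open>i\<close>.\<close>
  have L: "L \<beta> w = (\<Sum>\<gamma>\<in>UNIV. w $ \<gamma> * christoffel \<gamma> \<alpha> \<beta> q)" for \<beta>
    unfolding linear_dz_dzbar[OF lin, of \<beta> w] i by (simp add: L_def christoffel_def)
  have "D (frame \<alpha>) q (dir_deriv A c q w) = hvec q (\<chi> \<beta>. L \<beta> w)"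
    unfolding L_def by (rule tangent10_components[OF D_in_tangent10[OF open_dom section_frame q tan] q])
  then show ?thesis unfolding L .
qed

lemma section_frame_sum:
  assumes S: "open S" "S \<subseteq> dom_of c" and a: "\<And>\<alpha>. smooth_fun A S (a \<alpha>)"
  shows "smooth_section A (tangent10 A) S (\<lambda>q. \<Sum>\<alpha>\<in>I. a \<alpha> q \<odot> frame \<alpha> q)"
proof (rule smooth_section_tangent10I[OF S, where a = "\<lambda>q. \<chi> \<alpha>. if \<alpha> \<in> I then a \<alpha> q else 0"])
  fix q
  have "(\<Sum>\<alpha>\<in>I. a \<alpha> q * frame \<alpha> q f) = (\<Sum>\<alpha>\<in>UNIV. (if \<alpha> \<in> I then a \<alpha> q else 0) * frame \<alpha> q f)" for f
    by (rule sum.mono_neutral_cong_left) auto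
  then show "(\<Sum>\<alpha>\<in>I. a \<alpha> q \<odot> frame \<alpha> q) = hvec q (\<chi> \<alpha>. if \<alpha> \<in> I then a \<alpha> q else 0)"
    by (intro ext) (simp add: hvec_apply sum_tvec_apply)
next
  fix \<alpha> show "smooth_fun A S (\<lambda>q. (\<chi> \<alpha>. if \<alpha> \<in> I then a \<alpha> q else 0) $ \<alpha>)"
    by (cases "\<alpha> \<in> I") (simp_all add: a smooth_fun_const[OF manifold S(1)])
qed

lemma D_frame_sum:
  assumes S: "open S" "S \<subseteq> dom_of c" and a: "\<And>\<alpha>. smooth_fun A S (a \<alpha>)" and p: "p \<in> S"
    and X: "X \<in> tangent A p"
  shows "D (\<lambda>q. \<Sum>\<alpha>\<in>I. a \<alpha> q \<odot> frame \<alpha> q) p X = (\<Sum>\<alpha>\<in>I. X (a \<alpha>) \<odot> frame \<alpha> p + a \<alpha> p \<odot> D (frame \<alpha>) p X)"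
proof (induction I rule: finite_induct[OF finite])
  case 1
  have pU: "p \<in> dom_of c" using p S by auto
  have fr: "smooth_section A (tangent10 A) S (frame \<alpha>)" for \<alpha>
    by (rule smooth_section_subset[OF section_frame S(2)])
  obtain \<alpha> :: 'n where True by simp
  \<comment> \<open>The zero section is written as the function 0 times a frame field, so that the
    Leibniz rule computes its derivative.\<close>
  have "D (\<lambda>q. 0 \<odot> frame \<alpha> q) p X = X (\<lambda>q. 0) \<odot> frame \<alpha> p + 0 \<odot> D (frame \<alpha>) p X"
    by (rule D_Leibniz[OF S(1) fr smooth_fun_const[OF manifold S(1)] p X])
  moreover have "0 \<odot> Y = 0" for Y :: "'a tvec" by (rule ext) simp
  ultimately have "D (\<lambda>q. 0) p X = 0"
    unfolding derivation_const[OF derivation_tangent[OF X pU], of 0] by simp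
  then show ?case unfolding sum.empty .
next
  case (2 \<alpha> I)
  have fr: "smooth_section A (tangent10 A) S (frame \<alpha>)"
    by (rule smooth_section_subset[OF section_frame S(2)])
  have "smooth_section A (tangent10 A) S (\<lambda>q. a \<alpha> q \<odot> frame \<alpha> q)"
    using section_frame_sum[OF S a, where I = "{\<alpha>}"] by simp
  moreover have "smooth_section A (tangent10 A) S (\<lambda>q. \<Sum>\<alpha>\<in>I. a \<alpha> q \<odot> frame \<alpha> q)"
    by (rule section_frame_sum[OF S a])
  ultimately have "D (\<lambda>q. a \<alpha> q \<odot> frame \<alpha> q + (\<Sum>\<alpha>\<in>I. a \<alpha> q \<odot> frame \<alpha> q)) p X
      = D (\<lambda>q. a \<alpha> q \<odot> frame \<alpha> q) p X + D (\<lambda>q. \<Sum>\<alpha>\<in>I. a \<alpha> q \<odot> frame \<alpha> q) p X"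
    using p X by (rule D_add[OF S(1)])
  then show ?case
    unfolding sum.insert[OF 2(1,2)] D_Leibniz[OF S(1) fr a p X] 2(3) .
qed

lemma D_hvec:
  assumes S: "open S" "S \<subseteq> dom_of c" and a: "\<And>\<alpha>. smooth_fun A S (a \<alpha>)" and p: "p \<in> S"
    and X: "X \<in> tangent A p" and s: "\<And>q. q \<in> S \<Longrightarrow> s q = hvec q (\<chi> \<alpha>. a \<alpha> q)"
  shows "D s p X = hvec p (\<chi> \<beta>. X (a \<beta>)
    + (\<Sum>\<alpha>\<in>UNIV. \<Sum>\<gamma>\<in>UNIV. a \<alpha> p * X (coord_fun \<gamma>) * christoffel \<gamma> \<alpha> \<beta> p))"
proof -
  have pU: "p \<in> dom_of c" using p S by auto
  have "D s p X = D (\<lambda>q. \<Sum>\<alpha>\<in>UNIV. a \<alpha> q \<odot> frame \<alpha> q) p X"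
    by (rule D_local[OF S(1) section_frame_sum[OF S a] _ p X]) (simp add: s hvec_def)
  also have "\<dots> = (\<Sum>\<alpha>\<in>UNIV. X (a \<alpha>) \<odot> frame \<alpha> p + a \<alpha> p \<odot> D (frame \<alpha>) p X)"
    by (rule D_frame_sum[OF S a p X])
  also have "\<dots> = hvec p (\<chi> \<beta>. X (a \<beta>)
    + (\<Sum>\<alpha>\<in>UNIV. \<Sum>\<gamma>\<in>UNIV. a \<alpha> p * X (coord_fun \<gamma>) * christoffel \<gamma> \<alpha> \<beta> p))"
  proof
    fix f
    have "D (frame \<alpha>) p X = hvec p (\<chi> \<beta>. \<Sum>\<gamma>\<in>UNIV. X (coord_fun \<gamma>) * christoffel \<gamma> \<alpha> \<beta> p)" for \<alpha>
      using D_frame[OF pU, of \<alpha> "\<chi> \<alpha>. X (coord_fun \<alpha>)"] by (simp flip: tangent_components[OF X pU])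
    then have DX: "D (frame \<alpha>) p X f = (\<Sum>\<beta>\<in>UNIV. (\<Sum>\<gamma>\<in>UNIV. X (coord_fun \<gamma>) * christoffel \<gamma> \<alpha> \<beta> p) * frame \<beta> p f)" for \<alpha>
      by (simp add: hvec_apply)
    have "(\<Sum>\<alpha>\<in>UNIV. X (a \<alpha>) \<odot> frame \<alpha> p + a \<alpha> p \<odot> D (frame \<alpha>) p X) f
      = (\<Sum>\<alpha>\<in>UNIV. X (a \<alpha>) * frame \<alpha> p f)
        + (\<Sum>\<alpha>\<in>UNIV. \<Sum>\<beta>\<in>UNIV. (\<Sum>\<gamma>\<in>UNIV. a \<alpha> p * X (coord_fun \<gamma>) * christoffel \<gamma> \<alpha> \<beta> p) * frame \<beta> p f)"
      by (simp add: sum_tvec_apply DX sum.distrib sum_distrib_left sum_distrib_right mult.assoc)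
    also have "\<dots> = (\<Sum>\<alpha>\<in>UNIV. X (a \<alpha>) * frame \<alpha> p f)
        + (\<Sum>\<beta>\<in>UNIV. \<Sum>\<alpha>\<in>UNIV. (\<Sum>\<gamma>\<in>UNIV. a \<alpha> p * X (coord_fun \<gamma>) * christoffel \<gamma> \<alpha> \<beta> p) * frame \<beta> p f)"
      by (rule arg_cong2[where f = "(+)"], rule refl, rule sum.swap)
    finally show "(\<Sum>\<alpha>\<in>UNIV. X (a \<alpha>) \<odot> frame \<alpha> p + a \<alpha> p \<odot> D (frame \<alpha>) p X) f = hvec p (\<chi> \<beta>. X (a \<beta>)
    + (\<Sum>\<alpha>\<in>UNIV. \<Sum>\<gamma>\<in>UNIV. a \<alpha> p * X (coord_fun \<gamma>) * christoffel \<gamma> \<alpha> \<beta> p)) f"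
      by (simp add: hvec_apply distrib_right sum.distrib sum_distrib_right)
  qed
  finally show ?thesis .
qed

section \<open>The metric in the coordinate frame\<close>

abbreviation H :: "'n \<Rightarrow> 'n \<Rightarrow> 'a \<Rightarrow> complex" where
  "H \<alpha> \<beta> \<equiv> (\<lambda>q. h_matrix A h c q $ \<alpha> $ \<beta>)"

lemma H_eq: "H \<alpha> \<beta> q = h q (frame \<alpha> q) (frame \<beta> q)"
  by (simp add: h_matrix_def)

lemma h_linear:
  "X \<in> tangent10 A p \<Longrightarrow> Y \<in> tangent10 A p \<Longrightarrow> Z \<in> tangent10 A p \<Longrightarrow>
    h p (a \<odot> X + b \<odot> Y) Z = a * h p X Z + b * h p Y Z"
  by (rule metric[unfolded hermitian_metric_def, THEN conjunct1, rule_format])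

lemma h_cnj: "X \<in> tangent10 A p \<Longrightarrow> Y \<in> tangent10 A p \<Longrightarrow> h p Y X = cnj (h p X Y)"
  by (rule metric[unfolded hermitian_metric_def, THEN conjunct2, THEN conjunct1, rule_format])

lemma h_pos: "X \<in> tangent10 A p \<Longrightarrow> X \<noteq> 0 \<Longrightarrow> Re (h p X X) > 0"
  by (rule metric[unfolded hermitian_metric_def, THEN conjunct2, THEN conjunct2, THEN conjunct1, rule_format])

lemma frame_in_tangent10: "p \<in> dom_of c \<Longrightarrow> frame \<alpha> p \<in> tangent10 A p"
  using hvec_in_tangent10[of p "axis \<alpha> 1"] by (simp add: hvec_axis)

lemma H_cnj: "p \<in> dom_of c \<Longrightarrow> cnj (H \<alpha> \<beta> p) = H \<beta> \<alpha> p"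
  unfolding H_eq by (rule h_cnj[symmetric, OF frame_in_tangent10 frame_in_tangent10])

lemma smooth_fun_H: "smooth_fun A (dom_of c) (H \<alpha> \<beta>)"
proof -
  note K = metric[unfolded hermitian_metric_def, THEN conjunct2, THEN conjunct2, THEN conjunct2,
    THEN spec[of _ "dom_of c"], THEN spec[of _ "frame \<alpha>"], THEN spec[of _ "frame \<beta>"], THEN mp]
  show ?thesis unfolding H_eq by (rule K) (intro conjI open_dom section_frame)
qed

text \<open>Linearity of \<open>h\<close> is given for two vectors of the fibre at a time, so the
  induction also records that each partial sum stays in \<open>tangent10 A p\<close>.\<close>

lemma h_hvec_left:
  assumes p: "p \<in> dom_of c" and Z: "Z \<in> tangent10 A p"
  shows "h p (hvec p x) Z = (\<Sum>\<alpha>\<in>UNIV. x $ \<alpha> * h p (frame \<alpha> p) Z)"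
proof -
  note fr = frame_in_tangent10[OF p]
  have "(\<Sum>\<alpha>\<in>I. x $ \<alpha> \<odot> frame \<alpha> p) \<in> tangent10 A p
    \<and> h p (\<Sum>\<alpha>\<in>I. x $ \<alpha> \<odot> frame \<alpha> p) Z = (\<Sum>\<alpha>\<in>I. x $ \<alpha> * h p (frame \<alpha> p) Z)" for I
  proof (induction I rule: finite_induct[OF finite])
    case 1
    obtain \<alpha> :: 'n where True by simp
    \<comment> \<open>The empty sum is presented as a combination with coefficients 0, to which
      linearity of \<open>h\<close> applies.\<close>
    have 0: "0 = 0 \<odot> frame \<alpha> p + 0 \<odot> frame \<alpha> p" "0 = hvec p 0"
      by (rule ext, simp add: hvec_apply)+
    have "0 \<in> tangent10 A p" by (subst 0(2)) (rule hvec_in_tangent10[OF p])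
    moreover have "h p 0 Z = 0 * h p (frame \<alpha> p) Z + 0 * h p (frame \<alpha> p) Z"
      unfolding h_linear[OF fr fr Z, symmetric] by (simp only: 0(1)[symmetric])
    ultimately show ?case unfolding sum.empty mult_zero_left add_0 by (rule conjI)
  next
    case (2 \<alpha> I)
    let ?s = "\<Sum>\<alpha>\<in>I. x $ \<alpha> \<odot> frame \<alpha> p"
    have s: "?s \<in> tangent10 A p" using 2(3) by (rule conjunct1)
    obtain w where w: "?s = hvec p w" using tangent10E[OF s p] by metis
    have one: "1 \<odot> Y = Y" for Y :: "'a tvec" by (rule ext) simp
    have eq: "(\<Sum>\<alpha>\<in>insert \<alpha> I. x $ \<alpha> \<odot> frame \<alpha> p) = x $ \<alpha> \<odot> frame \<alpha> p + 1 \<odot> ?s"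
      unfolding sum.insert[OF 2(1,2)] one ..
    have "x $ \<alpha> \<odot> frame \<alpha> p + 1 \<odot> ?s = hvec p (x $ \<alpha> *s axis \<alpha> 1 + w)"
      unfolding w hvec_add hvec_scale hvec_axis one ..
    then have "(\<Sum>\<alpha>\<in>insert \<alpha> I. x $ \<alpha> \<odot> frame \<alpha> p) \<in> tangent10 A p"
      unfolding eq by (simp only: hvec_in_tangent10[OF p])
    moreover have "h p (\<Sum>\<alpha>\<in>insert \<alpha> I. x $ \<alpha> \<odot> frame \<alpha> p) Z = x $ \<alpha> * h p (frame \<alpha> p) Z + h p ?s Z"
      unfolding eq by (simp only: h_linear[OF fr s Z] mult_1)
    ultimately show ?case
      unfolding 2(3)[THEN conjunct2] sum.insert[OF 2(1,2)] by (rule conjI)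
  qed
  then show ?thesis by (simp add: hvec_def)
qed

lemma h_hvec:
  assumes p: "p \<in> dom_of c"
  shows "h p (hvec p x) (hvec p y) = (\<Sum>\<alpha>\<in>UNIV. \<Sum>\<beta>\<in>UNIV. x $ \<alpha> * cnj (y $ \<beta>) * H \<alpha> \<beta> p)"
proof -
  have "h p (frame \<alpha> p) (hvec p y) = (\<Sum>\<beta>\<in>UNIV. cnj (y $ \<beta>) * H \<alpha> \<beta> p)" for \<alpha>
    by (subst h_cnj[OF hvec_in_tangent10[OF p] frame_in_tangent10[OF p]])
       (simp add: h_hvec_left[OF p frame_in_tangent10[OF p]] H_cnj[OF p] flip: H_eq)
  then show ?thesis
    by (simp add: h_hvec_left[OF p hvec_in_tangent10[OF p]] sum_distrib_left mult.assoc)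
qed

lemma dir_deriv_H:
  assumes p: "p \<in> dom_of c"
  shows "dir_deriv A c p w (H \<alpha> \<beta>) = (\<Sum>\<kappa>\<in>UNIV. (\<Sum>\<gamma>\<in>UNIV. w $ \<gamma> * christoffel \<gamma> \<alpha> \<kappa> p) * H \<kappa> \<beta> p)
    + (\<Sum>\<kappa>\<in>UNIV. H \<alpha> \<kappa> p * cnj (\<Sum>\<gamma>\<in>UNIV. w $ \<gamma> * christoffel \<gamma> \<beta> \<kappa> p))"
proof -
  have "metric_compatible A h D" using chern by (simp add: chern_connection_def)
  from this[unfolded metric_compatible_def, THEN spec[of _ "dom_of c"], THEN spec[of _ "frame \<alpha>"],
      THEN spec[of _ "frame \<beta>"], THEN mp, THEN bspec, OF _ p, THEN bspec, OF _ dir_deriv_in_tangent[OF p]]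
  have "dir_deriv A c p w (H \<alpha> \<beta>) = h p (D (frame \<alpha>) p (dir_deriv A c p w)) (frame \<beta> p)
      + h p (frame \<alpha> p) (D (frame \<beta>) p (dir_deriv A c p w))"
    using open_dom section_frame by (simp add: H_eq)
  also have "h p (frame \<alpha> p) (D (frame \<beta>) p (dir_deriv A c p w))
      = cnj (h p (D (frame \<beta>) p (dir_deriv A c p w)) (frame \<alpha> p))"
    unfolding D_frame[OF p] by (rule h_cnj[OF hvec_in_tangent10[OF p] frame_in_tangent10[OF p]])
  finally show ?thesis
    by (simp add: D_frame[OF p] h_hvec_left[OF p frame_in_tangent10[OF p]] H_cnj[OF p] mult.commute flip: H_eq)
qed

text \<open>The derivative of \<open>H\<close> in a real direction is a complex linear term plus a
  conjugate linear one. Its values in the directions 1 and \<i> separate them: \<open>d_z\<close>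
  keeps the first, \<open>d_zbar\<close> the second.\<close>

lemma d_z_H:
  assumes p: "p \<in> dom_of c"
  shows "d_z A c \<gamma> p (H \<alpha> \<beta>) = (\<Sum>\<kappa>\<in>UNIV. christoffel \<gamma> \<alpha> \<kappa> p * H \<kappa> \<beta> p)"
    and d_zbar_H: "d_zbar A c \<gamma> p (H \<alpha> \<beta>) = (\<Sum>\<kappa>\<in>UNIV. H \<alpha> \<kappa> p * cnj (christoffel \<gamma> \<beta> \<kappa> p))"
proof -
  let ?P = "\<Sum>\<kappa>\<in>UNIV. christoffel \<gamma> \<alpha> \<kappa> p * H \<kappa> \<beta> p"
  let ?Q = "\<Sum>\<kappa>\<in>UNIV. H \<alpha> \<kappa> p * cnj (christoffel \<gamma> \<beta> \<kappa> p)"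
  have s: "(\<Sum>\<delta>\<in>UNIV. axis \<gamma> a $ \<delta> * g \<delta>) = a * g \<gamma>" for a and g :: "'n \<Rightarrow> complex"
    by (simp add: axis_def if_distrib if_distribR cong: if_cong)
  have 1: "dir_deriv A c p (axis \<gamma> 1) (H \<alpha> \<beta>) = ?P + ?Q"
    unfolding dir_deriv_H[OF p] s by simp
  have 2: "dir_deriv A c p (axis \<gamma> \<i>) (H \<alpha> \<beta>) = \<i> * ?P - \<i> * ?Q"
    unfolding dir_deriv_H[OF p] s by (simp add: sum_distrib_left sum_negf[symmetric] mult_ac)
  show "d_z A c \<gamma> p (H \<alpha> \<beta>) = ?P" "d_zbar A c \<gamma> p (H \<alpha> \<beta>) = ?Q"
    unfolding d_z_apply d_zbar_apply 1 2 by (simp_all add: field_simps)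
qed

section \<open>The induced connection on the real tangent bundle\<close>

abbreviation DT :: "'a conn" where
  "DT \<equiv> induced_connection A D"

text \<open>The \<beta>-th component of the covariant derivative of a real field \<open>u\<close>
  along \<open>X\<close>. Coefficients of the Chern connection may be used because
  \<open>to10\<close> preserves components.\<close>

abbreviation cov :: "'a field \<Rightarrow> 'a \<Rightarrow> 'a tvec \<Rightarrow> 'n \<Rightarrow> complex" where
  "cov u p X \<beta> \<equiv> X (\<lambda>q. u q (coord_fun \<beta>))
    + (\<Sum>\<alpha>\<in>UNIV. \<Sum>\<gamma>\<in>UNIV. u p (coord_fun \<alpha>) * X (coord_fun \<gamma>) * christoffel \<gamma> \<alpha> \<beta> p)"

text \<open>The real vector with components \<open>cov\<close> is mapped by \<open>to10\<close> to
  the Chern derivative, and injectivity of \<open>to10\<close> on the real tangent space makes it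
  the only such vector.\<close>

lemma DT_eq:
  assumes S: "open S" "S \<subseteq> dom_of c" and u: "smooth_section A (tangent A) S u" and p: "p \<in> S"
    and X: "X \<in> tangent A p"
  shows "DT u p X = dir_deriv A c p (\<chi> \<beta>. cov u p X \<beta>)"
proof -
  have pU: "p \<in> dom_of c" using p S by auto
  have "to10 A q (u q) = hvec q (\<chi> \<alpha>. u q (coord_fun \<alpha>))" if "q \<in> S" for q
  proof -
    have "q \<in> dom_of c" using that S by auto
    then show ?thesis
      using tangent_components[OF smooth_section_fibre[OF u that]] to10_dir_deriv by metis
  qed
  from D_hvec[OF S smooth_section_coord[OF S u] p X this]
  have D: "D (\<lambda>q. to10 A q (u q)) p X = hvec p (\<chi> \<beta>. cov u p X \<beta>)" .
  show ?thesis unfolding induced_connection_def D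
  proof (rule the_equality)
    show "dir_deriv A c p (\<chi> \<beta>. cov u p X \<beta>) \<in> tangent A p \<and>
        to10 A p (dir_deriv A c p (\<chi> \<beta>. cov u p X \<beta>)) = hvec p (\<chi> \<beta>. cov u p X \<beta>)"
      by (simp add: dir_deriv_in_tangent[OF pU] to10_dir_deriv[OF pU])
    fix Y assume Y: "Y \<in> tangent A p \<and> to10 A p Y = hvec p (\<chi> \<beta>. cov u p X \<beta>)"
    then obtain w where w: "Y = dir_deriv A c p w" using tangentE[OF _ pU] by metis
    then show "Y = dir_deriv A c p (\<chi> \<beta>. cov u p X \<beta>)"
      using Y by (simp add: to10_dir_deriv[OF pU] hvec_eq_iff[OF pU])
  qed
qed

text \<open>The curvature differentiates a covariant derivative once more, and \<open>DT_eq\<close>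
  asks for a smooth section.\<close>

lemma section_DT:
  assumes S: "open S" "S \<subseteq> dom_of c" and u: "smooth_section A (tangent A) S u"
    and w: "smooth_section A (tangent A) S w"
  shows "smooth_section A (tangent A) S (\<lambda>q. DT u q (w q))"
proof (rule smooth_section_tangentI[OF S DT_eq[OF S u]])
  show "w q \<in> tangent A q" if "q \<in> S" for q by (rule smooth_section_fibre[OF w that])
  note sm = smooth_section_coord[OF S u] smooth_section_coord[OF S w] smooth_fun_subset[OF smooth_fun_christoffel S(2)]
  show "smooth_fun A S (\<lambda>q. (\<chi> \<beta>. cov u q (w q) \<beta>) $ \<beta>)" for \<beta>
    by simp (intro smooth_fun_add smooth_fun_sum smooth_fun_mult smooth_section_apply[OF w] sm manifold S(1))
qed

section \<open>Curvature of the induced connection in components\<close>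

text \<open>The coefficients form matrices with the frame index \<alpha> as row and the component
  \<beta> as column; the double sum is their commutator. The components of \<open>v\<close> and
  \<open>w\<close> stand outside the derivatives, so only values at \<open>p\<close> enter.\<close>

definition curv :: "'a \<Rightarrow> complex ^ 'n \<Rightarrow> complex ^ 'n \<Rightarrow> complex ^ 'n \<Rightarrow> complex ^ 'n" where
  "curv p u v w = (\<chi> \<beta>. \<Sum>\<alpha>\<in>UNIV. u $ \<alpha> * (\<Sum>\<gamma>\<in>UNIV.
       (w $ \<gamma> * dir_deriv A c p v (christoffel \<gamma> \<alpha> \<beta>) - v $ \<gamma> * dir_deriv A c p w (christoffel \<gamma> \<alpha> \<beta>))
     + (\<Sum>\<kappa>\<in>UNIV. \<Sum>\<delta>\<in>UNIV. (w $ \<gamma> * v $ \<delta> - v $ \<gamma> * w $ \<delta>) * christoffel \<gamma> \<alpha> \<kappa> p * christoffel \<delta> \<kappa> \<beta> p)))"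

text \<open>Leibniz expansion of the second covariant derivative, with summands arranged to match
  \<open>curvature_sum_identity\<close>.\<close>

lemma cov_cov:
  assumes S: "open S" "S \<subseteq> dom_of c" and u: "smooth_section A (tangent A) S u" and p: "p \<in> S"
    and v: "smooth_section A (tangent A) S v" and w: "smooth_section A (tangent A) S w"
  shows "cov (\<lambda>q. DT u q (w q)) p (v p) \<beta> = v p (\<lambda>q. w q (\<lambda>q. u q (coord_fun \<beta>)))
    + (\<Sum>\<alpha>\<in>UNIV. \<Sum>\<gamma>\<in>UNIV.
         v p (\<lambda>q. u q (coord_fun \<alpha>)) * w p (coord_fun \<gamma>) * christoffel \<gamma> \<alpha> \<beta> p
       + u p (coord_fun \<alpha>) * v p (\<lambda>q. w q (coord_fun \<gamma>)) * christoffel \<gamma> \<alpha> \<beta> p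
       + u p (coord_fun \<alpha>) * w p (coord_fun \<gamma>) * v p (christoffel \<gamma> \<alpha> \<beta>)
       + w p (\<lambda>q. u q (coord_fun \<alpha>)) * v p (coord_fun \<gamma>) * christoffel \<gamma> \<alpha> \<beta> p)
    + (\<Sum>\<alpha>\<in>UNIV. \<Sum>\<gamma>\<in>UNIV. \<Sum>\<kappa>\<in>UNIV. \<Sum>\<delta>\<in>UNIV.
         u p (coord_fun \<alpha>) * w p (coord_fun \<gamma>) * v p (coord_fun \<delta>) * christoffel \<gamma> \<alpha> \<kappa> p * christoffel \<delta> \<kappa> \<beta> p)"
proof -
  have pU: "p \<in> dom_of c" using p S by auto
  have V: "v p \<in> tangent A p" by (rule smooth_section_fibre[OF v p])
  note D = derivation_tangent[OF V pU]
  have cm: "DT u q (w q) (coord_fun \<beta>) = cov u q (w q) \<beta>" if q: "q \<in> S" for q \<beta>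
  proof -
    have "q \<in> dom_of c" using q S by auto
    then show ?thesis by (simp add: DT_eq[OF S u q smooth_section_fibre[OF w q]])
  qed
  note near = smooth_nearI[OF manifold S(1) _ p]
  note sm = smooth_near_add[OF manifold] smooth_near_mult[OF manifold] smooth_near_sum[OF manifold]
    near[OF smooth_section_coord[OF S u]] near[OF smooth_section_coord[OF S w]]
    near[OF smooth_section_apply[OF w S(1) smooth_section_coord[OF S u]]]
    near[OF smooth_fun_subset[OF smooth_fun_christoffel S(2)]]
  have "v p (\<lambda>q. DT u q (w q) (coord_fun \<beta>)) = v p (\<lambda>q. cov u q (w q) \<beta>)"
  proof (rule derivation_cong[OF D _ S(1) p])
    show "smooth_near A p (\<lambda>q. cov u q (w q) \<beta>)" by (intro sm)
  qed (simp add: cm)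
  also have "\<dots> = v p (\<lambda>q. w q (\<lambda>q. u q (coord_fun \<beta>))) + (\<Sum>\<alpha>\<in>UNIV. \<Sum>\<gamma>\<in>UNIV.
      (v p (\<lambda>q. u q (coord_fun \<alpha>)) * w p (coord_fun \<gamma>) + u p (coord_fun \<alpha>) * v p (\<lambda>q. w q (coord_fun \<gamma>)))
         * christoffel \<gamma> \<alpha> \<beta> p
       + u p (coord_fun \<alpha>) * w p (coord_fun \<gamma>) * v p (christoffel \<gamma> \<alpha> \<beta>))"
    by (simp only: derivation_sum[OF manifold D] derivation_add[OF D] derivation_mult[OF D] sm)
  finally have first: "v p (\<lambda>q. DT u q (w q) (coord_fun \<beta>)) = \<dots>" .
  \<comment> \<open>In the outer derivative the component index \<kappa> of the inner one becomes
    the frame index, so its sum arises outermost and must be moved inwards.\<close>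
  have quadratic: "(\<Sum>\<alpha>\<in>UNIV. \<Sum>\<gamma>\<in>UNIV. \<Sum>\<kappa>\<in>UNIV. \<Sum>\<delta>\<in>UNIV. u p (coord_fun \<alpha>) * w p (coord_fun \<gamma>) * v p (coord_fun \<delta>)
         * christoffel \<gamma> \<alpha> \<kappa> p * christoffel \<delta> \<kappa> \<beta> p)
      = (\<Sum>\<kappa>\<in>UNIV. \<Sum>\<delta>\<in>UNIV. \<Sum>\<alpha>\<in>UNIV. \<Sum>\<gamma>\<in>UNIV. u p (coord_fun \<alpha>) * w p (coord_fun \<gamma>) * v p (coord_fun \<delta>)
         * christoffel \<gamma> \<alpha> \<kappa> p * christoffel \<delta> \<kappa> \<beta> p)"
    by (rule sum_swap_pairs)
  show ?thesis
    unfolding first cm[OF p] quadratic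
    by (simp add: sum.distrib sum_distrib_left sum_distrib_right algebra_simps)
qed

lemma curvature_fields_eq:
  assumes S: "open S" "S \<subseteq> dom_of c" and u: "smooth_section A (tangent A) S u" and p: "p \<in> S"
    and v: "smooth_section A (tangent A) S v" and w: "smooth_section A (tangent A) S w"
  shows "curvature_fields A DT u v w p = dir_deriv A c p
    (curv p (\<chi> \<alpha>. u p (coord_fun \<alpha>)) (\<chi> \<alpha>. v p (coord_fun \<alpha>)) (\<chi> \<alpha>. w p (coord_fun \<alpha>)))"
proof -
  have pU: "p \<in> dom_of c" using p S by auto
  note V = smooth_section_fibre[OF v p] and W = smooth_section_fibre[OF w p]
  let ?l = "lie_bracket A v w p"
  have l: "?l = dir_deriv A c p (\<chi> \<alpha>. v p (\<lambda>q. w q (coord_fun \<alpha>)) - w p (\<lambda>q. v q (coord_fun \<alpha>)))"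
    by (rule lie_bracket_eq[OF S p v w])
  have L: "?l \<in> tangent A p" unfolding l by (rule dir_deriv_in_tangent[OF pU])
  have lc: "?l (coord_fun \<gamma>) = v p (\<lambda>q. w q (coord_fun \<gamma>)) - w p (\<lambda>q. v q (coord_fun \<gamma>))" for \<gamma>
    unfolding l by (simp add: pU)
  have lu: "?l (\<lambda>q. u q (coord_fun \<beta>)) = v p (\<lambda>q. w q (\<lambda>q. u q (coord_fun \<beta>)))
      - w p (\<lambda>q. v q (\<lambda>q. u q (coord_fun \<beta>)))" for \<beta>
    using smooth_nearI[OF manifold S(1) smooth_section_coord[OF S u] p] by (simp add: lie_bracket_def)
  have vG: "dir_deriv A c p (\<chi> \<alpha>. X (coord_fun \<alpha>)) f = X f" if "X \<in> tangent A p" for X f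
    by (rule fun_cong[OF tangent_components[OF that pU, symmetric]])
  have diff: "dir_deriv A c p x - dir_deriv A c p y - dir_deriv A c p z = dir_deriv A c p (x - y - z)" for x y z
    by (rule ext) (simp add: linear_diff[OF dir_deriv_linear[OF pU]])
  have comp: "cov (\<lambda>q. DT u q (w q)) p (v p) \<beta> - cov (\<lambda>q. DT u q (v q)) p (w p) \<beta> - cov u p ?l \<beta>
    = curv p (\<chi> \<alpha>. u p (coord_fun \<alpha>)) (\<chi> \<alpha>. v p (coord_fun \<alpha>)) (\<chi> \<alpha>. w p (coord_fun \<alpha>)) $ \<beta>" for \<beta>
  proof -
    show ?thesis
      unfolding cov_cov[OF S u p v w] cov_cov[OF S u p w v] lc lu curvature_sum_identity curv_def vG[OF V] vG[OF W]
      by simp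
  qed
  have "curvature_fields A DT u v w p = dir_deriv A c p (\<chi> \<beta>. cov (\<lambda>q. DT u q (w q)) p (v p) \<beta>)
     - dir_deriv A c p (\<chi> \<beta>. cov (\<lambda>q. DT u q (v q)) p (w p) \<beta>) - dir_deriv A c p (\<chi> \<beta>. cov u p ?l \<beta>)"
    unfolding curvature_fields_def DT_eq[OF S section_DT[OF S u w] p V]
      DT_eq[OF S section_DT[OF S u v] p W] DT_eq[OF S u p L] ..
  also have "\<dots> = dir_deriv A c p
    (curv p (\<chi> \<alpha>. u p (coord_fun \<alpha>)) (\<chi> \<alpha>. v p (coord_fun \<alpha>)) (\<chi> \<alpha>. w p (coord_fun \<alpha>)))"
    unfolding diff using comp by (simp add: dir_deriv_eq_iff[OF pU] vec_eq_iff)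
  finally show ?thesis .
qed

text \<open>By \<open>curvature_fields_eq\<close> all extensions give the same vector, because only
  values at \<open>p\<close> enter. The fields with constant components on the chart domain show
  that an extension exists, and this pins down the value of the description.\<close>

lemma curvature_eq:
  assumes p: "p \<in> dom_of c"
  shows "curvature A DT p (dir_deriv A c p a) (dir_deriv A c p x) (dir_deriv A c p y) = dir_deriv A c p (curv p a x y)"
  unfolding curvature_def
proof (rule the_equality)
  show "\<forall>S u' v' w'. open S \<and> p \<in> S \<and> smooth_section A (tangent A) S u' \<and>
      smooth_section A (tangent A) S v' \<and> smooth_section A (tangent A) S w' \<and>
      u' p = dir_deriv A c p a \<and> v' p = dir_deriv A c p x \<and> w' p = dir_deriv A c p y \<longrightarrow>
      curvature_fields A DT u' v' w' p = dir_deriv A c p (curv p a x y)"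
  proof (intro allI impI; elim conjE)
    fix S u' v' w'
    assume S: "open S" "p \<in> S" and s: "smooth_section A (tangent A) S u'"
      "smooth_section A (tangent A) S v'" "smooth_section A (tangent A) S w'"
      and eq: "u' p = dir_deriv A c p a" "v' p = dir_deriv A c p x" "w' p = dir_deriv A c p y"
    \<comment> \<open>An extension may live on a set that leaves the chart domain; its restriction
      has the same values at \<open>p\<close> and is still smooth.\<close>
    have T: "open (S \<inter> dom_of c)" "S \<inter> dom_of c \<subseteq> dom_of c" "p \<in> S \<inter> dom_of c"
      using S p open_dom by auto
    note s' = s[THEN smooth_section_subset, OF Int_lower1[of S "dom_of c"]]
    show "curvature_fields A DT u' v' w' p = dir_deriv A c p (curv p a x y)"
      unfolding curvature_fields_eq[OF T(1,2) s'(1) T(3) s'(2,3)] eq by (simp add: p)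
  qed
next
  fix r
  assume r: "\<forall>S u' v' w'. open S \<and> p \<in> S \<and> smooth_section A (tangent A) S u' \<and>
      smooth_section A (tangent A) S v' \<and> smooth_section A (tangent A) S w' \<and>
      u' p = dir_deriv A c p a \<and> v' p = dir_deriv A c p x \<and> w' p = dir_deriv A c p y \<longrightarrow>
      curvature_fields A DT u' v' w' p = r"
  have const: "smooth_section A (tangent A) (dom_of c) (\<lambda>q. dir_deriv A c q b)" for b
    by (rule smooth_section_tangentI[OF open_dom order_refl refl]) (rule smooth_fun_const[OF manifold open_dom])
  have "curvature_fields A DT (\<lambda>q. dir_deriv A c q a) (\<lambda>q. dir_deriv A c q x) (\<lambda>q. dir_deriv A c q y) p = r"
    by (rule r[THEN spec[of _ "dom_of c"], THEN spec, THEN spec, THEN spec, THEN mp])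
       (intro conjI open_dom p const refl)
  then show "r = dir_deriv A c p (curv p a x y)"
    unfolding curvature_fields_eq[OF open_dom order_refl const p const const] by (simp add: p)
qed

section \<open>Curvature\<close>

text \<open>The conjugate of a kernel vector has length 0 for \<open>h\<close>, so positivity makes
  it vanish. Conjugation is needed because the column index of the matrix belongs to the conjugate
  linear slot.\<close>

lemma H_invertible:
  assumes p: "p \<in> dom_of c" shows "invertible (h_matrix A h c p)"
proof -
  have "x = 0" if x: "h_matrix A h c p *v x = 0" for x
  proof -
    define y where "y = (\<chi> \<alpha>. cnj (x $ \<alpha>))"
    have "(\<Sum>\<beta>\<in>UNIV. H \<alpha> \<beta> p * x $ \<beta>) = 0" for \<alpha>
      using x by (simp add: vec_eq_iff matrix_vector_mult_def)
    then have "y $ \<alpha> * (\<Sum>\<beta>\<in>UNIV. H \<alpha> \<beta> p * x $ \<beta>) = 0" for \<alpha> by simp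
    then have "h p (hvec p y) (hvec p y) = 0"
      by (simp add: h_hvec[OF p] y_def sum_distrib_left mult_ac)
    then have "hvec p y = 0"
      using h_pos[OF hvec_in_tangent10[OF p, of y]] by (cases "hvec p y = 0") auto
    also have "0 = hvec p 0" by (rule ext) (simp add: hvec_apply)
    finally have "y = 0" by (simp add: hvec_eq_iff[OF p])
    then show "x = 0" by (simp add: y_def vec_eq_iff)
  qed
  then show ?thesis by (simp add: invertible_left_inverse matrix_left_invertible_ker)
qed

text \<open>The form in which invertibility is used: it cancels the metric from the right of a row
  vector.\<close>

lemma H_matrix_inv:
  assumes p: "p \<in> dom_of c"
  shows "(\<Sum>\<mu>\<in>UNIV. (\<Sum>\<nu>\<in>UNIV. x \<nu> * H \<nu> \<mu> p) * matrix_inv (h_matrix A h c p) $ \<mu> $ \<kappa>) = x \<kappa>"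
proof -
  let ?M = "matrix_inv (h_matrix A h c p)"
  have "(h_matrix A h c p ** ?M) $ \<nu> $ \<kappa> = (if \<nu> = \<kappa> then 1 else 0)" for \<nu>
    by (simp add: matrix_mult_matrix_inv[OF H_invertible[OF p]] mat_def)
  then have inv: "(\<Sum>\<mu>\<in>UNIV. H \<nu> \<mu> p * ?M $ \<mu> $ \<kappa>) = (if \<nu> = \<kappa> then 1 else 0)" for \<nu>
    by (simp add: matrix_matrix_mult_def)
  have "(\<Sum>\<mu>\<in>UNIV. (\<Sum>\<nu>\<in>UNIV. x \<nu> * H \<nu> \<mu> p) * ?M $ \<mu> $ \<kappa>)
      = (\<Sum>\<mu>\<in>UNIV. \<Sum>\<nu>\<in>UNIV. x \<nu> * (H \<nu> \<mu> p * ?M $ \<mu> $ \<kappa>))"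
    by (simp add: sum_distrib_right mult.assoc)
  also have "\<dots> = (\<Sum>\<nu>\<in>UNIV. \<Sum>\<mu>\<in>UNIV. x \<nu> * (H \<nu> \<mu> p * ?M $ \<mu> $ \<kappa>))"
    by (rule sum.swap)
  also have "\<dots> = x \<kappa>"
    by (simp add: inv if_distrib cong: if_cong flip: sum_distrib_left)
  finally show ?thesis .
qed

abbreviation R :: "'a \<Rightarrow> 'n \<Rightarrow> 'n \<Rightarrow> 'n \<Rightarrow> 'n \<Rightarrow> complex" where
  "R \<equiv> chern_curvature A h c"

text \<open>By \<open>d_z_H\<close> the derivative of the metric times the inverse metric is the
  connection coefficient.\<close>

lemma R_eq:
  assumes p: "p \<in> dom_of c"
  shows "R p \<alpha> \<beta> \<gamma> \<delta> = - d_z A c \<gamma> p (\<lambda>q. d_zbar A c \<delta> q (H \<alpha> \<beta>))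
    + (\<Sum>\<kappa>\<in>UNIV. christoffel \<gamma> \<alpha> \<kappa> p * d_zbar A c \<delta> p (H \<kappa> \<beta>))"
proof -
  let ?M = "matrix_inv (h_matrix A h c p)"
  have "(\<Sum>\<mu>\<in>UNIV. \<Sum>\<kappa>\<in>UNIV. d_z A c \<gamma> p (H \<alpha> \<mu>) * ?M $ \<mu> $ \<kappa> * d_zbar A c \<delta> p (H \<kappa> \<beta>))
    = (\<Sum>\<kappa>\<in>UNIV. \<Sum>\<mu>\<in>UNIV. d_z A c \<gamma> p (H \<alpha> \<mu>) * ?M $ \<mu> $ \<kappa> * d_zbar A c \<delta> p (H \<kappa> \<beta>))"
    by (rule sum.swap)
  also have "\<dots> = (\<Sum>\<kappa>\<in>UNIV. christoffel \<gamma> \<alpha> \<kappa> p * d_zbar A c \<delta> p (H \<kappa> \<beta>))"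
    by (simp only: sum_distrib_right[symmetric] d_z_H[OF p] H_matrix_inv[OF p])
  finally show ?thesis by (simp add: chern_curvature_def)
qed

lemma smooth_near_H: "p \<in> dom_of c \<Longrightarrow> smooth_near A p (H \<alpha> \<beta>)"
  by (rule smooth_nearI[OF manifold open_dom smooth_fun_H])

lemma smooth_near_christoffel: "p \<in> dom_of c \<Longrightarrow> smooth_near A p (christoffel \<gamma> \<alpha> \<beta>)"
  by (rule smooth_nearI[OF manifold open_dom smooth_fun_christoffel])

lemma derivation_d_z_H:
  assumes p: "p \<in> dom_of c" and X: "derivation_at A p X"
  shows "X (\<lambda>q. d_z A c \<gamma> q (H \<alpha> \<beta>))
    = (\<Sum>\<kappa>\<in>UNIV. X (christoffel \<gamma> \<alpha> \<kappa>) * H \<kappa> \<beta> p + christoffel \<gamma> \<alpha> \<kappa> p * X (H \<kappa> \<beta>))"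
proof -
  note sm = smooth_near_H[OF p] smooth_near_christoffel[OF p] smooth_near_mult[OF manifold] smooth_near_sum[OF manifold]
  have "X (\<lambda>q. d_z A c \<gamma> q (H \<alpha> \<beta>)) = X (\<lambda>q. \<Sum>\<kappa>\<in>UNIV. christoffel \<gamma> \<alpha> \<kappa> q * H \<kappa> \<beta> q)"
    by (rule derivation_cong[OF X _ open_dom p]) (intro sm, simp add: d_z_H)
  also have "\<dots> = (\<Sum>\<kappa>\<in>UNIV. X (christoffel \<gamma> \<alpha> \<kappa>) * H \<kappa> \<beta> p + christoffel \<gamma> \<alpha> \<kappa> p * X (H \<kappa> \<beta>))"
    by (simp only: derivation_sum[OF manifold X] derivation_mult[OF X] sm)
  finally show ?thesis .
qed

text \<open>With the derivatives exchanged, \<open>d_zbar\<close> acts on the product of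
  coefficients and metric given by \<open>d_z_H\<close>; the part that differentiates the metric
  cancels the quadratic term of \<open>R_eq\<close>.\<close>

lemma R_eq_d_zbar_christoffel:
  assumes p: "p \<in> dom_of c"
  shows "R p \<alpha> \<beta> \<gamma> \<delta> = - (\<Sum>\<kappa>\<in>UNIV. d_zbar A c \<delta> p (christoffel \<gamma> \<alpha> \<kappa>) * H \<kappa> \<beta> p)"
  unfolding R_eq[OF p] d_z_d_zbar_commute[OF smooth_near_H[OF p] p] derivation_d_z_H[OF p derivation_d_zbar[OF p]]
  by (simp add: sum.distrib)

text \<open>Conjugation exchanges \<open>d_z\<close> with \<open>d_zbar\<close> and transposes
  \<open>H\<close>. Commuting derivatives repairs the second order term; in the other,
  \<open>d_zbar_H\<close> displays coefficients, metric and conjugate coefficients, a form symmetric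
  under conjugation with exchange of the index pairs.\<close>

lemma cnj_R:
  assumes p: "p \<in> dom_of c" shows "cnj (R p \<alpha> \<beta> \<gamma> \<delta>) = R p \<beta> \<alpha> \<delta> \<gamma>"
proof -
  have cnj_dH: "cnj (d_zbar A c \<delta> q (H \<alpha> \<beta>)) = d_z A c \<delta> q (H \<beta> \<alpha>)" if q: "q \<in> dom_of c" for q
  proof -
    have "d_z A c \<delta> q (\<lambda>r. cnj (H \<alpha> \<beta> r)) = d_z A c \<delta> q (H \<beta> \<alpha>)"
      by (rule derivation_cong[OF derivation_d_z[OF q] smooth_near_H[OF q] open_dom q]) (simp add: H_cnj)
    then show ?thesis by (simp add: d_z_cnj[OF smooth_near_H[OF q] q])
  qed
  note sm = smooth_near_d_zbar[OF smooth_near_H[OF p] p]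
  have "cnj (d_z A c \<gamma> p (\<lambda>q. d_zbar A c \<delta> q (H \<alpha> \<beta>))) = d_zbar A c \<gamma> p (\<lambda>q. cnj (d_zbar A c \<delta> q (H \<alpha> \<beta>)))"
    by (rule d_zbar_cnj[OF sm p, symmetric])
  also have "\<dots> = d_zbar A c \<gamma> p (\<lambda>q. d_z A c \<delta> q (H \<beta> \<alpha>))"
    by (rule derivation_cong[OF derivation_d_zbar[OF p] smooth_near_d_z[OF smooth_near_H[OF p] p] open_dom p])
       (simp add: cnj_dH)
  also have "\<dots> = d_z A c \<delta> p (\<lambda>q. d_zbar A c \<gamma> q (H \<beta> \<alpha>))"
    by (rule d_z_d_zbar_commute[OF smooth_near_H[OF p] p, symmetric])
  finally have 1: "cnj (d_z A c \<gamma> p (\<lambda>q. d_zbar A c \<delta> q (H \<alpha> \<beta>))) = d_z A c \<delta> p (\<lambda>q. d_zbar A c \<gamma> q (H \<beta> \<alpha>))" .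
  have "cnj (\<Sum>\<kappa>\<in>UNIV. \<Sum>\<mu>\<in>UNIV. christoffel \<gamma> \<alpha> \<kappa> p * (H \<kappa> \<mu> p * cnj (christoffel \<delta> \<beta> \<mu> p)))
      = (\<Sum>\<kappa>\<in>UNIV. \<Sum>\<mu>\<in>UNIV. christoffel \<delta> \<beta> \<mu> p * (H \<mu> \<kappa> p * cnj (christoffel \<gamma> \<alpha> \<kappa> p)))"
    by (simp add: H_cnj[OF p] mult_ac)
  also have "\<dots> = (\<Sum>\<mu>\<in>UNIV. \<Sum>\<kappa>\<in>UNIV. christoffel \<delta> \<beta> \<mu> p * (H \<mu> \<kappa> p * cnj (christoffel \<gamma> \<alpha> \<kappa> p)))"
    by (rule sum.swap)
  finally have 2: "cnj (\<Sum>\<kappa>\<in>UNIV. christoffel \<gamma> \<alpha> \<kappa> p * d_zbar A c \<delta> p (H \<kappa> \<beta>))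
      = (\<Sum>\<kappa>\<in>UNIV. christoffel \<delta> \<beta> \<kappa> p * d_zbar A c \<gamma> p (H \<kappa> \<alpha>))"
    by (simp only: d_zbar_H[OF p] sum_distrib_left)
  show ?thesis
    unfolding R_eq[OF p] complex_cnj_add complex_cnj_minus 1 2 ..
qed

text \<open>The curvature has no part of type (2,0): the left-hand side times the metric is
  \<open>\<partial>\<^sub>\<delta> \<partial>\<^sub>\<gamma> h\<close>, which is symmetric.\<close>

lemma christoffel_symmetry:
  assumes p: "p \<in> dom_of c"
  shows "d_z A c \<delta> p (christoffel \<gamma> \<alpha> \<beta>) + (\<Sum>\<kappa>\<in>UNIV. christoffel \<gamma> \<alpha> \<kappa> p * christoffel \<delta> \<kappa> \<beta> p)
       = d_z A c \<gamma> p (christoffel \<delta> \<alpha> \<beta>) + (\<Sum>\<kappa>\<in>UNIV. christoffel \<delta> \<alpha> \<kappa> p * christoffel \<gamma> \<kappa> \<beta> p)"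
proof -
  define S where "S \<gamma> \<delta> \<nu> = d_z A c \<delta> p (christoffel \<gamma> \<alpha> \<nu>)
      + (\<Sum>\<kappa>\<in>UNIV. christoffel \<gamma> \<alpha> \<kappa> p * christoffel \<delta> \<kappa> \<nu> p)" for \<gamma> \<delta> \<nu>
  have S: "(\<Sum>\<nu>\<in>UNIV. S \<gamma> \<delta> \<nu> * H \<nu> \<mu> p) = d_z A c \<delta> p (\<lambda>q. d_z A c \<gamma> q (H \<alpha> \<mu>))" for \<gamma> \<delta> \<mu>
  proof -
    have "(\<Sum>\<nu>\<in>UNIV. S \<gamma> \<delta> \<nu> * H \<nu> \<mu> p) = (\<Sum>\<nu>\<in>UNIV. d_z A c \<delta> p (christoffel \<gamma> \<alpha> \<nu>) * H \<nu> \<mu> p)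
      + (\<Sum>\<nu>\<in>UNIV. \<Sum>\<kappa>\<in>UNIV. christoffel \<gamma> \<alpha> \<kappa> p * (christoffel \<delta> \<kappa> \<nu> p * H \<nu> \<mu> p))"
      by (simp add: S_def distrib_right sum.distrib sum_distrib_right mult.assoc)
    also have "(\<Sum>\<nu>\<in>UNIV. \<Sum>\<kappa>\<in>UNIV. christoffel \<gamma> \<alpha> \<kappa> p * (christoffel \<delta> \<kappa> \<nu> p * H \<nu> \<mu> p))
      = (\<Sum>\<kappa>\<in>UNIV. \<Sum>\<nu>\<in>UNIV. christoffel \<gamma> \<alpha> \<kappa> p * (christoffel \<delta> \<kappa> \<nu> p * H \<nu> \<mu> p))"
      by (rule sum.swap)
    finally show ?thesis
      by (simp add: derivation_d_z_H[OF p derivation_d_z[OF p]] d_z_H[OF p] sum.distrib sum_distrib_left)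
  qed
  \<comment> \<open>Both become equal after multiplication with the metric, and the inverse matrix
    takes the metric away again.\<close>
  have "S \<gamma> \<delta> \<beta> = S \<delta> \<gamma> \<beta>"
    using H_matrix_inv[OF p, of "S \<gamma> \<delta>" \<beta>] H_matrix_inv[OF p, of "S \<delta> \<gamma>" \<beta>]
    unfolding S d_z_commute[OF smooth_near_H[OF p] p, of \<delta> \<gamma>] by simp
  then show ?thesis by (simp add: S_def)
qed

text \<open>Once directional derivatives are split by type, the \<open>d_z\<close> terms and the
  products of coefficients form the symmetric expression of \<open>christoffel_symmetry\<close> with
  an antisymmetric coefficient. Only the \<open>d_zbar\<close> terms survive.\<close>

lemma curv_eq:
  assumes p: "p \<in> dom_of c"
  shows "curv p u v w $ \<beta> = (\<Sum>\<alpha>\<in>UNIV. u $ \<alpha> * (\<Sum>\<gamma>\<in>UNIV. \<Sum>\<delta>\<in>UNIV.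
    (w $ \<gamma> * cnj (v $ \<delta>) - v $ \<gamma> * cnj (w $ \<delta>)) * d_zbar A c \<delta> p (christoffel \<gamma> \<alpha> \<beta>)))"
proof -
  have "(\<Sum>\<gamma>\<in>UNIV.
       (w $ \<gamma> * dir_deriv A c p v (christoffel \<gamma> \<alpha> \<beta>) - v $ \<gamma> * dir_deriv A c p w (christoffel \<gamma> \<alpha> \<beta>))
     + (\<Sum>\<kappa>\<in>UNIV. \<Sum>\<delta>\<in>UNIV. (w $ \<gamma> * v $ \<delta> - v $ \<gamma> * w $ \<delta>) * christoffel \<gamma> \<alpha> \<kappa> p * christoffel \<delta> \<kappa> \<beta> p))
    = (\<Sum>\<gamma>\<in>UNIV. \<Sum>\<delta>\<in>UNIV. (w $ \<gamma> * cnj (v $ \<delta>) - v $ \<gamma> * cnj (w $ \<delta>)) * d_zbar A c \<delta> p (christoffel \<gamma> \<alpha> \<beta>))"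
    (is "?L = ?R") for \<alpha>
  proof -
    let ?S = "\<lambda>\<gamma> \<delta>. d_z A c \<delta> p (christoffel \<gamma> \<alpha> \<beta>) + (\<Sum>\<kappa>\<in>UNIV. christoffel \<gamma> \<alpha> \<kappa> p * christoffel \<delta> \<kappa> \<beta> p)"
    have swap: "(\<Sum>\<kappa>\<in>UNIV. \<Sum>\<delta>\<in>UNIV. (w $ \<gamma> * v $ \<delta> - v $ \<gamma> * w $ \<delta>) * christoffel \<gamma> \<alpha> \<kappa> p * christoffel \<delta> \<kappa> \<beta> p)
      = (\<Sum>\<delta>\<in>UNIV. \<Sum>\<kappa>\<in>UNIV. (w $ \<gamma> * v $ \<delta> - v $ \<gamma> * w $ \<delta>) * christoffel \<gamma> \<alpha> \<kappa> p * christoffel \<delta> \<kappa> \<beta> p)" for \<gamma>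
      by (rule sum.swap)
    have "?L = (\<Sum>\<gamma>\<in>UNIV. \<Sum>\<delta>\<in>UNIV. (w $ \<gamma> * v $ \<delta> - v $ \<gamma> * w $ \<delta>) * ?S \<gamma> \<delta>) + ?R"
      unfolding dir_deriv_expand[OF p] swap
      by (simp add: algebra_simps sum.distrib sum_subtractf sum_distrib_left)
    also have "(\<Sum>\<gamma>\<in>UNIV. \<Sum>\<delta>\<in>UNIV. (w $ \<gamma> * v $ \<delta> - v $ \<gamma> * w $ \<delta>) * ?S \<gamma> \<delta>) = 0"
      by (rule antisymmetric_sum_zero) (simp, rule christoffel_symmetry[OF p])
    finally show ?thesis by simp
  qed
  then show ?thesis by (simp add: curv_def)
qed

text \<open>Pairing with \<open>H\<close> turns \<open>d_zbar\<close> of the coefficients into minus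
  the Chern curvature; the sign is absorbed by reversing the difference in the last factor.\<close>

lemma h_curv:
  assumes p: "p \<in> dom_of c"
  shows "h p (hvec p (curv p u v w)) (hvec p y) = (\<Sum>\<alpha>\<in>UNIV. \<Sum>\<beta>\<in>UNIV. \<Sum>\<gamma>\<in>UNIV. \<Sum>\<delta>\<in>UNIV.
    R p \<alpha> \<beta> \<gamma> \<delta> * (u $ \<alpha> * cnj (y $ \<beta>)) * (v $ \<gamma> * cnj (w $ \<delta>) - w $ \<gamma> * cnj (v $ \<delta>)))"
proof -
  let ?T = "\<lambda>\<gamma> \<delta>. w $ \<gamma> * cnj (v $ \<delta>) - v $ \<gamma> * cnj (w $ \<delta>)"
  let ?Q = "\<lambda>\<gamma> \<delta> \<alpha> \<kappa>. d_zbar A c \<delta> p (christoffel \<gamma> \<alpha> \<kappa>)"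
  let ?F = "\<lambda>\<alpha> \<beta> \<gamma> \<delta> \<kappa>. u $ \<alpha> * cnj (y $ \<beta>) * ?T \<gamma> \<delta> * (?Q \<gamma> \<delta> \<alpha> \<kappa> * H \<kappa> \<beta> p)"
  have "h p (hvec p (curv p u v w)) (hvec p y)
      = (\<Sum>\<kappa>\<in>UNIV. \<Sum>\<beta>\<in>UNIV. \<Sum>\<alpha>\<in>UNIV. \<Sum>\<gamma>\<in>UNIV. \<Sum>\<delta>\<in>UNIV. ?F \<alpha> \<beta> \<gamma> \<delta> \<kappa>)"
    unfolding h_hvec[OF p] curv_eq[OF p] by (simp only: sum_distrib_left sum_distrib_right mult_ac)
  \<comment> \<open>The sum over \<kappa> has to become innermost, where it contracts the
    coefficients with the metric.\<close>
  also have "\<dots> = (\<Sum>\<alpha>\<in>UNIV. \<Sum>\<beta>\<in>UNIV. \<Sum>\<gamma>\<in>UNIV. \<Sum>\<delta>\<in>UNIV. \<Sum>\<kappa>\<in>UNIV. ?F \<alpha> \<beta> \<gamma> \<delta> \<kappa>)"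
  proof -
    have "(\<Sum>\<kappa>\<in>UNIV. \<Sum>\<beta>\<in>UNIV. \<Sum>\<alpha>\<in>UNIV. \<Sum>\<gamma>\<in>UNIV. \<Sum>\<delta>\<in>UNIV. ?F \<alpha> \<beta> \<gamma> \<delta> \<kappa>)
       = (\<Sum>\<alpha>\<in>UNIV. \<Sum>\<gamma>\<in>UNIV. \<Sum>\<kappa>\<in>UNIV. \<Sum>\<beta>\<in>UNIV. \<Sum>\<delta>\<in>UNIV. ?F \<alpha> \<beta> \<gamma> \<delta> \<kappa>)"
      by (rule sum_swap_pairs)
    also have "\<dots> = (\<Sum>\<alpha>\<in>UNIV. \<Sum>\<gamma>\<in>UNIV. \<Sum>\<beta>\<in>UNIV. \<Sum>\<kappa>\<in>UNIV. \<Sum>\<delta>\<in>UNIV. ?F \<alpha> \<beta> \<gamma> \<delta> \<kappa>)"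
      by (rule sum.cong[OF refl], rule sum.cong[OF refl], rule sum.swap)
    also have "\<dots> = (\<Sum>\<alpha>\<in>UNIV. \<Sum>\<beta>\<in>UNIV. \<Sum>\<gamma>\<in>UNIV. \<Sum>\<kappa>\<in>UNIV. \<Sum>\<delta>\<in>UNIV. ?F \<alpha> \<beta> \<gamma> \<delta> \<kappa>)"
      by (rule sum.cong[OF refl]) (rule sum.swap)
    also have "\<dots> = (\<Sum>\<alpha>\<in>UNIV. \<Sum>\<beta>\<in>UNIV. \<Sum>\<gamma>\<in>UNIV. \<Sum>\<delta>\<in>UNIV. \<Sum>\<kappa>\<in>UNIV. ?F \<alpha> \<beta> \<gamma> \<delta> \<kappa>)"
      by (rule sum.cong[OF refl], rule sum.cong[OF refl], rule sum.cong[OF refl], rule sum.swap)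
    finally show ?thesis .
  qed
  also have "\<dots> = (\<Sum>\<alpha>\<in>UNIV. \<Sum>\<beta>\<in>UNIV. \<Sum>\<gamma>\<in>UNIV. \<Sum>\<delta>\<in>UNIV.
    R p \<alpha> \<beta> \<gamma> \<delta> * (u $ \<alpha> * cnj (y $ \<beta>)) * (v $ \<gamma> * cnj (w $ \<delta>) - w $ \<gamma> * cnj (v $ \<delta>)))"
    unfolding sum_distrib_left[symmetric] R_eq_d_zbar_christoffel[OF p]
    by (intro sum.cong refl) (simp add: algebra_simps)
  finally show ?thesis .
qed

lemma g_curvature:
  assumes p: "p \<in> dom_of c"
  shows "complex_of_real (g_metric A h p
      (curvature A DT p (dir_deriv A c p \<xi>) (dir_deriv A c p \<eta>) (dir_deriv A c p \<xi>)) (dir_deriv A c p \<eta>)) =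
    1/2 * (\<Sum>\<alpha>\<in>UNIV. \<Sum>\<beta>\<in>UNIV. \<Sum>\<gamma>\<in>UNIV. \<Sum>\<delta>\<in>UNIV. R p \<alpha> \<beta> \<gamma> \<delta>
             * (\<xi> $ \<alpha> * cnj (\<eta> $ \<beta>) - \<eta> $ \<alpha> * cnj (\<xi> $ \<beta>))
             * (\<eta> $ \<gamma> * cnj (\<xi> $ \<delta>) - \<xi> $ \<gamma> * cnj (\<eta> $ \<delta>)))"
proof -
  let ?T = "\<lambda>\<gamma> \<delta>. \<eta> $ \<gamma> * cnj (\<xi> $ \<delta>) - \<xi> $ \<gamma> * cnj (\<eta> $ \<delta>)"
  define Z where "Z = h p (hvec p (curv p \<xi> \<eta> \<xi>)) (hvec p \<eta>)"
  have Z: "Z = (\<Sum>\<alpha>\<in>UNIV. \<Sum>\<beta>\<in>UNIV. \<Sum>\<gamma>\<in>UNIV. \<Sum>\<delta>\<in>UNIV. R p \<alpha> \<beta> \<gamma> \<delta> * (\<xi> $ \<alpha> * cnj (\<eta> $ \<beta>)) * ?T \<gamma> \<delta>)"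
    unfolding Z_def by (rule h_curv[OF p])
  \<comment> \<open>Conjugation sends \<open>?T \<gamma> \<delta>\<close> to
    \<open>- ?T \<delta> \<gamma>\<close> and exchanges both index pairs of the curvature. Swapping
    the sums accordingly gives \<open>Z\<close> with \<xi> and \<eta> exchanged in the first factor
    and the sign reversed, so adding \<open>Z\<close> antisymmetrises that factor.\<close>
  have "cnj Z = (\<Sum>\<alpha>\<in>UNIV. \<Sum>\<beta>\<in>UNIV. \<Sum>\<gamma>\<in>UNIV. \<Sum>\<delta>\<in>UNIV. - (R p \<beta> \<alpha> \<delta> \<gamma> * (\<eta> $ \<beta> * cnj (\<xi> $ \<alpha>)) * ?T \<delta> \<gamma>))"
    unfolding Z cnj_sum by (intro sum.cong refl) (simp add: cnj_R[OF p] algebra_simps)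
  also have "\<dots> = (\<Sum>\<beta>\<in>UNIV. \<Sum>\<alpha>\<in>UNIV. \<Sum>\<gamma>\<in>UNIV. \<Sum>\<delta>\<in>UNIV. - (R p \<beta> \<alpha> \<delta> \<gamma> * (\<eta> $ \<beta> * cnj (\<xi> $ \<alpha>)) * ?T \<delta> \<gamma>))"
    by (rule sum.swap)
  also have "\<dots> = (\<Sum>\<beta>\<in>UNIV. \<Sum>\<alpha>\<in>UNIV. \<Sum>\<delta>\<in>UNIV. \<Sum>\<gamma>\<in>UNIV. - (R p \<beta> \<alpha> \<delta> \<gamma> * (\<eta> $ \<beta> * cnj (\<xi> $ \<alpha>)) * ?T \<delta> \<gamma>))"
    by (rule sum.cong[OF refl], rule sum.cong[OF refl], rule sum.swap)
  finally have "Z + cnj Z = (\<Sum>\<alpha>\<in>UNIV. \<Sum>\<beta>\<in>UNIV. \<Sum>\<gamma>\<in>UNIV. \<Sum>\<delta>\<in>UNIV. R p \<alpha> \<beta> \<gamma> \<delta>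
             * (\<xi> $ \<alpha> * cnj (\<eta> $ \<beta>) - \<eta> $ \<alpha> * cnj (\<xi> $ \<beta>)) * ?T \<gamma> \<delta>)"
    unfolding Z by (simp add: algebra_simps sum.distrib sum_subtractf)
  moreover have "complex_of_real (Re Z) = 1/2 * (Z + cnj Z)"
    by (simp add: complex_add_cnj)
  ultimately show ?thesis
    by (simp add: g_metric_def curvature_eq[OF p] to10_dir_deriv[OF p] flip: Z_def)
qed

end

section \<open>The formulas in the given components\<close>

theorem theorem1p1:
  fixes A :: "('a::{t2_space, second_countable_topology}, 'n::finite) chart set"
    and h :: "'a \<Rightarrow> 'a tvec \<Rightarrow> 'a tvec \<Rightarrow> complex"
    and D0 D :: "'a conn"
    and p :: 'a and c :: "('a, 'n) chart" and u v :: "'a tvec" and \<xi> \<eta> :: "'n \<Rightarrow> complex"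
  assumes "hermitian_manifold A h"
    and "chern_connection A h D0"
    and "D = induced_connection A D0"
    and "c \<in> A" and "p \<in> dom_of c"
    and "u \<in> tangent A p" and "v \<in> tangent A p"
    and "to10 A p u = (\<Sum>\<alpha>\<in>UNIV. \<xi> \<alpha> \<odot> d_z A c \<alpha> p)"
    and "to10 A p v = (\<Sum>\<alpha>\<in>UNIV. \<eta> \<alpha> \<odot> d_z A c \<alpha> p)"
  shows "complex_of_real (g_metric A h p (curvature A D p u v u) v) =
           1/2 * (\<Sum>\<alpha>\<in>UNIV. \<Sum>\<beta>\<in>UNIV. \<Sum>\<gamma>\<in>UNIV. \<Sum>\<delta>\<in>UNIV.
             chern_curvature A h c p \<alpha> \<beta> \<gamma> \<delta>
             * (\<xi> \<alpha> * cnj (\<eta> \<beta>) - \<eta> \<alpha> * cnj (\<xi> \<beta>))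
             * (\<eta> \<gamma> * cnj (\<xi> \<delta>) - \<xi> \<gamma> * cnj (\<eta> \<delta>)))
       \<and> complex_of_real (g_metric A h p (curvature A D p u (J_map A p u) u) (J_map A p u)) =
           2 * (\<Sum>\<alpha>\<in>UNIV. \<Sum>\<beta>\<in>UNIV. \<Sum>\<gamma>\<in>UNIV. \<Sum>\<delta>\<in>UNIV.
             chern_curvature A h c p \<alpha> \<beta> \<gamma> \<delta> * \<xi> \<alpha> * cnj (\<xi> \<beta>) * \<xi> \<gamma> * cnj (\<xi> \<delta>))"
proof -
  interpret chern_chart A c h D0
    using assms(1,2,4) by unfold_locales (simp_all add: hermitian_manifold_def)
  note p = assms(5)
  \<comment> \<open>As \<open>to10\<close> preserves components and frame components are unique, the
    expansion of \<open>to10 A p X\<close> determines \<open>X\<close>.\<close>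
  have eqI: "X = dir_deriv A c p (\<chi> \<alpha>. x \<alpha>)"
    if X: "X \<in> tangent A p" and x: "to10 A p X = (\<Sum>\<alpha>\<in>UNIV. x \<alpha> \<odot> d_z A c \<alpha> p)" for X x
  proof -
    obtain w where w: "X = dir_deriv A c p w" using tangentE[OF X p] by metis
    have "hvec p w = hvec p (\<chi> \<alpha>. x \<alpha>)"
      using x unfolding w to10_dir_deriv[OF p] by (simp only: hvec_def vec_lambda_beta)
    then show ?thesis by (simp add: w hvec_eq_iff[OF p])
  qed
  have u: "u = dir_deriv A c p (\<chi> \<alpha>. \<xi> \<alpha>)" by (rule eqI[OF assms(6,8)])
  have v: "v = dir_deriv A c p (\<chi> \<alpha>. \<eta> \<alpha>)" by (rule eqI[OF assms(7,9)])
  have Ju: "J_map A p u = dir_deriv A c p (\<i> *s (\<chi> \<alpha>. \<xi> \<alpha>))"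
    unfolding u by (rule J_map_dir_deriv[OF p])
  \<comment> \<open>With \<eta> equal to \<i> times \<xi>, the two difference factors are -2\<i> and
    2\<i> times a component of \<xi> and a conjugate one. Their product gives 4, which the factor
    1/2 turns into 2.\<close>
  have "(\<Sum>\<alpha>\<in>UNIV. \<Sum>\<beta>\<in>UNIV. \<Sum>\<gamma>\<in>UNIV. \<Sum>\<delta>\<in>UNIV. chern_curvature A h c p \<alpha> \<beta> \<gamma> \<delta>
             * (\<xi> \<alpha> * cnj (\<i> * \<xi> \<beta>) - (\<i> * \<xi> \<alpha>) * cnj (\<xi> \<beta>))
             * ((\<i> * \<xi> \<gamma>) * cnj (\<xi> \<delta>) - \<xi> \<gamma> * cnj (\<i> * \<xi> \<delta>)))
      = (\<Sum>\<alpha>\<in>UNIV. \<Sum>\<beta>\<in>UNIV. \<Sum>\<gamma>\<in>UNIV. \<Sum>\<delta>\<in>UNIV.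
             4 * (chern_curvature A h c p \<alpha> \<beta> \<gamma> \<delta> * \<xi> \<alpha> * cnj (\<xi> \<beta>) * \<xi> \<gamma> * cnj (\<xi> \<delta>)))"
    by (intro sum.cong refl) (simp add: algebra_simps)
  also have "\<dots> = 4 * (\<Sum>\<alpha>\<in>UNIV. \<Sum>\<beta>\<in>UNIV. \<Sum>\<gamma>\<in>UNIV. \<Sum>\<delta>\<in>UNIV.
             chern_curvature A h c p \<alpha> \<beta> \<gamma> \<delta> * \<xi> \<alpha> * cnj (\<xi> \<beta>) * \<xi> \<gamma> * cnj (\<xi> \<delta>))"
    by (simp only: sum_distrib_left)
  finally have 4: "1/2 * (\<Sum>\<alpha>\<in>UNIV. \<Sum>\<beta>\<in>UNIV. \<Sum>\<gamma>\<in>UNIV. \<Sum>\<delta>\<in>UNIV. chern_curvature A h c p \<alpha> \<beta> \<gamma> \<delta>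
             * (\<xi> \<alpha> * cnj (\<i> * \<xi> \<beta>) - (\<i> * \<xi> \<alpha>) * cnj (\<xi> \<beta>))
             * ((\<i> * \<xi> \<gamma>) * cnj (\<xi> \<delta>) - \<xi> \<gamma> * cnj (\<i> * \<xi> \<delta>)))
      = 2 * (\<Sum>\<alpha>\<in>UNIV. \<Sum>\<beta>\<in>UNIV. \<Sum>\<gamma>\<in>UNIV. \<Sum>\<delta>\<in>UNIV.
             chern_curvature A h c p \<alpha> \<beta> \<gamma> \<delta> * \<xi> \<alpha> * cnj (\<xi> \<beta>) * \<xi> \<gamma> * cnj (\<xi> \<delta>))"
    by simp
  show ?thesis
    unfolding assms(3)
  proof
    show "complex_of_real (g_metric A h p (curvature A DT p u v u) v) =
           1/2 * (\<Sum>\<alpha>\<in>UNIV. \<Sum>\<beta>\<in>UNIV. \<Sum>\<gamma>\<in>UNIV. \<Sum>\<delta>\<in>UNIV.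
             chern_curvature A h c p \<alpha> \<beta> \<gamma> \<delta>
             * (\<xi> \<alpha> * cnj (\<eta> \<beta>) - \<eta> \<alpha> * cnj (\<xi> \<beta>))
             * (\<eta> \<gamma> * cnj (\<xi> \<delta>) - \<xi> \<gamma> * cnj (\<eta> \<delta>)))"
      unfolding u v g_curvature[OF p] vec_lambda_beta ..
    show "complex_of_real (g_metric A h p (curvature A DT p u (J_map A p u) u) (J_map A p u)) =
           2 * (\<Sum>\<alpha>\<in>UNIV. \<Sum>\<beta>\<in>UNIV. \<Sum>\<gamma>\<in>UNIV. \<Sum>\<delta>\<in>UNIV.
             chern_curvature A h c p \<alpha> \<beta> \<gamma> \<delta> * \<xi> \<alpha> * cnj (\<xi> \<beta>) * \<xi> \<gamma> * cnj (\<xi> \<delta>))"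
      unfolding Ju unfolding u g_curvature[OF p] vector_smult_component vec_lambda_beta by (rule 4)
  qed
qed

end
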